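(* If the graphon $W$ is piecewise Lipschitz, then the clustering method $f$ "clustering by neighborhood smoothing" (single-linkage clustering of the modified neighborhood smoothing estimate $\hat P$) is a consistent estimator of the graphon cluster tree of $W$.
   Context: Graphons and clusters. $\mu$ is Lebesgue measure on $[0,1]$ and $\Sigma$ the Lebesgue measurable subsets. A graphon is a symmetric measurable $W:[0,1]^2\to[0,1]$. A measurable $A\subset[0,1]$ with $\mu(A)>0$ is disconnected at level $\lambda$ in $W$ if there is a measurable $S\subset A$ with $0<\mu(S)<\mu(A)$ and $W<\lambda$ a.e. on $S\times(A\setminus S)$; otherwise $A$ is connected at level $\lambda$. Let $\mathfrak A_\lambda$ be the collection of $A\in\Sigma$ with $\mu(A)>0$ that are connected at every level $\lambda'<\lambda$. For $A_1,A_2\in\mathfrak A_\lambda$ write $A_1\sim_\lambda A_2$ iff some $A\in\mathfrak A_\lambda$ has $A\supset A_1\cup A_2$; this is an equivalence relation. For each equivalence class $\mathscr A$, the essential maxima are the $A^*\in\mathscr A$ with $\mu(A\setminus A^* )=0$ for all $A\in\mathscr A$; they exist and are unique up to null sets. The clusters of $W$ at level $\lambda$ are the classes of measurable sets modulo null sets $\mathcal C=\operatorname{ess\,max}\mathscr A$; $\mathbb C_W(\lambda)$ is the (countable) collection of them, and the family $\mathbb C_W$ is the graphon cluster tree of $W$. Mergeon. A mergeon of $W$ is a graphon $M$ such that for every $\lambda\in[0,1]$, $\{(x,y):M(x,y)\ge\lambda\}$ equals $\bigcup_{\mathcal C\in\mathbb C_W(\lambda)}\mathcal C\times\mathcal C$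 up to a null set. Any two mergeons of $W$ agree a.e. Clusterings and merge distortion. A clustering of a finite set $S$ is a collection $\mathsf C$ of subsets of $S$ with $S\in\mathsf C$ such that any two members are nested or disjoint. For $S\subset[0,1]$ finite, a clustering $\mathsf C$ of $S$ and a mergeon $M$, the induced merge height is $\hat M_{\mathsf C}(s,s')=\min\{M(u,v):u,v\in \mathsf C(s,s'),\,u\ne v\}$ for $s\neq s'$, where $\mathsf C(s,s')$ is the smallest member of $\mathsf C$ containing $s$ and $s'$. The merge distortion is $d_S(M,\hat M_{\mathsf C})=\max_{s\ne s'\in S}|M(s,s')-\hat M_{\mathsf C}(s,s')|$. Label measure and consistency. Let $\mathcal G_n$ be the set of simple undirected graphs on $[n]=\{1,\dots,n\}$. $\Lambda_{W,n}$ is the probability measure on $\mathcal G_n\times[0,1]^n$ with $\Lambda_{W,n}(\mathcal G\times\mathcal S)=\sum_{G\in\mathcal G}\int_{\mathcal S}\prod_{\{i,j\}\in E(G)}W(x_i,x_j)\prod_{\{i,j\}\notin E(G)}[1-W(x_i,x_j)]\,dx_1\cdots dx_n$ (products over unordered pairs $i\ne j$). A hierarchical graph clustering method $f$ assigns to every $G\in\mathcal G_n$ a clustering of $[n]$; $f(G)\circ S$ is the clustering of $S=(x_1,\dots,x_n)$ obtained by replacing $i$ by $x_i$. $f$ is a consistent estimator of the graphon cluster tree of $W$ if, for every mergeon $M$ of $W$ and every $\epsilon>0$, $\Lambda_{W,n}\big(\{(G,S):d_S(M,\hat M_{f(G)\circ S})>\epsilon\}\big)\to0$ as $n\to\infty$.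 Piecewise Lipschitz. $W$ is piecewise Lipschitz if for some $c\ge0$ there is a finite partition $\{B_1,\dots,B_k\}$ of $[0,1]$ into disjoint (open, half-open or closed) intervals of positive length such that $|W(x,y)-W(x',y')|\le c(|x-x'|+|y-y'|)$ for all $(x,y),(x',y')\in B_i\times B_j$ and all $i,j$. The method $f$. Fix a constant $C\in(0,1)$. Given the adjacency matrix $A$ (symmetric, zero diagonal) of $G\in\mathcal G_n$, set $h=C\sqrt{(\log n)/n}$. Let $\partial_jA$ be $A$ with row and column $j$ set to zero; for distinct $i,i',j$ put $d_j(i,i')=\max_{k\ne i,i',j}|((\partial_jA)^2/n)_{ik}-((\partial_jA)^2/n)_{i'k}|$. For $i\ne j$ let $q_{i\setminus j}$ be the $h$-th quantile of $\{d_j(i,i'):i'\ne i,j\}$ (the smallest $q$ such that at least a fraction $h$ of these values are $\le q$), $\mathcal N_{i\setminus j}=\{i'\ne i,j:d_j(i,i')\le q_{i\setminus j}\}$, and $\hat P_{ij}=\frac12\big(\frac1{|\mathcal N_{i\setminus j}|}\sum_{i'\in\mathcal N_{i\setminus j}}A_{i'j}+\frac1{|\mathcal N_{j\setminus i}|}\sum_{j'\in\mathcal N_{j\setminus i}}A_{ij'}\big)$. Then $f(G)$ is the single-linkage clustering of $\hat P$: the set of all connected components, over all $\lambda\in\mathbb R$, of the graph on $[n]$ joining $i\ne j$ whenever $\hat P_{ij}\ge\lambda$. *)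

theory Defs
  imports "HOL-Analysis.Analysis"
begin

definition graphon :: "(real \<Rightarrow> real \<Rightarrow> real) \<Rightarrow> bool" where
  "graphon W \<longleftrightarrow>
     (\<lambda>(x, y). W x y) \<in> borel_measurable (lebesgue_on ({0..1} \<times> {0..1})) \<and>
     (\<forall>x\<in>{0..1}. \<forall>y\<in>{0..1}. W x y = W y x \<and> 0 \<le> W x y \<and> W x y \<le> 1)"

definition disconnected_at :: "(real \<Rightarrow> real \<Rightarrow> real) \<Rightarrow> real \<Rightarrow> real set \<Rightarrow> bool" where
  "disconnected_at W l A \<longleftrightarrow>
     (\<exists>S. S \<in> sets lebesgue \<and> S \<subseteq> A \<and> 0 < measure lebesgue S \<and> measure lebesgue S < measure lebesgue A \<and>
        (AE (x, y) in lebesgue. x \<in> S \<and> y \<in> A - S \<longrightarrow> W x y < l))"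

definition conn_sets :: "(real \<Rightarrow> real \<Rightarrow> real) \<Rightarrow> real \<Rightarrow> real set set" where
  "conn_sets W l =
     {A \<in> sets lebesgue. A \<subseteq> {0..1} \<and> 0 < measure lebesgue A \<and> (\<forall>l'<l. \<not> disconnected_at W l' A)}"

definition conn_rel :: "(real \<Rightarrow> real \<Rightarrow> real) \<Rightarrow> real \<Rightarrow> (real set \<times> real set) set" where
  "conn_rel W l =
     {(A1, A2). A1 \<in> conn_sets W l \<and> A2 \<in> conn_sets W l \<and> (\<exists>A\<in>conn_sets W l. A1 \<union> A2 \<subseteq> A)}"

definition ess_max :: "real set set \<Rightarrow> real set set" where
  "ess_max \<A> = {A' \<in> \<A>. \<forall>A\<in>\<A>. A - A' \<in> null_sets lebesgue}"

text \<open>A cluster is a class of sets modulo null sets, represented by the set of all its members.\<close>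

definition clusters :: "(real \<Rightarrow> real \<Rightarrow> real) \<Rightarrow> real \<Rightarrow> real set set set" where
  "clusters W l = ess_max ` (conn_sets W l // conn_rel W l)"

text \<open>The union is formed with one representative \<open>r \<C>\<close> of each cluster; as there are only
  countably many clusters, the choice of representatives changes it by a null set only.\<close>

definition mergeon :: "(real \<Rightarrow> real \<Rightarrow> real) \<Rightarrow> (real \<Rightarrow> real \<Rightarrow> real) \<Rightarrow> bool" where
  "mergeon W M \<longleftrightarrow> graphon M \<and>
     (\<forall>l\<in>{0..1}. \<exists>r. (\<forall>\<C>\<in>clusters W l. r \<C> \<in> \<C>) \<and>
        sym_diff {(x, y). x \<in> {0..1} \<and> y \<in> {0..1} \<and> l \<le> M x y} (\<Union>\<C>\<in>clusters W l. r \<C> \<times> r \<C>)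
          \<in> null_sets lebesgue)"

definition piecewise_lipschitz :: "(real \<Rightarrow> real \<Rightarrow> real) \<Rightarrow> bool" where
  "piecewise_lipschitz W \<longleftrightarrow>
     (\<exists>c\<ge>0. \<exists>P. finite P \<and> partition_on {0..1} P \<and>
        (\<forall>B\<in>P. is_interval B \<and> 0 < measure lebesgue B) \<and>
        (\<forall>B\<in>P. \<forall>B'\<in>P. \<forall>x\<in>B. \<forall>x'\<in>B. \<forall>y\<in>B'. \<forall>y'\<in>B'.
           \<bar>W x y - W x' y'\<bar> \<le> c * (\<bar>x - x'\<bar> + \<bar>y - y'\<bar>)))"

definition clustering :: "'a set \<Rightarrow> 'a set set \<Rightarrow> bool" where
  "clustering S \<C> \<longleftrightarrow> \<C> \<subseteq> Pow S \<and> S \<in> \<C> \<and> (\<forall>A\<in>\<C>. \<forall>B\<in>\<C>. A \<subseteq> B \<or> B \<subseteq> A \<or> A \<inter> B = {})"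

text \<open>\<open>Least\<close> refers to the order on sets, i.e.\ to inclusion.\<close>

definition smallest_cluster :: "'a set set \<Rightarrow> 'a \<Rightarrow> 'a \<Rightarrow> 'a set" where
  "smallest_cluster \<C> s s' = (LEAST A. A \<in> \<C> \<and> s \<in> A \<and> s' \<in> A)"

definition merge_height :: "(real \<Rightarrow> real \<Rightarrow> real) \<Rightarrow> real set set \<Rightarrow> real \<Rightarrow> real \<Rightarrow> real" where
  "merge_height M \<C> s s' =
     Min {M u v | u v. u \<in> smallest_cluster \<C> s s' \<and> v \<in> smallest_cluster \<C> s s' \<and> u \<noteq> v}"

definition merge_distortion :: "real set \<Rightarrow> (real \<Rightarrow> real \<Rightarrow> real) \<Rightarrow> (real \<Rightarrow> real \<Rightarrow> real) \<Rightarrow> real" where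
  "merge_distortion S M M' = Max {\<bar>M s s' - M' s s'\<bar> | s s'. s \<in> S \<and> s' \<in> S \<and> s \<noteq> s'}"

text \<open>A simple graph on \<open>{1..n}\<close> is given by its set of edges.\<close>

definition graphs :: "nat \<Rightarrow> nat set set set" where
  "graphs n = Pow {e. e \<subseteq> {1..n} \<and> card e = 2}"

definition label_density :: "(real \<Rightarrow> real \<Rightarrow> real) \<Rightarrow> nat \<Rightarrow> nat set set \<Rightarrow> (nat \<Rightarrow> real) \<Rightarrow> real" where
  "label_density W n G x =
     (\<Prod>(i, j) | 1 \<le> i \<and> i < j \<and> j \<le> n \<and> {i, j} \<in> G. W (x i) (x j)) *
     (\<Prod>(i, j) | 1 \<le> i \<and> i < j \<and> j \<le> n \<and> {i, j} \<notin> G. 1 - W (x i) (x j))"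

text \<open>The product measure on the cube is completed, i.e.\ it is \<open>n\<close>-dimensional Lebesgue measure.
  Without the completion a function \<open>\<lambda>x. M (x i) (x j)\<close> with \<open>M\<close> Lebesgue measurable on the square
  need not be measurable.\<close>

definition label_measure :: "(real \<Rightarrow> real \<Rightarrow> real) \<Rightarrow> nat \<Rightarrow> (nat set set \<times> (nat \<Rightarrow> real)) measure" where
  "label_measure W n =
     density (count_space (graphs n) \<Otimes>\<^sub>M completion (\<Pi>\<^sub>M i\<in>{1..n}. lebesgue_on {0..1}))
       (\<lambda>(G, x). ennreal (label_density W n G x))"

definition graph_clustering_method :: "(nat \<Rightarrow> nat set set \<Rightarrow> nat set set) \<Rightarrow> bool" where
  "graph_clustering_method f \<longleftrightarrow> (\<forall>n\<ge>1. \<forall>G\<in>graphs n. clustering {1..n} (f n G))"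

definition relabel :: "'a set set \<Rightarrow> ('a \<Rightarrow> 'b) \<Rightarrow> 'b set set" where
  "relabel \<C> x = (\<lambda>A. x ` A) ` \<C>"

definition distortion_event ::
  "(nat \<Rightarrow> nat set set \<Rightarrow> nat set set) \<Rightarrow> (real \<Rightarrow> real \<Rightarrow> real) \<Rightarrow> (real \<Rightarrow> real \<Rightarrow> real) \<Rightarrow> real \<Rightarrow> nat
     \<Rightarrow> (nat set set \<times> (nat \<Rightarrow> real)) set" where
  "distortion_event f W M e n =
     {(G, x) \<in> space (label_measure W n).
        e < merge_distortion (x ` {1..n}) M (merge_height M (relabel (f n G) x))}"

text \<open>Measurability of the events is required explicitly because \<open>measure\<close> is \<open>0\<close> on
  non-measurable sets.\<close>

definition consistent_estimator ::
  "(nat \<Rightarrow> nat set set \<Rightarrow> nat set set) \<Rightarrow> (real \<Rightarrow> real \<Rightarrow> real) \<Rightarrow> bool" where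
  "consistent_estimator f W \<longleftrightarrow> graph_clustering_method f \<and>
     (\<forall>M e. mergeon W M \<and> 0 < e \<longrightarrow>
        (\<forall>n\<ge>1. distortion_event f W M e n \<in> sets (label_measure W n)) \<and>
        (\<lambda>n. measure (label_measure W n) (distortion_event f W M e n)) \<longlonglongrightarrow> 0)"

definition adjacency :: "nat set set \<Rightarrow> nat \<Rightarrow> nat \<Rightarrow> real" where
  "adjacency G i j = (if {i, j} \<in> G then 1 else 0)"

definition delete_vertex :: "nat \<Rightarrow> (nat \<Rightarrow> nat \<Rightarrow> real) \<Rightarrow> nat \<Rightarrow> nat \<Rightarrow> real" where
  "delete_vertex j A i k = (if i = j \<or> k = j then 0 else A i k)"

definition mat_square :: "nat \<Rightarrow> (nat \<Rightarrow> nat \<Rightarrow> real) \<Rightarrow> nat \<Rightarrow> nat \<Rightarrow> real" where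
  "mat_square n A i k = (\<Sum>l\<in>{1..n}. A i l * A l k)"

definition nbhd_dist :: "nat \<Rightarrow> (nat \<Rightarrow> nat \<Rightarrow> real) \<Rightarrow> nat \<Rightarrow> nat \<Rightarrow> nat \<Rightarrow> real" where
  "nbhd_dist n A j i i' =
     Max ((\<lambda>k. \<bar>mat_square n (delete_vertex j A) i k / real n
                - mat_square n (delete_vertex j A) i' k / real n\<bar>) ` ({1..n} - {i, i', j}))"

text \<open>The quantile of a finite family: values are counted with multiplicity.\<close>

definition quantile :: "real \<Rightarrow> 'a set \<Rightarrow> ('a \<Rightarrow> real) \<Rightarrow> real" where
  "quantile h I v = (LEAST q. h * real (card I) \<le> real (card {i \<in> I. v i \<le> q}))"

definition bandwidth :: "real \<Rightarrow> nat \<Rightarrow> real" where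
  "bandwidth C n = C * sqrt (ln (real n) / real n)"

definition nbhd :: "real \<Rightarrow> nat \<Rightarrow> (nat \<Rightarrow> nat \<Rightarrow> real) \<Rightarrow> nat \<Rightarrow> nat \<Rightarrow> nat set" where
  "nbhd C n A i j =
     {i' \<in> {1..n} - {i, j}.
        nbhd_dist n A j i i' \<le> quantile (bandwidth C n) ({1..n} - {i, j}) (nbhd_dist n A j i)}"

definition smoothed :: "real \<Rightarrow> nat \<Rightarrow> (nat \<Rightarrow> nat \<Rightarrow> real) \<Rightarrow> nat \<Rightarrow> nat \<Rightarrow> real" where
  "smoothed C n A i j =
     1 / 2 * (1 / real (card (nbhd C n A i j)) * (\<Sum>i'\<in>nbhd C n A i j. A i' j) +
              1 / real (card (nbhd C n A j i)) * (\<Sum>j'\<in>nbhd C n A j i. A i j'))"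

text \<open>For a symmetric \<open>P\<close> the reflexive transitive closure is an equivalence relation on \<open>V\<close>, whose
  classes are the connected components of the graph thresholded at \<open>l\<close>.\<close>

definition single_linkage :: "'a set \<Rightarrow> ('a \<Rightarrow> 'a \<Rightarrow> real) \<Rightarrow> 'a set set" where
  "single_linkage V P =
     (\<Union>l::real. V // {(i, j). i \<in> V \<and> j \<in> V \<and> i \<noteq> j \<and> l \<le> P i j}\<^sup>*)"

definition nbhd_smoothing_clustering :: "real \<Rightarrow> nat \<Rightarrow> nat set set \<Rightarrow> nat set set" where
  "nbhd_smoothing_clustering C n G = single_linkage {1..n} (smoothed C n (adjacency G))"

end

theory Submission
  imports Defs "HOL-Probability.Probability" "HOL-Real_Asymp.Real_Asymp"
begin

text \<open>
  Cut \<open>[0,1]\<close> into finitely many cells of positive measure on whose products \<open>W\<close> oscillates little.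
  A path of cells along which \<open>W \<ge> l\<close> has a union that is connected at level \<open>l\<close>, and conversely a
  cluster of level \<open>l\<close> meets only cells joined by such a path at a slightly lower level; so up to a
  small error \<open>M x y\<close> is the bottleneck value of the best path of cells from \<open>x\<close> to \<open>y\<close>. With high
  probability every cell contains a positive fraction of the sample, and then paths of cells are paths of
  sample points. It therefore suffices that the smoothed matrix is uniformly close to \<open>W (x i) (x j)\<close>.

  For the latter, the common neighbour counts are uniformly close to their conditional means by
  exponential tail bounds. If \<open>i'\<close> is in the neighbourhood of \<open>i\<close>, testing with vertices \<open>k\<close> from the cells of
  \<open>i\<close> and of \<open>i'\<close> shows that \<open>W (x i)\<close> and \<open>W (x i')\<close> are close in mean square over the sample; as the cell
  of \<open>j\<close> has a positive fraction of the sample and \<open>W\<close> hardly oscillates on it, they are also close at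
  \<open>x j\<close>. Finally the neighbourhood of \<open>i\<close> is computed without the edges at \<open>j\<close>, so the average of the
  entries in column \<open>j\<close> over it concentrates.
\<close>

section \<open>Independent edges\<close>

text \<open>Two dependences shape the probabilistic half. A common neighbour count is a sum of
  products of edges, and the neighbourhood over which a column is averaged is itself random. Both
  yield to one tail bound for a block of independent edges whose coefficients may depend on all
  other edges and whose threshold is relative to a random quantity \<open>Q\<close> with a
  deterministic lower bound \<open>m\<close>. For the averages, \<open>Q\<close> is the size of the
  neighbourhood, and the quantile guarantees a size of order \<open>sqrt (n * ln n)\<close>. The
  failure probability is then exponentially small in that quantity, which survives a union bound
  over all pairs. The analytic half has another obstacle: a mergeon is determined only up to null
  sets, separately at each level. Comparisons of \<open>M\<close> with paths of cells are therefore
  almost everywhere statements, obtained from countably many rational levels and carried to the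
  sample through pairs of distinct coordinates.\<close>

definition bern_weight :: "('e \<Rightarrow> real) \<Rightarrow> 'e set \<Rightarrow> 'e set \<Rightarrow> real" where
  "bern_weight p E G = (\<Prod>e\<in>G. p e) * (\<Prod>e\<in>E - G. 1 - p e)"

text \<open>Once the labels are fixed the graph takes finitely many values, so its law is kept as a
  finite sum; measure theory is needed only for the labels.\<close>

definition bern_prob :: "('e \<Rightarrow> real) \<Rightarrow> 'e set \<Rightarrow> ('e set \<Rightarrow> bool) \<Rightarrow> real" where
  "bern_prob p E A = (\<Sum>G | G \<subseteq> E \<and> A G. bern_weight p E G)"

lemma bern_weight_nonneg:
  assumes "\<And>e. e \<in> E \<Longrightarrow> 0 \<le> p e \<and> p e \<le> 1" "G \<subseteq> E"
  shows "0 \<le> bern_weight p E G"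
  unfolding bern_weight_def using assms by (auto intro!: mult_nonneg_nonneg prod_nonneg)

text \<open>Expectations of products over independent edges factorize: expanding the product on the
  right chooses, for each subset \<open>J\<close>, the first summand on \<open>J\<close> and the
  second elsewhere.\<close>

lemma sum_bern_weight_prod:
  assumes "finite F"
  shows "(\<Sum>J\<in>Pow F. bern_weight p F J * (\<Prod>e\<in>F. g e (e \<in> J))) =
         (\<Prod>e\<in>F. p e * g e True + (1 - p e) * g e False)"
proof -
  have "bern_weight p F J * (\<Prod>e\<in>F. g e (e \<in> J)) =
      (\<Prod>e\<in>J. p e * g e True) * (\<Prod>e\<in>F - J. (1 - p e) * g e False)" if "J \<subseteq> F" for J
  proof -
    have "(\<Prod>e\<in>F. g e (e \<in> J)) = (\<Prod>e\<in>J. g e (e \<in> J)) * (\<Prod>e\<in>F - J. g e (e \<in> J))"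
      using assms that by (metis mult.commute prod.subset_diff)
    also have "\<dots> = (\<Prod>e\<in>J. g e True) * (\<Prod>e\<in>F - J. g e False)"
      by (intro arg_cong2[of _ _ _ _ "(*)"] prod.cong) auto
    finally show ?thesis by (simp add: bern_weight_def prod.distrib mult_ac)
  qed
  then show ?thesis using assms by (subst prod_add) (auto intro!: sum.cong)
qed

text \<open>Fubini for two disjoint blocks of edges. It permits conditioning: \<open>H\<close> is
  frozen while the sum over \<open>J\<close> is estimated.\<close>

lemma sum_bern_weight_split:
  assumes "finite E" "finite F" "E \<inter> F = {}"
  shows "(\<Sum>G\<in>Pow (E \<union> F). bern_weight p (E \<union> F) G * f G) =
     (\<Sum>H\<in>Pow E. bern_weight p E H * (\<Sum>J\<in>Pow F. bern_weight p F J * f (H \<union> J)))"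
proof -
  have w: "bern_weight p (E \<union> F) (H \<union> J) = bern_weight p E H * bern_weight p F J"
    if "H \<subseteq> E" "J \<subseteq> F" for H J
  proof -
    have "E \<union> F - (H \<union> J) = (E - H) \<union> (F - J)" using that assms(3) by blast
    moreover have "(\<Prod>e\<in>H \<union> J. p e) = (\<Prod>e\<in>H. p e) * (\<Prod>e\<in>J. p e)"
      using that assms by (intro prod.union_disjoint) (auto dest: finite_subset)
    moreover have "(\<Prod>e\<in>(E - H) \<union> (F - J). 1 - p e) = (\<Prod>e\<in>E - H. 1 - p e) * (\<Prod>e\<in>F - J. 1 - p e)"
      using that assms by (intro prod.union_disjoint) auto
    ultimately show ?thesis by (simp add: bern_weight_def mult_ac)
  qed
  have "(\<Sum>G\<in>Pow (E \<union> F). bern_weight p (E \<union> F) G * f G) =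
      (\<Sum>(H, J)\<in>Pow E \<times> Pow F. bern_weight p (E \<union> F) (H \<union> J) * f (H \<union> J))"
    by (rule sum.reindex_bij_witness[where i = "\<lambda>(H, J). H \<union> J" and j = "\<lambda>G. (G \<inter> E, G \<inter> F)"])
      (use assms in \<open>auto simp: Int_Un_distrib[symmetric] Int_absorb2\<close>)
  also have "\<dots> = (\<Sum>(H, J)\<in>Pow E \<times> Pow F. bern_weight p E H * (bern_weight p F J * f (H \<union> J)))"
    by (intro sum.cong) (auto simp: w)
  finally show ?thesis by (simp add: sum.cartesian_product[symmetric] sum_distrib_left)
qed

lemma sum_bern_weight_eq_1:
  assumes "finite E"
  shows "(\<Sum>G\<in>Pow E. bern_weight p E G) = 1"
  using sum_bern_weight_prod[OF assms, of p "\<lambda>_ _. 1"] by simp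

lemma bern_prob_le_1:
  assumes "finite E" "\<And>e. e \<in> E \<Longrightarrow> 0 \<le> p e \<and> p e \<le> 1"
  shows "bern_prob p E A \<le> 1"
proof -
  have "bern_prob p E A \<le> (\<Sum>G\<in>Pow E. bern_weight p E G)"
    unfolding bern_prob_def using assms by (intro sum_mono2) (auto intro!: bern_weight_nonneg)
  then show ?thesis using assms sum_bern_weight_eq_1 by metis
qed

lemma bern_prob_mono:
  assumes "finite E" "\<And>e. e \<in> E \<Longrightarrow> 0 \<le> p e \<and> p e \<le> 1" "\<And>G. G \<subseteq> E \<Longrightarrow> A G \<Longrightarrow> B G"
  shows "bern_prob p E A \<le> bern_prob p E B"
  unfolding bern_prob_def using assms by (intro sum_mono2) (auto intro!: bern_weight_nonneg)

lemma bern_prob_disj: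
  assumes "finite E" "\<And>e. e \<in> E \<Longrightarrow> 0 \<le> p e \<and> p e \<le> 1"
  shows "bern_prob p E (\<lambda>G. A G \<or> B G) \<le> bern_prob p E A + bern_prob p E B"
proof -
  have "{G. G \<subseteq> E \<and> (A G \<or> B G)} = {G. G \<subseteq> E \<and> A G} \<union> {G. G \<subseteq> E \<and> B G}" by auto
  moreover have "0 \<le> sum (bern_weight p E) ({G. G \<subseteq> E \<and> A G} \<inter> {G. G \<subseteq> E \<and> B G})"
    using assms by (intro sum_nonneg) (auto intro!: bern_weight_nonneg)
  ultimately show ?thesis
    unfolding bern_prob_def using assms(1) by (simp add: sum_Un)
qed

lemma bern_prob_Ex:
  assumes "finite E" "\<And>e. e \<in> E \<Longrightarrow> 0 \<le> p e \<and> p e \<le> 1" "finite I"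
    and "\<And>i. i \<in> I \<Longrightarrow> bern_prob p E (A i) \<le> b"
  shows "bern_prob p E (\<lambda>G. \<exists>i\<in>I. A i G) \<le> real (card I) * b"
  using assms(3,4)
proof (induction I rule: finite_induct)
  case empty
  then show ?case by (simp add: bern_prob_def)
next
  case (insert i I)
  have "bern_prob p E (\<lambda>G. \<exists>i\<in>insert i I. A i G) \<le> bern_prob p E (A i) + bern_prob p E (\<lambda>G. \<exists>i\<in>I. A i G)"
    using bern_prob_disj[OF assms(1,2), where A = "A i" and B = "\<lambda>G. \<exists>i\<in>I. A i G"] by (simp cong: conj_cong)
  also have "\<dots> \<le> b + real (card I) * b"
    using insert by (intro add_mono) auto
  finally show ?case using insert by (simp add: algebra_simps)
qed

section \<open>Exponential tail bounds for weighted sums of independent edges\<close>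

lemma exp_le_quadratic:
  fixes y :: real
  assumes "\<bar>y\<bar> \<le> 1"
  shows "exp y \<le> 1 + y + y\<^sup>2"
proof (cases "0 \<le> y")
  case True
  then show ?thesis using assms exp_bound[of y] by simp
next
  case False
  then obtain z where z: "y = - z" "0 \<le> z" "z \<le> 1" using assms by (metis abs_minus_cancel abs_of_nonneg linorder_linear neg_0_le_iff_le minus_minus)
  \<comment> \<open>This identity turns a lower bound for \<open>exp z\<close> into an upper bound
    for \<open>exp (- z)\<close>, because the remainder on the right is nonnegative.\<close>
  have "(1 + z + z\<^sup>2/2) * (1 - z + z\<^sup>2) = 1 + z\<^sup>2/2 * (1 + z + z\<^sup>2)"
    by (simp add: field_simps power2_eq_square)
  then have "1 \<le> (1 + z + z\<^sup>2/2) * (1 - z + z\<^sup>2)" using z by simp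
  also have "\<dots> \<le> exp z * (1 - z + z\<^sup>2)"
    using exp_lower_Taylor_quadratic[of z] z by (intro mult_right_mono) auto
  finally have "exp (-z) \<le> 1 - z + z\<^sup>2" by (simp add: exp_minus field_simps)
  then show ?thesis using z by simp
qed

text \<open>The variable is centred, so the linear terms of the quadratic bound cancel and only the
  variance \<open>p * (1 - p)\<close>, at most 1, remains.\<close>

lemma bernoulli_mgf_le:
  fixes p y :: real
  assumes "0 \<le> p" "p \<le> 1" "\<bar>y\<bar> \<le> 1"
  shows "p * exp (y * (1 - p)) + (1 - p) * exp (- y * p) \<le> exp (y\<^sup>2)"
proof -
  have 1: "\<bar>y * (1 - p)\<bar> \<le> 1" "\<bar>- y * p\<bar> \<le> 1"
    using assms by (auto simp: abs_mult intro!: mult_le_one)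
  have "p * exp (y * (1 - p)) + (1 - p) * exp (- y * p) \<le>
      p * (1 + y * (1 - p) + (y * (1 - p))\<^sup>2) + (1 - p) * (1 + (- y * p) + (- y * p)\<^sup>2)"
    using assms 1 by (intro add_mono mult_left_mono exp_le_quadratic) auto
  also have "\<dots> = 1 + y\<^sup>2 * (p * (1 - p))" by (simp add: algebra_simps power2_eq_square)
  also have "\<dots> \<le> 1 + y\<^sup>2 * 1" using assms by (intro add_left_mono mult_left_mono mult_le_one) auto
  also have "\<dots> \<le> exp (y\<^sup>2)" using exp_ge_add_one_self[of "y\<^sup>2"] by simp
  finally show ?thesis .
qed

text \<open>Chernoff's method conditionally on the edges in \<open>E\<close>. The exponential
  parameter \<open>\<epsilon> / 2\<close> minimises \<open>s^2 * Q - s * \<epsilon> * Q\<close>. The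
  resulting bound decreases in \<open>Q H\<close>, so \<open>m\<close> makes it uniform in
  \<open>H\<close>, and averaging over \<open>H\<close> preserves it.\<close>

lemma bern_prob_upper_tail:
  assumes "finite E" "finite F" "E \<inter> F = {}"
    and p: "\<And>e. e \<in> E \<union> F \<Longrightarrow> 0 \<le> p e \<and> p e \<le> 1"
    and \<epsilon>: "0 \<le> \<epsilon>" "\<epsilon> \<le> 2"
    and c: "\<And>H e. H \<subseteq> E \<Longrightarrow> e \<in> F \<Longrightarrow> \<bar>c H e\<bar> \<le> 1"
    and Q: "\<And>H. H \<subseteq> E \<Longrightarrow> (\<Sum>e\<in>F. (c H e)\<^sup>2) \<le> Q H"
    and m: "\<And>H. H \<subseteq> E \<Longrightarrow> m \<le> Q H"
  shows "bern_prob p (E \<union> F)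
      (\<lambda>G. \<epsilon> * Q (G \<inter> E) \<le> (\<Sum>e\<in>F. c (G \<inter> E) e * (of_bool (e \<in> G) - p e)))
    \<le> exp (- (\<epsilon>\<^sup>2 * m / 4))"
proof -
  let ?X = "\<lambda>H J. \<Sum>e\<in>F. c H e * (of_bool (e \<in> J) - p e)"
  have inner: "(\<Sum>J\<in>Pow F. bern_weight p F J * exp (\<epsilon>/2 * (?X H J - \<epsilon> * Q H))) \<le> exp (- (\<epsilon>\<^sup>2 * m / 4))"
    if H: "H \<subseteq> E" for H
  proof -
    let ?y = "\<lambda>e. \<epsilon>/2 * c H e"
    have "exp (\<epsilon>/2 * (?X H J - \<epsilon> * Q H)) =
        exp (- (\<epsilon>\<^sup>2/2 * Q H)) * (\<Prod>e\<in>F. exp (?y e * (of_bool (e \<in> J) - p e)))" for J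
      using \<open>finite F\<close> by (simp add: exp_sum[symmetric] exp_add[symmetric] sum_distrib_left algebra_simps power2_eq_square diff_divide_distrib)
    then have "(\<Sum>J\<in>Pow F. bern_weight p F J * exp (\<epsilon>/2 * (?X H J - \<epsilon> * Q H))) =
        exp (- (\<epsilon>\<^sup>2/2 * Q H)) *
          (\<Sum>J\<in>Pow F. bern_weight p F J * (\<Prod>e\<in>F. exp (?y e * (of_bool (e \<in> J) - p e))))"
      by (simp add: sum_distrib_left mult_ac)
    also have "(\<Sum>J\<in>Pow F. bern_weight p F J * (\<Prod>e\<in>F. exp (?y e * (of_bool (e \<in> J) - p e)))) =
        (\<Prod>e\<in>F. p e * exp (?y e * (1 - p e)) + (1 - p e) * exp (- ?y e * p e))"
      using sum_bern_weight_prod[OF \<open>finite F\<close>, of p "\<lambda>e b. exp (?y e * (of_bool b - p e))"] by simp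
    also have "\<dots> \<le> (\<Prod>e\<in>F. exp ((?y e)\<^sup>2))"
    proof (intro prod_mono conjI bernoulli_mgf_le)
      fix e assume e: "e \<in> F"
      show "0 \<le> p e * exp (?y e * (1 - p e)) + (1 - p e) * exp (- ?y e * p e)" using p e by simp
      \<comment> \<open>The quadratic bound on the exponential needs exponents of modulus at most 1;
        this is where \<open>\<epsilon> \<le> 2\<close> enters.\<close>
      show "\<bar>?y e\<bar> \<le> 1" using \<epsilon> c[OF H e] mult_mono[of \<epsilon> 2 "\<bar>c H e\<bar>" 1] by (auto simp: abs_mult)
    qed (use p in auto)
    also have "\<dots> = exp (\<epsilon>\<^sup>2/4 * (\<Sum>e\<in>F. (c H e)\<^sup>2))"
      using \<open>finite F\<close> by (simp add: exp_sum[symmetric] sum_distrib_left power_mult_distrib power_divide)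
    also have "\<dots> \<le> exp (\<epsilon>\<^sup>2/4 * Q H)" using Q[OF H] by (simp add: mult_left_mono)
    finally have "(\<Sum>J\<in>Pow F. bern_weight p F J * exp (\<epsilon>/2 * (?X H J - \<epsilon> * Q H))) \<le>
       exp (- (\<epsilon>\<^sup>2/2 * Q H)) * exp (\<epsilon>\<^sup>2/4 * Q H)" by simp
    also have "\<dots> = exp (- (\<epsilon>\<^sup>2/4 * Q H))" by (simp add: exp_add[symmetric])
    also have "\<dots> \<le> exp (- (\<epsilon>\<^sup>2 * m / 4))"
      using mult_left_mono[OF m[OF H], of "\<epsilon>\<^sup>2/4"] by simp
    finally show ?thesis .
  qed
  let ?A = "\<lambda>G. \<epsilon> * Q (G \<inter> E) \<le> ?X (G \<inter> E) G"
  have "bern_prob p (E \<union> F) ?A = (\<Sum>G\<in>Pow (E \<union> F). bern_weight p (E \<union> F) G * of_bool (?A G))"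
    unfolding bern_prob_def using assms(1,2) by (intro sum.mono_neutral_cong_left) auto
  \<comment> \<open>Markov's inequality in pointwise form: the exponent is nonnegative on the
    event.\<close>
  also have "\<dots> \<le> (\<Sum>G\<in>Pow (E \<union> F). bern_weight p (E \<union> F) G * exp (\<epsilon>/2 * (?X (G \<inter> E) G - \<epsilon> * Q (G \<inter> E))))"
    using p \<epsilon> by (intro sum_mono mult_left_mono bern_weight_nonneg) auto
  also have "\<dots> = (\<Sum>H\<in>Pow E. bern_weight p E H * (\<Sum>J\<in>Pow F. bern_weight p F J *
      exp (\<epsilon>/2 * (?X ((H \<union> J) \<inter> E) (H \<union> J) - \<epsilon> * Q ((H \<union> J) \<inter> E)))))"
    using assms(1-3) by (rule sum_bern_weight_split)
  also have "\<dots> = (\<Sum>H\<in>Pow E. bern_weight p E H * (\<Sum>J\<in>Pow F. bern_weight p F J *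
      exp (\<epsilon>/2 * (?X H J - \<epsilon> * Q H))))"
  proof (intro sum.cong refl arg_cong2[of _ _ _ _ "(*)"] arg_cong[of _ _ exp])
    fix H J assume "H \<in> Pow E" "J \<in> Pow F"
    then have *: "(H \<union> J) \<inter> E = H" "\<And>e. e \<in> F \<Longrightarrow> e \<in> H \<union> J \<longleftrightarrow> e \<in> J" using assms(3) by auto
    then have "?X ((H \<union> J) \<inter> E) (H \<union> J) = ?X H J" by (intro sum.cong) auto
    then show "?X ((H \<union> J) \<inter> E) (H \<union> J) - \<epsilon> * Q ((H \<union> J) \<inter> E) = ?X H J - \<epsilon> * Q H" using *(1) by simp
  qed
  also have "\<dots> \<le> (\<Sum>H\<in>Pow E. bern_weight p E H * exp (- (\<epsilon>\<^sup>2 * m / 4)))"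
    using p inner by (intro sum_mono mult_left_mono bern_weight_nonneg) auto
  also have "\<dots> = exp (- (\<epsilon>\<^sup>2 * m / 4))"
    using assms(1) by (simp add: sum_distrib_right[symmetric] sum_bern_weight_eq_1)
  finally show ?thesis .
qed

text \<open>The coefficients and \<open>Q\<close> may depend on the edges outside \<open>F\<close>: given those, the edges in \<open>F\<close> are
  still independent.\<close>

lemma bern_prob_tail:
  assumes "finite E" "F \<subseteq> E"
    and p: "\<And>e. e \<in> E \<Longrightarrow> 0 \<le> p e \<and> p e \<le> 1"
    and \<epsilon>: "0 \<le> \<epsilon>" "\<epsilon> \<le> 2"
    and c: "\<And>H e. H \<subseteq> E - F \<Longrightarrow> e \<in> F \<Longrightarrow> \<bar>c H e\<bar> \<le> 1"
    and Q: "\<And>H. H \<subseteq> E - F \<Longrightarrow> (\<Sum>e\<in>F. (c H e)\<^sup>2) \<le> Q H"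
    and m: "\<And>H. H \<subseteq> E - F \<Longrightarrow> m \<le> Q H"
  shows "bern_prob p E
      (\<lambda>G. \<epsilon> * Q (G - F) \<le> \<bar>\<Sum>e\<in>F. c (G - F) e * (of_bool (e \<in> G) - p e)\<bar>)
    \<le> 2 * exp (- (\<epsilon>\<^sup>2 * m / 4))"
proof -
  have E: "E - F \<union> F = E" using assms(2) by auto
  have GF: "G \<inter> (E - F) = G - F" if "G \<subseteq> E" for G using that by auto
  have fin: "finite (E - F)" "finite F" using assms(1,2) finite_subset by auto
  let ?A = "\<lambda>c G. \<epsilon> * Q (G \<inter> (E - F)) \<le> (\<Sum>e\<in>F. c (G \<inter> (E - F)) e * (of_bool (e \<in> G) - p e))"
  have "bern_prob p E
      (\<lambda>G. \<epsilon> * Q (G - F) \<le> \<bar>\<Sum>e\<in>F. c (G - F) e * (of_bool (e \<in> G) - p e)\<bar>)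
    \<le> bern_prob p E (\<lambda>G. ?A c G \<or> ?A (\<lambda>H e. - c H e) G)"
  proof (rule bern_prob_mono[OF assms(1) p])
    fix G assume G: "G \<subseteq> E" "\<epsilon> * Q (G - F) \<le> \<bar>\<Sum>e\<in>F. c (G - F) e * (of_bool (e \<in> G) - p e)\<bar>"
    show "?A c G \<or> ?A (\<lambda>H e. - c H e) G"
      unfolding GF[OF G(1)] using G(2) by (auto simp: abs_if sum_negf split: if_splits)
  qed auto
  also have "\<dots> \<le> bern_prob p E (?A c) + bern_prob p E (?A (\<lambda>H e. - c H e))"
    by (rule bern_prob_disj[OF assms(1) p])
  also have "\<dots> \<le> exp (- (\<epsilon>\<^sup>2 * m / 4)) + exp (- (\<epsilon>\<^sup>2 * m / 4))"
    using bern_prob_upper_tail[OF fin _ _ \<epsilon>, of p c Q m] bern_prob_upper_tail[OF fin _ _ \<epsilon>, of p "\<lambda>H e. - c H e" Q m]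
    unfolding E using c Q m p by (intro add_mono) auto
  finally show ?thesis by simp
qed

section \<open>Quantiles, single linkage and merge heights\<close>

text \<open>\<open>LEAST\<close> over the reals is meaningful only if a least element exists. The
  count changes only at values of \<open>v\<close>, so the smallest qualifying value is one;
  \<open>0 < h\<close> excludes the empty count, for which every smaller \<open>q\<close> would
  qualify too.\<close>

lemma quantile:
  fixes v :: "'a \<Rightarrow> real"
  assumes "finite I" "I \<noteq> {}" "0 < h" "h \<le> 1"
  shows count_le_quantile: "h * real (card I) \<le> real (card {i \<in> I. v i \<le> quantile h I v})"
    and quantile_le: "h * real (card I) \<le> real (card {i \<in> I. v i \<le> q}) \<Longrightarrow> quantile h I v \<le> q"
proof -
  let ?P = "\<lambda>q. h * real (card I) \<le> real (card {i \<in> I. v i \<le> q})"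
  let ?Q = "{q \<in> v ` I. ?P q}"
  have below: "\<exists>q'\<in>?Q. q' \<le> q" if q: "?P q" for q
  proof -
    let ?J = "{i \<in> I. v i \<le> q}"
    have "0 < h * real (card I)" using assms by (simp add: card_gt_0_iff)
    then have "card ?J \<noteq> 0" using q by linarith
    then have ne: "finite ?J" "?J \<noteq> {}" using assms(1) by (auto simp: card_eq_0_iff)
    define q' where "q' = Max (v ` ?J)"
    have q': "q' \<in> v ` ?J" using ne unfolding q'_def by (intro Max_in) auto
    have "v i \<le> q'" if "i \<in> ?J" for i using ne that unfolding q'_def by (intro Max_ge) auto
    then have "{i \<in> I. v i \<le> q'} = ?J" using q' by auto
    then show ?thesis using q q' by (intro bexI[of _ q']) auto
  qed
  have "{i \<in> I. v i \<le> Max (v ` I)} = I" using assms by auto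
  then have "?P (Max (v ` I))" using assms mult_right_mono[of h 1 "real (card I)"] by simp
  then have ne: "?Q \<noteq> {}" "finite ?Q" using below assms by (blast, simp)
  have M: "Min ?Q \<in> ?Q" using ne by (intro Min_in)
  have le: "Min ?Q \<le> q" if "?P q" for q
    using below[OF that] ne(2) by (meson Min_le order_trans)
  have eq: "quantile h I v = Min ?Q"
    unfolding quantile_def using M le by (intro Least_equality) auto
  show "?P (quantile h I v)" unfolding eq using M by blast
  show "quantile h I v \<le> q" if "?P q" unfolding eq using le[OF that] .
qed

text \<open>Members with a common point are comparable, so a minimal member containing
  \<open>s\<close> and \<open>s'\<close>, which exists by finiteness, is the least one and
  \<open>LEAST\<close> is well defined.\<close>

lemma smallest_cluster:
  assumes "clustering S \<C>" "finite S" "s \<in> S" "s' \<in> S"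
  shows smallest_cluster_in: "smallest_cluster \<C> s s' \<in> \<C>"
    and smallest_cluster_mem: "s \<in> smallest_cluster \<C> s s'" "s' \<in> smallest_cluster \<C> s s'"
    and smallest_cluster_subset: "\<And>B. B \<in> \<C> \<Longrightarrow> s \<in> B \<Longrightarrow> s' \<in> B \<Longrightarrow> smallest_cluster \<C> s s' \<subseteq> B"
proof -
  let ?P = "\<lambda>A. A \<in> \<C> \<and> s \<in> A \<and> s' \<in> A"
  have "finite (Collect ?P)" "Collect ?P \<noteq> {}"
    using assms unfolding clustering_def by (auto intro: finite_subset[of _ "Pow S"])
  then obtain A where A: "?P A" and min: "\<And>B. ?P B \<Longrightarrow> B \<subseteq> A \<Longrightarrow> A = B"
    using finite_has_minimal[of "Collect ?P"] by auto
  have sub: "A \<subseteq> B" if B: "?P B" for B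
  proof -
    have "A \<subseteq> B \<or> B \<subseteq> A \<or> A \<inter> B = {}" using assms(1) A B unfolding clustering_def by blast
    then show ?thesis using A B min[OF B] by blast
  qed
  have eq: "smallest_cluster \<C> s s' = A"
    unfolding smallest_cluster_def using A sub by (intro Least_equality) auto
  show "smallest_cluster \<C> s s' \<in> \<C>" "s \<in> smallest_cluster \<C> s s'" "s' \<in> smallest_cluster \<C> s s'"
    "\<And>B. B \<in> \<C> \<Longrightarrow> s \<in> B \<Longrightarrow> s' \<in> B \<Longrightarrow> smallest_cluster \<C> s s' \<subseteq> B"
    using A sub unfolding eq by auto
qed

lemma clustering_relabel:
  assumes "clustering S \<C>" "inj_on x S"
  shows "clustering (x ` S) (relabel \<C> x)"
  unfolding clustering_def
proof (intro conjI ballI)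
  show "relabel \<C> x \<subseteq> Pow (x ` S)" "x ` S \<in> relabel \<C> x"
    using assms unfolding clustering_def relabel_def by auto
  fix A B assume "A \<in> relabel \<C> x" "B \<in> relabel \<C> x"
  then obtain A' B' where AB: "A' \<in> \<C>" "B' \<in> \<C>" "A = x ` A'" "B = x ` B'" unfolding relabel_def by auto
  then have "A' \<subseteq> B' \<or> B' \<subseteq> A' \<or> A' \<inter> B' = {}" "A' \<subseteq> S" "B' \<subseteq> S"
    using assms(1) unfolding clustering_def by auto
  then show "A \<subseteq> B \<or> B \<subseteq> A \<or> A \<inter> B = {}"
    unfolding AB(3,4) using inj_on_image_Int[OF assms(2), of A' B'] by (metis image_empty image_mono)
qed

lemma smallest_cluster_relabel:
  assumes C: "clustering S \<C>" and S: "finite S" and x: "inj_on x S" and ij: "i \<in> S" "j \<in> S"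
  shows "smallest_cluster (relabel \<C> x) (x i) (x j) = x ` smallest_cluster \<C> i j"
proof
  note C' = clustering_relabel[OF C x]
  have S': "finite (x ` S)" "x i \<in> x ` S" "x j \<in> x ` S" using S ij by auto
  show "smallest_cluster (relabel \<C> x) (x i) (x j) \<subseteq> x ` smallest_cluster \<C> i j"
    using smallest_cluster[OF C S ij] by (intro smallest_cluster_subset[OF C' S']) (auto simp: relabel_def)
  obtain B where B: "B \<in> \<C>" "smallest_cluster (relabel \<C> x) (x i) (x j) = x ` B"
    using smallest_cluster_in[OF C' S'] unfolding relabel_def by auto
  then have "B \<subseteq> S" using C unfolding clustering_def by auto
  moreover have "x i \<in> x ` B" "x j \<in> x ` B" using smallest_cluster_mem[OF C' S'] B by auto
  ultimately have "i \<in> B" "j \<in> B" using x ij by (meson inj_on_image_mem_iff)+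
  then show "x ` smallest_cluster \<C> i j \<subseteq> smallest_cluster (relabel \<C> x) (x i) (x j)"
    unfolding B(2) using B(1) by (intro image_mono smallest_cluster_subset[OF C S ij]) auto
qed

text \<open>The pair \<open>(i, j)\<close> itself competes in the minimum, so a merge height never
  exceeds \<open>M (x i) (x j)\<close> and the absolute value disappears. The quantifiers on the
  right range over finite index sets independent of \<open>x\<close>; this serves both the estimate
  and the measurability of the event.\<close>

lemma less_merge_distortion_iff:
  assumes C: "clustering V \<C>" and V: "finite V" "2 \<le> card V" and x: "inj_on x V" and "0 < e"
  shows "e < merge_distortion (x ` V) M (merge_height M (relabel \<C> x)) \<longleftrightarrow>
    (\<exists>i\<in>V. \<exists>j\<in>V. i \<noteq> j \<and> (\<exists>u\<in>smallest_cluster \<C> i j. \<exists>v\<in>smallest_cluster \<C> i j.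
       u \<noteq> v \<and> e < M (x i) (x j) - M (x u) (x v)))"
    (is "_ \<longleftrightarrow> ?R")
proof -
  define D where "D = {(i, j). i \<in> V \<and> j \<in> V \<and> i \<noteq> j}"
  define U where "U i j = {(u, v). u \<in> smallest_cluster \<C> i j \<and> v \<in> smallest_cluster \<C> i j \<and> u \<noteq> v}" for i j
  have D: "finite D" "D \<noteq> {}"
  proof -
    show "finite D" using V by (intro finite_subset[of D "V \<times> V"]) (auto simp: D_def)
    obtain i j where "i \<in> V" "j \<in> V" "i \<noteq> j"
      using V by (metis One_nat_def Suc_1 card_le_Suc0_iff_eq not_less_eq_eq)
    then show "D \<noteq> {}" by (auto simp: D_def)
  qed
  have sub: "smallest_cluster \<C> i j \<subseteq> V" if "(i, j) \<in> D" for i j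
    using smallest_cluster_in[OF C V(1), of i j] C that unfolding clustering_def D_def by auto
  have U: "finite (U i j)" "(i, j) \<in> U i j" if "(i, j) \<in> D" for i j
  proof -
    show "finite (U i j)" using sub[OF that] V
      by (intro finite_subset[of "U i j" "V \<times> V"]) (auto simp: U_def)
    show "(i, j) \<in> U i j" using smallest_cluster_mem[OF C V(1), of i j] that by (auto simp: U_def D_def)
  qed
  have mh: "merge_height M (relabel \<C> x) (x i) (x j) = Min ((\<lambda>(u, v). M (x u) (x v)) ` U i j)" if "(i, j) \<in> D" for i j
  proof -
    have ij: "i \<in> V" "j \<in> V" using that by (auto simp: D_def)
    have "{M u v |u v. u \<in> x ` smallest_cluster \<C> i j \<and> v \<in> x ` smallest_cluster \<C> i j \<and> u \<noteq> v} =
        (\<lambda>(u, v). M (x u) (x v)) ` U i j"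
      (is "?L = ?R")
    proof (intro equalityI subsetI)
      fix a assume "a \<in> ?L"
      then obtain u v where "a = M (x u) (x v)" "u \<in> smallest_cluster \<C> i j" "v \<in> smallest_cluster \<C> i j" "u \<noteq> v"
        by auto
      then show "a \<in> ?R" by (intro image_eqI[of _ _ "(u, v)"]) (auto simp: U_def)
    next
      fix a assume "a \<in> ?R"
      then obtain u v where uv: "a = M (x u) (x v)" "u \<in> smallest_cluster \<C> i j" "v \<in> smallest_cluster \<C> i j" "u \<noteq> v"
        by (auto simp: U_def)
      then have "x u \<noteq> x v" using sub[OF that] x by (meson inj_onD subsetD)
      then show "a \<in> ?L" using uv by blast
    qed
    then show ?thesis unfolding merge_height_def smallest_cluster_relabel[OF C V(1) x ij] by simp
  qed
  let ?f = "\<lambda>(i, j). \<bar>M (x i) (x j) - merge_height M (relabel \<C> x) (x i) (x j)\<bar>"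
  have "{\<bar>M s s' - merge_height M (relabel \<C> x) s s'\<bar> |s s'. s \<in> x ` V \<and> s' \<in> x ` V \<and> s \<noteq> s'} = ?f ` D"
    (is "?L = ?R'")
  proof (intro equalityI subsetI)
    fix a assume "a \<in> ?L"
    then obtain i j where "a = ?f (i, j)" "i \<in> V" "j \<in> V" "x i \<noteq> x j" by auto
    then show "a \<in> ?R'" by (intro image_eqI[of _ _ "(i, j)"]) (auto simp: D_def)
  next
    fix a assume "a \<in> ?R'"
    then obtain i j where ij: "a = ?f (i, j)" "i \<in> V" "j \<in> V" "i \<noteq> j" by (auto simp: D_def)
    then have "x i \<noteq> x j" using x by (meson inj_onD)
    then show "a \<in> ?L" using ij by auto
  qed
  then have "e < merge_distortion (x ` V) M (merge_height M (relabel \<C> x)) \<longleftrightarrow> (\<exists>d\<in>D. e < ?f d)"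
    unfolding merge_distortion_def using D by (simp add: Max_gr_iff)
  also have "\<dots> \<longleftrightarrow> (\<exists>(i, j)\<in>D. \<exists>(u, v)\<in>U i j. e < M (x i) (x j) - M (x u) (x v))"
  proof (intro bex_cong refl, clarify)
    fix i j assume d: "(i, j) \<in> D"
    let ?S = "(\<lambda>(u, v). M (x u) (x v)) ` U i j"
    have S: "finite ?S" "M (x i) (x j) \<in> ?S" using U[OF d] by force+
    have "Min ?S \<le> M (x i) (x j)" using S by (intro Min_le)
    then have "e < \<bar>M (x i) (x j) - Min ?S\<bar> \<longleftrightarrow> Min ?S < M (x i) (x j) - e" by linarith
    also have "\<dots> \<longleftrightarrow> (\<exists>a\<in>?S. a < M (x i) (x j) - e)" using S by (intro Min_less_iff) auto
    also have "\<dots> \<longleftrightarrow> (\<exists>(u, v)\<in>U i j. e < M (x i) (x j) - M (x u) (x v))"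
      by (force simp: algebra_simps)
    finally show "e < \<bar>M (x i) (x j) - merge_height M (relabel \<C> x) (x i) (x j)\<bar> \<longleftrightarrow>
      (\<exists>(u, v)\<in>U i j. e < M (x i) (x j) - M (x u) (x v))" unfolding mh[OF d] .
  qed
  also have "\<dots> \<longleftrightarrow> ?R" by (auto simp: D_def U_def)
  finally show ?thesis .
qed

section \<open>Single linkage as bottleneck connectivity\<close>

definition threshold_rel :: "'a set \<Rightarrow> ('a \<Rightarrow> 'a \<Rightarrow> real) \<Rightarrow> real \<Rightarrow> ('a \<times> 'a) set" where
  "threshold_rel V P l = {(i, j). i \<in> V \<and> j \<in> V \<and> i \<noteq> j \<and> l \<le> P i j}"

lemma single_linkage_eq: "single_linkage V P = (\<Union>l. V // (threshold_rel V P l)\<^sup>*)"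
  by (simp add: single_linkage_def threshold_rel_def)

lemma sym_threshold_rel:
  assumes "\<And>i j. i \<in> V \<Longrightarrow> j \<in> V \<Longrightarrow> P i j = P j i"
  shows "sym ((threshold_rel V P l)\<^sup>*)"
  using assms by (intro sym_rtrancl) (auto simp: sym_def threshold_rel_def)

text \<open>Lowering the threshold coarsens the components, so overlapping components are
  nested.\<close>

lemma clustering_single_linkage:
  assumes "finite V" "V \<noteq> {}" and P: "\<And>i j. i \<in> V \<Longrightarrow> j \<in> V \<Longrightarrow> P i j = P j i"
  shows "clustering V (single_linkage V P)"
  unfolding clustering_def
proof (intro conjI ballI)
  let ?R = "\<lambda>l. (threshold_rel V P l)\<^sup>*"
  note sym = sym_threshold_rel[of V P, OF P]
  have V: "(i, j) \<in> ?R l \<Longrightarrow> i \<in> V \<Longrightarrow> j \<in> V" for i j l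
    by (induction rule: rtrancl_induct) (auto simp: threshold_rel_def)
  have anti: "?R l \<subseteq> ?R l'" if "l' \<le> l" for l l'
    using that by (intro rtrancl_mono) (auto simp: threshold_rel_def)
  show "single_linkage V P \<subseteq> Pow V"
    unfolding single_linkage_eq by (auto simp: quotient_def V)
  show "V \<in> single_linkage V P"
  proof -
    \<comment> \<open>At the smallest entry every pair is joined. The diagonal is included so that
      the set is nonempty also for a single vertex.\<close>
    let ?l = "Min ((\<lambda>(i, j). P i j) ` (V \<times> V))"
    have *: "?l \<le> P i j" if "i \<in> V" "j \<in> V" for i j
      using assms that by (intro Min_le) force+
    obtain i where i: "i \<in> V" using assms by auto
    have "?R ?l `` {i} = V"
    proof (intro equalityI subsetI)
      fix j assume "j \<in> V"
      then have "i = j \<or> (i, j) \<in> threshold_rel V P ?l"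
        using *[of i j] i by (auto simp: threshold_rel_def)
      then show "j \<in> ?R ?l `` {i}" by auto
    qed (use V i in auto)
    then show ?thesis unfolding single_linkage_eq using i by (auto simp: quotient_def)
  qed
  fix A B assume "A \<in> single_linkage V P" "B \<in> single_linkage V P"
  then obtain l i l' i' where A: "A = ?R l `` {i}" and B: "B = ?R l' `` {i'}"
    unfolding single_linkage_eq by (auto simp: quotient_def)
  have *: "?R l `` {i} \<subseteq> ?R l' `` {i'}"
    if "l' \<le> l" "k \<in> ?R l `` {i}" "k \<in> ?R l' `` {i'}" for l l' i i' k
  proof
    fix j assume j: "j \<in> ?R l `` {i}"
    have "(k, i) \<in> ?R l" using symD[OF sym] that by auto
    then have "(k, j) \<in> ?R l" using j by auto
    then show "j \<in> ?R l' `` {i'}" using anti[OF that(1)] that(3) by (auto intro: rtrancl_trans)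
  qed
  show "A \<subseteq> B \<or> B \<subseteq> A \<or> A \<inter> B = {}"
  proof (cases "A \<inter> B = {}")
    case False
    then obtain k where "k \<in> A" "k \<in> B" by auto
    then show ?thesis using *[of l' l k i i'] *[of l l' k i' i] A B by (metis linorder_linear)
  qed auto
qed

text \<open>Loops are allowed, in contrast to \<open>threshold_rel\<close>, and carry information: a
  cell is related to itself only if \<open>W\<close> is at least \<open>l\<close> on its
  square.\<close>

definition cell_rel :: "(real \<Rightarrow> real \<Rightarrow> real) \<Rightarrow> real set set \<Rightarrow> real \<Rightarrow> (real set \<times> real set) set" where
  "cell_rel W \<K> l = {(K, K'). K \<in> \<K> \<and> K' \<in> \<K> \<and> (\<forall>x\<in>K. \<forall>y\<in>K'. l \<le> W x y)}"

text \<open>A deterministic comparison of two bottleneck structures. A cell path lifts to a sample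
  path because every cell is hit; a sample path projects to a cell path because \<open>W\<close>
  oscillates little. Of the seven errors, four are made on the way from \<open>M (x i) (x j)\<close>
  down to the threshold, three on the way back to \<open>M (x u) (x v)\<close>.\<close>

lemma single_linkage_merge_close:
  assumes V: "finite V" "V \<noteq> {}"
    and P: "\<And>i j. i \<in> V \<Longrightarrow> j \<in> V \<Longrightarrow> P i j = P j i"
    and PW: "\<And>i j. i \<in> V \<Longrightarrow> j \<in> V \<Longrightarrow> i \<noteq> j \<Longrightarrow> \<bar>P i j - W (x i) (x j)\<bar> \<le> \<epsilon>"
    and osc: "\<And>K K' a a' b b'. K \<in> \<K> \<Longrightarrow> K' \<in> \<K> \<Longrightarrow> a \<in> K \<Longrightarrow> a' \<in> K \<Longrightarrow> b \<in> K' \<Longrightarrow> b' \<in> K' \<Longrightarrow>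
        \<bar>W a b - W a' b'\<bar> \<le> \<epsilon>"
    and cover: "\<And>i. i \<in> V \<Longrightarrow> x i \<in> \<Union>\<K>"
    and hit: "\<And>K. K \<in> \<K> \<Longrightarrow> \<exists>i\<in>V. x i \<in> K"
    and lower: "\<And>i j K K' l. i \<in> V \<Longrightarrow> j \<in> V \<Longrightarrow> i \<noteq> j \<Longrightarrow> K \<in> \<K> \<Longrightarrow> K' \<in> \<K> \<Longrightarrow> x i \<in> K \<Longrightarrow> x j \<in> K' \<Longrightarrow>
        (K, K') \<in> (cell_rel W \<K> l)\<^sup>+ \<Longrightarrow> l - \<epsilon> \<le> M (x i) (x j)"
    and upper: "\<And>i j K K'. i \<in> V \<Longrightarrow> j \<in> V \<Longrightarrow> i \<noteq> j \<Longrightarrow> K \<in> \<K> \<Longrightarrow> K' \<in> \<K> \<Longrightarrow> x i \<in> K \<Longrightarrow> x j \<in> K' \<Longrightarrow>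
        (K, K') \<in> (cell_rel W \<K> (M (x i) (x j) - 3 * \<epsilon>))\<^sup>+"
    and ij: "i \<in> V" "j \<in> V" "i \<noteq> j"
    and uv: "u \<in> smallest_cluster (single_linkage V P) i j" "v \<in> smallest_cluster (single_linkage V P) i j" "u \<noteq> v"
  shows "M (x i) (x j) - M (x u) (x v) \<le> 7 * \<epsilon>"
proof -
  \<comment> \<open>\<open>3 * \<epsilon>\<close> is lost in \<open>upper\<close> and one more
    \<open>\<epsilon>\<close> in passing from \<open>W\<close> to \<open>P\<close>.\<close>
  define \<theta> where "\<theta> = M (x i) (x j) - 4 * \<epsilon>"
  let ?T = "threshold_rel V P \<theta>"
  obtain K K' where K: "K \<in> \<K>" "K' \<in> \<K>" "x i \<in> K" "x j \<in> K'" using cover ij by blast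
  have up: "(i, k) \<in> ?T\<^sup>*"
    if "(K, K') \<in> (cell_rel W \<K> (M (x i) (x j) - 3 * \<epsilon>))\<^sup>+" "x k \<in> K'" "k \<in> V" for k K'
    using that
  proof (induction arbitrary: k rule: trancl_induct)
    case (base K1)
    then have "M (x i) (x j) - 3 * \<epsilon> \<le> W (x i) (x k)" using K by (auto simp: cell_rel_def)
    \<comment> \<open>Representatives of consecutive cells may coincide, and nothing is known about
      the diagonal of \<open>P\<close>; such a step of the cell path is dropped.\<close>
    then have "i = k \<or> \<theta> \<le> P i k" using PW[of i k] ij base by (fastforce simp: \<theta>_def)
    then have "i = k \<or> (i, k) \<in> ?T" using ij base by (auto simp: threshold_rel_def)
    then show ?case by auto
  next
    case (step K1 K2)
    then have "K1 \<in> \<K>" by (auto simp: cell_rel_def)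
    then obtain k1 where k1: "k1 \<in> V" "x k1 \<in> K1" using hit by auto
    then have "M (x i) (x j) - 3 * \<epsilon> \<le> W (x k1) (x k)" using step by (auto simp: cell_rel_def)
    then have "k1 = k \<or> \<theta> \<le> P k1 k" using PW[of k1 k] k1 step by (fastforce simp: \<theta>_def)
    then have "k1 = k \<or> (k1, k) \<in> ?T" using k1 step by (auto simp: threshold_rel_def)
    then show ?case using step.IH[OF k1(2,1)] by auto
  qed
  have "(i, j) \<in> ?T\<^sup>*" using up[OF upper[OF ij K] K(4) ij(2)] .
  then have "smallest_cluster (single_linkage V P) i j \<subseteq> ?T\<^sup>* `` {i}"
    using ij by (intro smallest_cluster_subset[OF clustering_single_linkage[OF V P]] V(1))
      (auto simp: single_linkage_eq quotient_def)
  then have iu: "(i, u) \<in> ?T\<^sup>*" "(i, v) \<in> ?T\<^sup>*" using uv by auto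
  have inV: "k \<in> V" if "(i, k) \<in> ?T\<^sup>*" for k
    using that ij(1) by (induction rule: rtrancl_induct) (auto simp: threshold_rel_def)
  have u: "u \<in> V" "v \<in> V" using inV iu by auto
  have "(u, i) \<in> ?T\<^sup>*" using iu(1) symD[OF sym_threshold_rel[of V P, OF P]] by metis
  then have "(u, v) \<in> ?T\<^sup>*" using iu(2) by auto
  \<comment> \<open>\<open>lower\<close> needs a nonempty path, since a cell need not be joined to
    itself; \<open>u \<noteq> v\<close> provides one.\<close>
  then have uv': "(u, v) \<in> ?T\<^sup>+" using uv(3) by (metis rtranclD)
  obtain K where K: "K \<in> \<K>" "x u \<in> K" using cover u by blast
  have cell: "(K1, K2) \<in> cell_rel W \<K> (\<theta> - 2 * \<epsilon>)"
    if "(a, b) \<in> ?T" "K1 \<in> \<K>" "K2 \<in> \<K>" "x a \<in> K1" "x b \<in> K2" for a b K1 K2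
  proof -
    have "\<theta> - 2 * \<epsilon> \<le> W y z" if "y \<in> K1" "z \<in> K2" for y z
      using osc[of K1 K2 y "x a" z "x b"] PW[of a b] that \<open>(a, b) \<in> ?T\<close> \<open>K1 \<in> \<K>\<close> \<open>K2 \<in> \<K>\<close> \<open>x a \<in> K1\<close> \<open>x b \<in> K2\<close>
      by (auto simp: threshold_rel_def abs_le_iff)
    then show ?thesis using that by (auto simp: cell_rel_def)
  qed
  have path: "(K, K') \<in> (cell_rel W \<K> (\<theta> - 2 * \<epsilon>))\<^sup>+" if "(u, w) \<in> ?T\<^sup>+" "K' \<in> \<K>" "x w \<in> K'" for w K'
    using that
  proof (induction arbitrary: K' rule: trancl_induct)
    case (base w)
    then show ?case using cell K by auto
  next
    case (step w z)
    then have "w \<in> V" by (auto simp: threshold_rel_def)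
    then obtain L where L: "L \<in> \<K>" "x w \<in> L" using cover by blast
    then show ?case using step.IH[OF L] cell[OF step(2) L(1) step(4) L(2) step(5)] by auto
  qed
  obtain K' where K': "K' \<in> \<K>" "x v \<in> K'" using cover u by blast
  have "\<theta> - 2 * \<epsilon> - \<epsilon> \<le> M (x u) (x v)"
    using lower[OF u uv(3) K(1) K'(1) K(2) K'(2) path[OF uv' K']] .
  then show ?thesis by (simp add: \<theta>_def)
qed

section \<open>Neighbourhoods\<close>

lemma adjacency_sym: "adjacency G i j = adjacency G j i"
  by (simp add: adjacency_def insert_commute)

lemma adjacency_diag:
  assumes "G \<in> graphs n"
  shows "adjacency G i i = 0"
  using assms by (auto simp: adjacency_def graphs_def)

lemma smoothed_sym: "smoothed C n (adjacency G) i j = smoothed C n (adjacency G) j i"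
  unfolding smoothed_def by (simp add: adjacency_sym[of G i] adjacency_sym[of G j] add.commute)

lemma graph_clustering_method_nbhd_smoothing:
  "graph_clustering_method (nbhd_smoothing_clustering C)"
  unfolding graph_clustering_method_def nbhd_smoothing_clustering_def
  by (auto intro!: clustering_single_linkage smoothed_sym)

text \<open>Deleting \<open>j\<close> and the zero diagonal remove \<open>i\<close>,
  \<open>j\<close> and \<open>k\<close> from the sum, so no remaining term contains the edge
  \<open>{i, k}\<close> or an edge at \<open>j\<close>.\<close>

lemma mat_square_delete_vertex:
  assumes "G \<in> graphs n" "i \<noteq> j" "k \<noteq> j"
  shows "mat_square n (delete_vertex j (adjacency G)) i k =
    (\<Sum>l\<in>{1..n} - {i, j, k}. adjacency G i l * adjacency G l k)"
  unfolding mat_square_def using assms adjacency_diag[OF assms(1)]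
  by (intro sum.mono_neutral_cong_right) (auto simp: delete_vertex_def)

lemma bandwidth_bounds:
  assumes "0 < C" "C < 1" "2 \<le> n"
  shows "0 < bandwidth C n" "bandwidth C n \<le> 1"
proof -
  show "0 < bandwidth C n" using assms unfolding bandwidth_def by simp
  have "ln (real n) / real n \<le> 1" using assms ln_le_minus_one[of "real n"] by simp
  then have "sqrt (ln (real n) / real n) \<le> 1" by simp
  then show "bandwidth C n \<le> 1" using assms unfolding bandwidth_def by (intro mult_le_one) auto
qed

text \<open>The bound holds for every graph. It keeps the averages in \<open>smoothed\<close> from
  being empty and is the constant \<open>m\<close> in their tail bound.\<close>

lemma card_nbhd_ge:
  assumes "0 < C" "C < 1" "3 \<le> n" "i \<in> {1..n}" "j \<in> {1..n}" "i \<noteq> j"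
  shows "bandwidth C n * real (n - 2) \<le> real (card (nbhd C n A i j))"
proof -
  have c: "card ({1..n} - {i, j}) = n - 2" using assms by (subst card_Diff_subset) auto
  then have "{1..n} - {i, j} \<noteq> {}" using assms by (metis card.empty diff_is_0_eq not_less_eq_eq numeral_2_eq_2 numeral_3_eq_3)
  from count_le_quantile[OF _ this bandwidth_bounds(1,2), of C n "nbhd_dist n A j i"]
  show ?thesis using assms unfolding nbhd_def c by simp
qed

text \<open>Two scales are needed: the density \<open>\<beta>\<close> of the coarse cells has to be fixed before \<open>\<epsilon>\<^sub>0\<close> and \<open>\<tau>\<close> can be
  chosen small relative to it, and fine cells are less dense.\<close>

lemma nbhd_close:
  fixes n :: nat and w :: "nat \<Rightarrow> nat \<Rightarrow> real" and \<kappa> :: "nat \<Rightarrow> 'c" and \<kappa>' :: "nat \<Rightarrow> 'd"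
    and \<epsilon>\<^sub>0 \<epsilon> \<beta> \<tau> :: real
  defines "V \<equiv> {1..n}"
  assumes C: "0 < C" "C < 1" and n: "4 \<le> n"
    and w: "\<And>i j. i \<in> V \<Longrightarrow> j \<in> V \<Longrightarrow> w i j = w j i \<and> 0 \<le> w i j \<and> w i j \<le> 1"
    and conc: "\<And>i j k. i \<in> V \<Longrightarrow> j \<in> V \<Longrightarrow> k \<in> V \<Longrightarrow> i \<noteq> j \<Longrightarrow> i \<noteq> k \<Longrightarrow> j \<noteq> k \<Longrightarrow>
      \<bar>mat_square n (delete_vertex j A) i k / n - (\<Sum>l\<in>V. w i l * w l k) / n\<bar> \<le> \<tau>"
    and fine: "\<And>i i' l. i \<in> V \<Longrightarrow> i' \<in> V \<Longrightarrow> l \<in> V \<Longrightarrow> \<kappa> i = \<kappa> i' \<Longrightarrow> \<bar>w i l - w i' l\<bar> \<le> \<epsilon>\<^sub>0"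
    and fine_count: "\<And>i. i \<in> V \<Longrightarrow> 4 \<le> card {i' \<in> V. \<kappa> i' = \<kappa> i} \<and>
      bandwidth C n * real (n - 2) + 2 \<le> real (card {i' \<in> V. \<kappa> i' = \<kappa> i})"
    and coarse: "\<And>i i' l. i \<in> V \<Longrightarrow> i' \<in> V \<Longrightarrow> l \<in> V \<Longrightarrow> \<kappa>' i = \<kappa>' i' \<Longrightarrow> \<bar>w i l - w i' l\<bar> \<le> \<epsilon> / 4"
    and coarse_count: "\<And>i. i \<in> V \<Longrightarrow> \<beta> * n \<le> real (card {i' \<in> V. \<kappa>' i' = \<kappa>' i})"
    and small: "0 < \<epsilon>" "4 * \<epsilon>\<^sub>0 + 8 * \<tau> < \<beta> * \<epsilon>\<^sup>2 / 4"
    and ij: "i \<in> V" "j \<in> V" "i \<noteq> j" and i': "i' \<in> nbhd C n A i j"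
  shows "\<bar>w i j - w i' j\<bar> \<le> \<epsilon>"
proof (rule ccontr)
  let ?S = "\<lambda>i k. mat_square n (delete_vertex j A) i k / n"
  let ?D = "\<lambda>i k. (\<Sum>l\<in>V. w i l * w l k)"
  let ?I = "V - {i, j}"
  let ?q = "quantile (bandwidth C n) ?I (nbhd_dist n A j i)"
  have n0: "0 < real n" using n by simp
  have i'V: "i' \<in> V" "i' \<noteq> i" "i' \<noteq> j" and i'q: "nbhd_dist n A j i i' \<le> ?q"
    using i' unfolding nbhd_def V_def by auto
  have card_V: "card V = n" "finite V" unfolding V_def by auto
  have ex: "\<exists>k. k \<in> V - {i, j, m}" for m
  proof -
    have "card {i, j, m} \<le> 3" by (simp add: card_insert_if)
    then have "card {i, j, m} < card V" using n card_V by auto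
    then have "\<not> V \<subseteq> {i, j, m}"
      using card_mono[of "{i, j, m}" V] by (meson finite.emptyI finite.insertI not_less)
    then show ?thesis by blast
  qed
  \<comment> \<open>Vertices in the fine cell of \<open>i\<close> have nearly the same expected
    counts as \<open>i\<close>; each of the two observed counts costs another
    \<open>\<tau>\<close>.\<close>
  have near: "nbhd_dist n A j i m \<le> \<epsilon>\<^sub>0 + 2 * \<tau>" if m: "m \<in> ?I" "\<kappa> m = \<kappa> i" "m \<noteq> i" for m
  proof -
    have "\<bar>?S i k - ?S m k\<bar> \<le> \<epsilon>\<^sub>0 + 2 * \<tau>" if k: "k \<in> V - {i, m, j}" for k
    proof -
      have "\<bar>?D i k - ?D m k\<bar> \<le> (\<Sum>l\<in>V. \<bar>w i l * w l k - w m l * w l k\<bar>)"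
        unfolding sum_subtractf[symmetric] by (rule sum_abs)
      also have "\<dots> \<le> (\<Sum>l\<in>V. \<epsilon>\<^sub>0)"
      proof (rule sum_mono)
        fix l assume l: "l \<in> V"
        have "\<bar>w i l * w l k - w m l * w l k\<bar> = \<bar>w i l - w m l\<bar> * \<bar>w l k\<bar>"
          by (simp add: abs_mult[symmetric] left_diff_distrib)
        also have "\<dots> \<le> \<bar>w i l - w m l\<bar> * 1" using w[of l k] l k by (intro mult_left_mono) auto
        also have "\<dots> \<le> \<epsilon>\<^sub>0" using fine[of i m l] ij m l by auto
        finally show "\<bar>w i l * w l k - w m l * w l k\<bar> \<le> \<epsilon>\<^sub>0" .
      qed
      finally have "\<bar>?D i k - ?D m k\<bar> \<le> \<epsilon>\<^sub>0 * n" using card_V by (simp add: mult.commute)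
      then have "\<bar>?D i k - ?D m k\<bar> / n \<le> \<epsilon>\<^sub>0" using n0 by (simp add: field_simps)
      then have "\<bar>?D i k / n - ?D m k / n\<bar> \<le> \<epsilon>\<^sub>0" using n0 by (simp add: diff_divide_distrib[symmetric])
      moreover have "\<bar>?S i k - ?D i k / n\<bar> \<le> \<tau>" "\<bar>?S m k - ?D m k / n\<bar> \<le> \<tau>"
        using conc[of i j k] conc[of m j k] ij m k by auto
      ultimately show ?thesis by linarith
    qed
    moreover have "V - {i, m, j} \<noteq> {}" using ex[of m] by auto
    ultimately show ?thesis unfolding nbhd_dist_def V_def[symmetric] using card_V by (subst Max_le_iff) auto
  qed
  \<comment> \<open>The fine cell without \<open>i\<close> and \<open>j\<close> already makes up the
    requested fraction; removing these two is the reason for \<open>+ 2\<close> in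
    \<open>fine_count\<close>.\<close>
  have "?q \<le> \<epsilon>\<^sub>0 + 2 * \<tau>"
  proof (rule quantile_le)
    show "finite ?I" "?I \<noteq> {}" "0 < bandwidth C n" "bandwidth C n \<le> 1"
      using card_V ex[of i] bandwidth_bounds[OF C, of n] n by auto
    have "{i' \<in> V. \<kappa> i' = \<kappa> i} - {i, j} \<subseteq> {m \<in> ?I. nbhd_dist n A j i m \<le> \<epsilon>\<^sub>0 + 2 * \<tau>}"
      using near by auto
    then have "card ({i' \<in> V. \<kappa> i' = \<kappa> i} - {i, j}) \<le> card {m \<in> ?I. nbhd_dist n A j i m \<le> \<epsilon>\<^sub>0 + 2 * \<tau>}"
      using card_V by (intro card_mono) auto
    moreover have "card {i' \<in> V. \<kappa> i' = \<kappa> i} - card {i, j} \<le> card ({i' \<in> V. \<kappa> i' = \<kappa> i} - {i, j})"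
      by (intro diff_card_le_card_Diff) auto
    moreover have "card {i, j} = 2" using ij by simp
    moreover have cI: "card ?I = n - 2" using ij card_V by (subst card_Diff_subset) auto
    ultimately show "bandwidth C n * real (card ?I) \<le> real (card {m \<in> ?I. nbhd_dist n A j i m \<le> \<epsilon>\<^sub>0 + 2 * \<tau>})"
      unfolding cI using fine_count[OF ij(1)] by linarith
  qed
  then have d: "nbhd_dist n A j i i' \<le> \<epsilon>\<^sub>0 + 2 * \<tau>" using i'q by simp
  have D: "\<bar>?D i k - ?D i' k\<bar> \<le> (\<epsilon>\<^sub>0 + 4 * \<tau>) * n" if k: "k \<in> V - {i, i', j}" for k
  proof -
    have "\<bar>?S i k - ?S i' k\<bar> \<le> nbhd_dist n A j i i'"
      unfolding nbhd_dist_def V_def[symmetric] using card_V k by (intro Max_ge) auto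
    moreover have "\<bar>?S i k - ?D i k / n\<bar> \<le> \<tau>" "\<bar>?S i' k - ?D i' k / n\<bar> \<le> \<tau>"
      using conc[of i j k] conc[of i' j k] ij i'V k by auto
    ultimately have "\<bar>?D i k / n - ?D i' k / n\<bar> \<le> \<epsilon>\<^sub>0 + 4 * \<tau>" using d by linarith
    then have "\<bar>?D i k - ?D i' k\<bar> / n \<le> \<epsilon>\<^sub>0 + 4 * \<tau>" using n0 by (simp add: diff_divide_distrib[symmetric])
    then show ?thesis using n0 by (simp add: field_simps)
  qed
  let ?T = "\<Sum>l\<in>V. (w i l - w i' l)\<^sup>2"
  \<comment> \<open>The tests wanted below are at \<open>m = i\<close> and \<open>m = i'\<close>,
    which \<open>nbhd_dist\<close> excludes. A substitute \<open>k\<close> is taken from the fine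
    cell of \<open>m\<close>, at a cost of \<open>\<epsilon>\<^sub>0\<close>; having 4 members, the
    cell has one outside \<open>{i, i', j}\<close>.\<close>
  have half: "\<bar>\<Sum>l\<in>V. (w i l - w i' l) * w l m\<bar> \<le> (2 * \<epsilon>\<^sub>0 + 4 * \<tau>) * n" if m: "m \<in> V" for m
  proof -
    have "card {i, i', j} \<le> 3" by (simp add: card_insert_if)
    then have "card {i, i', j} < card {k \<in> V. \<kappa> k = \<kappa> m}" using fine_count[OF m] by linarith
    then have "\<not> {k \<in> V. \<kappa> k = \<kappa> m} \<subseteq> {i, i', j}"
      using card_mono[of "{i, i', j}" "{k \<in> V. \<kappa> k = \<kappa> m}"] by (meson finite.emptyI finite.insertI not_less)
    then obtain k where k: "k \<in> V" "\<kappa> k = \<kappa> m" "k \<notin> {i, i', j}" by blast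
    have "(\<Sum>l\<in>V. (w i l - w i' l) * w l m) = (?D i k - ?D i' k) + (\<Sum>l\<in>V. (w i l - w i' l) * (w l m - w l k))"
      unfolding sum_subtractf[symmetric] sum.distrib[symmetric]
      by (intro sum.cong refl) (simp add: algebra_simps)
    moreover have "\<bar>\<Sum>l\<in>V. (w i l - w i' l) * (w l m - w l k)\<bar> \<le> (\<Sum>l\<in>V. \<epsilon>\<^sub>0)"
    proof (rule order_trans[OF sum_abs sum_mono])
      fix l assume l: "l \<in> V"
      have "\<bar>(w i l - w i' l) * (w l m - w l k)\<bar> = \<bar>w i l - w i' l\<bar> * \<bar>w m l - w k l\<bar>"
        using w[of l m] w[of l k] l k m by (simp add: abs_mult)
      also have "\<dots> \<le> 1 * \<epsilon>\<^sub>0"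
        using w[of i l] w[of i' l] ij i'V l fine[of m k l] m k by (intro mult_mono) auto
      finally show "\<bar>(w i l - w i' l) * (w l m - w l k)\<bar> \<le> \<epsilon>\<^sub>0" by simp
    qed
    moreover have "(\<Sum>l\<in>V. \<epsilon>\<^sub>0) = \<epsilon>\<^sub>0 * n" using card_V by (simp add: mult.commute)
    moreover have "(2 * \<epsilon>\<^sub>0 + 4 * \<tau>) * n = (\<epsilon>\<^sub>0 + 4 * \<tau>) * n + \<epsilon>\<^sub>0 * n" by (simp add: algebra_simps)
    moreover have "\<bar>?D i k - ?D i' k\<bar> \<le> (\<epsilon>\<^sub>0 + 4 * \<tau>) * n" using D k by blast
    ultimately show ?thesis unfolding abs_le_iff by linarith
  qed
  \<comment> \<open>Expanding one factor of the square leaves the test at \<open>m = i\<close> minus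
    the test at \<open>m = i'\<close>.\<close>
  have "?T = (\<Sum>l\<in>V. (w i l - w i' l) * w l i) - (\<Sum>l\<in>V. (w i l - w i' l) * w l i')"
    unfolding sum_subtractf[symmetric]
  proof (rule sum.cong)
    fix l assume "l \<in> V"
    then have "w i l = w l i" "w i' l = w l i'" using w[of i l] w[of i' l] ij i'V by auto
    then show "(w i l - w i' l)\<^sup>2 = (w i l - w i' l) * w l i - (w i l - w i' l) * w l i'"
      by (simp add: power2_eq_square algebra_simps)
  qed simp
  moreover have "(4 * \<epsilon>\<^sub>0 + 8 * \<tau>) * n = (2 * \<epsilon>\<^sub>0 + 4 * \<tau>) * n + (2 * \<epsilon>\<^sub>0 + 4 * \<tau>) * n"
    by (simp add: algebra_simps)
  ultimately have "?T \<le> (4 * \<epsilon>\<^sub>0 + 8 * \<tau>) * n"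
    using half[OF ij(1)] half[OF i'V(1)] unfolding abs_le_iff by linarith
  also have "\<dots> < \<beta> * \<epsilon>\<^sup>2 / 4 * n" using small n0 by (intro mult_strict_right_mono) auto
  finally have T: "?T < \<beta> * n * (\<epsilon> / 2)\<^sup>2" by (simp add: power_divide algebra_simps)
  assume far: "\<not> \<bar>w i j - w i' j\<bar> \<le> \<epsilon>"
  \<comment> \<open>A gap above \<open>\<epsilon>\<close> at \<open>j\<close> stays at least
    \<open>\<epsilon> / 2\<close> on the whole coarse cell of \<open>j\<close>, which alone would
    exceed the bound on \<open>?T\<close>.\<close>
  let ?B = "{l \<in> V. \<kappa>' l = \<kappa>' j}"
  have "\<beta> * n * (\<epsilon> / 2)\<^sup>2 \<le> (\<Sum>l\<in>?B. (\<epsilon> / 2)\<^sup>2)"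
    using mult_right_mono[OF coarse_count[OF ij(2)], of "(\<epsilon> / 2)\<^sup>2"] by simp
  also have "\<dots> \<le> (\<Sum>l\<in>?B. (w i l - w i' l)\<^sup>2)"
  proof (rule sum_mono)
    fix l assume l: "l \<in> ?B"
    have "\<bar>w i l - w i j\<bar> \<le> \<epsilon> / 4" "\<bar>w i' l - w i' j\<bar> \<le> \<epsilon> / 4"
      using coarse[of l j i] coarse[of l j i'] l ij i'V w[of i l] w[of i j] w[of i' l] w[of i' j] by auto
    then have "\<epsilon> / 2 \<le> \<bar>w i l - w i' l\<bar>" using far by linarith
    then show "(\<epsilon> / 2)\<^sup>2 \<le> (w i l - w i' l)\<^sup>2" using small(1)
      by (metis abs_le_square_iff abs_of_pos half_gt_zero)
  qed
  also have "\<dots> \<le> ?T" using card_V by (intro sum_mono2) auto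
  finally show False using T by simp
qed

text \<open>Bias plus fluctuation, each at most \<open>\<epsilon>\<close>. The average over
  neighbours of \<open>j\<close> is the other one with \<open>i\<close> and \<open>j\<close>
  exchanged, by symmetry of the adjacency matrix.\<close>

lemma smoothed_close:
  fixes \<epsilon> :: real
  assumes ij: "i \<in> {1..n}" "j \<in> {1..n}" "i \<noteq> j"
    and w: "w i j = w j i"
    and ne: "\<And>i j. i \<in> {1..n} \<Longrightarrow> j \<in> {1..n} \<Longrightarrow> i \<noteq> j \<Longrightarrow> nbhd C n (adjacency G) i j \<noteq> {}"
    and close: "\<And>i j i'. i \<in> {1..n} \<Longrightarrow> j \<in> {1..n} \<Longrightarrow> i \<noteq> j \<Longrightarrow> i' \<in> nbhd C n (adjacency G) i j \<Longrightarrow> \<bar>w i j - w i' j\<bar> \<le> \<epsilon>"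
    and conc: "\<And>i j. i \<in> {1..n} \<Longrightarrow> j \<in> {1..n} \<Longrightarrow> i \<noteq> j \<Longrightarrow>
      \<bar>\<Sum>i'\<in>nbhd C n (adjacency G) i j. adjacency G i' j - w i' j\<bar> \<le> \<epsilon> * card (nbhd C n (adjacency G) i j)"
  shows "\<bar>smoothed C n (adjacency G) i j - w i j\<bar> \<le> 2 * \<epsilon>"
proof -
  have avg: "\<bar>1 / real (card (nbhd C n (adjacency G) i j)) * (\<Sum>i'\<in>nbhd C n (adjacency G) i j. adjacency G i' j) - w i j\<bar> \<le> 2 * \<epsilon>"
    if ij: "i \<in> {1..n}" "j \<in> {1..n}" "i \<noteq> j" for i j
  proof -
    let ?N = "nbhd C n (adjacency G) i j"
    have "finite ?N" unfolding nbhd_def by simp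
    then have c: "0 < real (card ?N)" using ne[OF ij] by (simp add: card_gt_0_iff)
    have "\<bar>\<Sum>i'\<in>?N. w i' j - w i j\<bar> \<le> (\<Sum>i'\<in>?N. \<epsilon>)"
      using close[OF ij] by (intro order_trans[OF sum_abs sum_mono]) (simp add: abs_minus_commute)
    moreover have "(\<Sum>i'\<in>?N. adjacency G i' j) - card ?N * w i j =
        (\<Sum>i'\<in>?N. adjacency G i' j - w i' j) + (\<Sum>i'\<in>?N. w i' j - w i j)"
      by (simp add: sum_subtractf)
    ultimately have "\<bar>(\<Sum>i'\<in>?N. adjacency G i' j) - card ?N * w i j\<bar> \<le> 2 * \<epsilon> * card ?N"
      using conc[OF ij] by (simp add: mult.commute)
    moreover have "1 / real (card ?N) * (\<Sum>i'\<in>?N. adjacency G i' j) - w i j =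
        ((\<Sum>i'\<in>?N. adjacency G i' j) - card ?N * w i j) / card ?N" using c by (simp add: field_simps)
    ultimately show ?thesis using c by (simp add: field_simps)
  qed
  have "smoothed C n (adjacency G) i j =
      1 / 2 * (1 / real (card (nbhd C n (adjacency G) i j)) * (\<Sum>i'\<in>nbhd C n (adjacency G) i j. adjacency G i' j) +
        1 / real (card (nbhd C n (adjacency G) j i)) * (\<Sum>j'\<in>nbhd C n (adjacency G) j i. adjacency G j' i))"
    unfolding smoothed_def using adjacency_sym[of G i] by presburger
  moreover have "\<bar>1 / 2 * (a + b) - c\<bar> \<le> 2 * \<epsilon>" if "\<bar>a - c\<bar> \<le> 2 * \<epsilon>" "\<bar>b - c\<bar> \<le> 2 * \<epsilon>" for a b c :: real
    using that by argo
  ultimately show ?thesis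
    using avg[OF ij] avg[OF ij(2) ij(1) ij(3)[symmetric]] w by metis
qed

section \<open>Clusters and mergeons\<close>

lemma null_sets_lebesgue_subset:
  fixes N :: "'a::euclidean_space set"
  assumes "N \<in> null_sets lebesgue" "A \<subseteq> N"
  shows "A \<in> null_sets lebesgue"
  using assms null_sets_completion_subset by blast

text \<open>Planar Lebesgue measure is the completion of the Borel product measure, so the null
  factor is first enlarged to a Borel null set, to which the product rule applies.\<close>

lemma null_sets_lebesgue_Times:
  fixes X Y :: "real set"
  assumes "X \<in> null_sets lebesgue \<or> Y \<in> null_sets lebesgue"
  shows "X \<times> Y \<in> null_sets lebesgue"
proof -
  have 1: "N \<times> UNIV \<in> null_sets (lebesgue :: (real \<times> real) measure)"
    and 2: "UNIV \<times> N \<in> null_sets (lebesgue :: (real \<times> real) measure)"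
    if "N \<in> null_sets lborel" for N :: "real set"
  proof -
    have "N \<times> UNIV \<in> null_sets (lborel \<Otimes>\<^sub>M lborel :: (real \<times> real) measure)"
      using that by (intro lborel.times_in_null_sets1) auto
    then show "N \<times> UNIV \<in> null_sets (lebesgue :: (real \<times> real) measure)"
      unfolding lborel_prod by (rule null_sets_completionI)
    have "UNIV \<times> N \<in> null_sets (lborel \<Otimes>\<^sub>M lborel :: (real \<times> real) measure)"
      using that by (intro lborel.times_in_null_sets2) auto
    then show "UNIV \<times> N \<in> null_sets (lebesgue :: (real \<times> real) measure)"
      unfolding lborel_prod by (rule null_sets_completionI)
  qed
  show ?thesis
    using assms
  proof
    assume "X \<in> null_sets lebesgue"
    then obtain N where "N \<in> null_sets lborel" "X \<subseteq> N" unfolding null_sets_completion_iff2 by auto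
    then show ?thesis using null_sets_lebesgue_subset[OF 1, of N "X \<times> Y"] by auto
  next
    assume "Y \<in> null_sets lebesgue"
    then obtain N where "N \<in> null_sets lborel" "Y \<subseteq> N" unfolding null_sets_completion_iff2 by auto
    then show ?thesis using null_sets_lebesgue_subset[OF 2, of N "X \<times> Y"] by auto
  qed
qed

text \<open>Dually, each factor is shrunk to its Borel main part, which has the same
  measure.\<close>

lemma null_sets_lebesgue_Times_D:
  fixes X Y :: "real set"
  assumes "X \<in> sets lebesgue" "Y \<in> sets lebesgue" "X \<times> Y \<in> null_sets lebesgue"
  shows "X \<in> null_sets lebesgue \<or> Y \<in> null_sets lebesgue"
proof -
  let ?X = "main_part lborel X" and ?Y = "main_part lborel Y"
  have "?X \<subseteq> X" "?Y \<subseteq> Y"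
    using assms main_part_null_part_Un[of X lborel] main_part_null_part_Un[of Y lborel] by blast+
  then have "?X \<times> ?Y \<in> null_sets (lebesgue :: (real \<times> real) measure)"
    using assms(3) by (intro null_sets_lebesgue_subset[OF assms(3)]) auto
  moreover have XY: "?X \<in> sets lborel" "?Y \<in> sets lborel"
    using main_part_sets[OF assms(1)] main_part_sets[OF assms(2)] by auto
  then have "?X \<times> ?Y \<in> sets (lborel :: (real \<times> real) measure)"
    unfolding lborel_prod[symmetric] by (rule pair_measureI)
  ultimately have "?X \<times> ?Y \<in> null_sets (lborel \<Otimes>\<^sub>M lborel)"
    unfolding lborel_prod by (simp add: null_sets_completion_iff)
  then have "emeasure lborel ?X = 0 \<or> emeasure lborel ?Y = 0"
    using XY by (simp add: null_sets_def lborel.emeasure_pair_measure_Times)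
  then show ?thesis using assms(1,2) by (auto simp: null_sets_def)
qed

text \<open>This is how almost everywhere bounds on \<open>W\<close> are exploited: a rectangle on
  which the bound fails must have a null side.\<close>

lemma AE_lebesgue_Times_null:
  fixes X Y :: "real set"
  assumes "AE (x, y) in lebesgue. P x y" "X \<in> sets lebesgue" "Y \<in> sets lebesgue"
    and "\<And>x y. x \<in> X \<Longrightarrow> y \<in> Y \<Longrightarrow> \<not> P x y"
  shows "X \<in> null_sets lebesgue \<or> Y \<in> null_sets lebesgue"
proof -
  obtain N where N: "N \<in> null_sets lebesgue" "{z \<in> space lebesgue. \<not> (case z of (x, y) \<Rightarrow> P x y)} \<subseteq> N"
    using assms(1) unfolding eventually_ae_filter by blast
  have "X \<times> Y \<subseteq> N" using assms(4) N(2) by fastforce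
  then have "X \<times> Y \<in> null_sets lebesgue" using N(1) null_sets_lebesgue_subset by blast
  then show ?thesis using null_sets_lebesgue_Times_D assms by blast
qed

lemma AE_lebesgueI_null:
  assumes "N \<in> null_sets lebesgue" "\<And>x y. (x, y) \<notin> N \<Longrightarrow> P x y"
  shows "AE (x, y) in lebesgue. P x y"
  using assms by (intro AE_I'[of N]) auto

lemma unit_lmeasurable:
  fixes X :: "real set"
  assumes "X \<in> sets lebesgue" "X \<subseteq> {0..1}"
  shows "X \<in> lmeasurable"
  using assms by (meson bounded_closed_interval bounded_subset bounded_set_imp_lmeasurable)

lemma unit_measure_pos_iff:
  fixes X :: "real set"
  assumes "X \<in> sets lebesgue" "X \<subseteq> {0..1}"
  shows "0 < measure lebesgue X \<longleftrightarrow> X \<notin> null_sets lebesgue"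
proof -
  have "emeasure lebesgue X = ennreal (measure lebesgue X)"
    using unit_lmeasurable[OF assms] by (simp add: emeasure_eq_measure2)
  then show ?thesis using assms(1) by (auto simp: null_sets_def ennreal_eq_0_iff zero_less_measure_iff not_le)
qed

lemma unit_measure_less_iff:
  fixes X :: "real set"
  assumes "X \<in> sets lebesgue" "X \<subseteq> {0..1}" "S \<in> sets lebesgue" "S \<subseteq> X"
  shows "measure lebesgue S < measure lebesgue X \<longleftrightarrow> X - S \<notin> null_sets lebesgue"
proof -
  have "measure lebesgue (X - S) = measure lebesgue X - measure lebesgue S"
    using unit_lmeasurable[OF assms(1,2)] assms
    by (intro measure_Diff) (auto simp: fmeasurable_def)
  then show ?thesis using unit_measure_pos_iff[of "X - S"] assms by auto
qed

text \<open>It lets all later connectivity arguments speak of null sets only: inside the unit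
  interval, smaller measure of a subset means a non-null complement.\<close>

lemma conn_sets_iff:
  "A \<in> conn_sets W l \<longleftrightarrow> A \<in> sets lebesgue \<and> A \<subseteq> {0..1} \<and> A \<notin> null_sets lebesgue \<and>
    (\<forall>l'<l. \<forall>S\<in>sets lebesgue. S \<subseteq> A \<longrightarrow> (AE (x, y) in lebesgue. x \<in> S \<and> y \<in> A - S \<longrightarrow> W x y < l') \<longrightarrow>
       S \<in> null_sets lebesgue \<or> A - S \<in> null_sets lebesgue)"
proof (cases "A \<in> sets lebesgue \<and> A \<subseteq> {0..1}")
  case True
  have "0 < measure lebesgue S \<longleftrightarrow> S \<notin> null_sets lebesgue"
    "measure lebesgue S < measure lebesgue A \<longleftrightarrow> A - S \<notin> null_sets lebesgue"
    if "S \<in> sets lebesgue" "S \<subseteq> A" for S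
    using unit_measure_less_iff[of A S] unit_measure_pos_iff[of S] that True by auto
  note * = this
  define Q where "Q l' S \<longleftrightarrow> (AE (x, y) in lebesgue. x \<in> S \<and> y \<in> A - S \<longrightarrow> W x y < l')" for l' S
  have "\<not> disconnected_at W l' A \<longleftrightarrow> (\<forall>S\<in>sets lebesgue. S \<subseteq> A \<longrightarrow> Q l' S \<longrightarrow>
       S \<in> null_sets lebesgue \<or> A - S \<in> null_sets lebesgue)" for l'
    unfolding disconnected_at_def Q_def[symmetric] using * by blast
  then show ?thesis
    unfolding conn_sets_def mem_Collect_eq Q_def[symmetric]
    using True unit_measure_pos_iff[of A] by simp
qed (auto simp: conn_sets_def)

lemma conn_setsD:
  assumes "A \<in> conn_sets W l" "l' < l" "S \<in> sets lebesgue" "S \<subseteq> A"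
    and "AE (x, y) in lebesgue. x \<in> S \<and> y \<in> A - S \<longrightarrow> W x y < l'"
  shows "S \<in> null_sets lebesgue \<or> A - S \<in> null_sets lebesgue"
proof -
  have "\<forall>l'<l. \<forall>S\<in>sets lebesgue. S \<subseteq> A \<longrightarrow>
      (AE (x, y) in lebesgue. x \<in> S \<and> y \<in> A - S \<longrightarrow> W x y < l') \<longrightarrow>
      S \<in> null_sets lebesgue \<or> A - S \<in> null_sets lebesgue"
    using assms(1) unfolding conn_sets_iff by (elim conjE)
  from this[rule_format, OF assms(2-5)] show ?thesis .
qed

text \<open>A cut \<open>S\<close> of the union is trivial on \<open>A\<close> and on
  \<open>B\<close>. If it were trivial in opposite ways, \<open>A \<inter> B\<close> would be
  covered by two null sets.\<close>

lemma conn_sets_Un: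
  assumes "A \<in> conn_sets W l" "B \<in> conn_sets W l" "A \<inter> B \<notin> null_sets lebesgue"
  shows "A \<union> B \<in> conn_sets W l"
  unfolding conn_sets_iff
proof (intro conjI allI impI ballI)
  show "A \<union> B \<in> sets lebesgue" "A \<union> B \<subseteq> {0..1}" using assms unfolding conn_sets_iff by auto
  show "A \<union> B \<notin> null_sets lebesgue"
    using assms(3) null_sets_lebesgue_subset[of "A \<union> B" "A \<inter> B"] by blast
  fix l' S assume l': "l' < l" and S: "S \<in> sets lebesgue" "S \<subseteq> A \<union> B"
    and AE: "AE (x, y) in lebesgue. x \<in> S \<and> y \<in> A \<union> B - S \<longrightarrow> W x y < l'"
  have *: "S \<inter> X \<in> null_sets lebesgue \<or> X - S \<in> null_sets lebesgue"
    if X: "X \<in> conn_sets W l" "X \<subseteq> A \<union> B" for X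
  proof -
    have "S \<inter> X \<in> null_sets lebesgue \<or> X - S \<inter> X \<in> null_sets lebesgue"
    proof (rule conn_setsD[OF X(1) l'])
      show "S \<inter> X \<in> sets lebesgue" using S X(1) unfolding conn_sets_iff by auto
      show "AE (x, y) in lebesgue. x \<in> S \<inter> X \<and> y \<in> X - S \<inter> X \<longrightarrow> W x y < l'"
        using AE by (rule AE_mp) (use X in auto)
    qed auto
    moreover have "X - S \<inter> X = X - S" by auto
    ultimately show ?thesis by simp
  qed
  consider "S \<inter> A \<in> null_sets lebesgue" "S \<inter> B \<in> null_sets lebesgue"
    | "A - S \<in> null_sets lebesgue" "B - S \<in> null_sets lebesgue"
    | "(S \<inter> A) \<union> (B - S) \<in> null_sets lebesgue" | "(S \<inter> B) \<union> (A - S) \<in> null_sets lebesgue"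
    using *[OF assms(1)] *[OF assms(2)] by blast
  then show "S \<in> null_sets lebesgue \<or> A \<union> B - S \<in> null_sets lebesgue"
  proof cases
    case 1
    then have "(S \<inter> A) \<union> (S \<inter> B) \<in> null_sets lebesgue" by blast
    moreover have "(S \<inter> A) \<union> (S \<inter> B) = S" using S by auto
    ultimately show ?thesis by simp
  next
    case 2
    then show ?thesis by (simp add: Un_Diff null_sets.Un)
  next
    case 3
    then have "A \<inter> B \<in> null_sets lebesgue" by (rule null_sets_lebesgue_subset) auto
    then show ?thesis using assms(3) by simp
  next
    case 4
    then have "A \<inter> B \<in> null_sets lebesgue" by (rule null_sets_lebesgue_subset) auto
    then show ?thesis using assms(3) by simp
  qed
qed

lemma equiv_conn_rel: "equiv (conn_sets W l) (conn_rel W l)"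
proof (rule equivI)
  show "refl_on (conn_sets W l) (conn_rel W l)" unfolding refl_on_def conn_rel_def by auto
  show "conn_rel W l \<subseteq> conn_sets W l \<times> conn_sets W l" unfolding conn_rel_def by auto
  show "sym (conn_rel W l)" unfolding sym_def conn_rel_def by auto
  show "trans (conn_rel W l)"
  proof (rule transI)
    fix A1 A2 A3 assume "(A1, A2) \<in> conn_rel W l" "(A2, A3) \<in> conn_rel W l"
    then obtain A B where *: "A1 \<in> conn_sets W l" "A2 \<in> conn_sets W l" "A3 \<in> conn_sets W l"
      "A \<in> conn_sets W l" "A1 \<union> A2 \<subseteq> A" "B \<in> conn_sets W l" "A2 \<union> A3 \<subseteq> B"
      unfolding conn_rel_def by auto
    have "A \<inter> B \<notin> null_sets lebesgue"
      using * null_sets_lebesgue_subset[of "A \<inter> B" A2] unfolding conn_sets_iff by auto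
    then have "A \<union> B \<in> conn_sets W l" using * conn_sets_Un by blast
    then show "(A1, A3) \<in> conn_rel W l" using * unfolding conn_rel_def by blast
  qed
qed

lemma cluster_member:
  assumes "\<C> \<in> clusters W l" "A \<in> \<C>"
  shows "A \<in> conn_sets W l"
  using assms in_quotient_imp_subset[OF equiv_conn_rel] unfolding clusters_def ess_max_def by blast

text \<open>A non-null overlap would make \<open>A \<union> B\<close> connected and so put both sets
  in one class.\<close>

lemma clusters_disjoint:
  assumes "\<C> \<in> clusters W l" "\<D> \<in> clusters W l" "\<C> \<noteq> \<D>" "A \<in> \<C>" "B \<in> \<D>"
  shows "A \<inter> B \<in> null_sets lebesgue"
proof (rule ccontr)
  obtain \<A> \<B> where AB: "\<A> \<in> conn_sets W l // conn_rel W l" "\<C> = ess_max \<A>"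
    "\<B> \<in> conn_sets W l // conn_rel W l" "\<D> = ess_max \<B>"
    using assms unfolding clusters_def by auto
  assume "A \<inter> B \<notin> null_sets lebesgue"
  then have "A \<union> B \<in> conn_sets W l" using cluster_member assms conn_sets_Un by metis
  then have "(A, B) \<in> conn_rel W l" using cluster_member assms unfolding conn_rel_def by blast
  moreover have "A \<in> \<A>" "B \<in> \<B>" using assms AB unfolding ess_max_def by auto
  ultimately have "\<A> = \<B>" using quotient_eqI[OF equiv_conn_rel AB(1,3)] by metis
  then show False using AB assms by simp
qed

text \<open>Representatives are non-null, overlap in null sets and lie in the unit interval, so
  their measures are summable. Countability keeps unions of null rectangles over the clusters
  null.\<close>

lemma countable_clusters:
  assumes r: "\<forall>\<C>\<in>clusters W l. r \<C> \<in> \<C>"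
  shows "countable (clusters W l)"
proof -
  let ?m = "\<lambda>\<C>. measure lebesgue (r \<C>)"
  have mem: "r \<C> \<in> conn_sets W l" if "\<C> \<in> clusters W l" for \<C> using r cluster_member that by metis
  have fm: "r \<C> \<in> lmeasurable" if "\<C> \<in> clusters W l" for \<C>
    using mem[OF that] unit_lmeasurable unfolding conn_sets_iff by blast
  have "?m summable_on clusters W l"
  proof (rule nonneg_bdd_above_summable_on)
    show "bdd_above (sum ?m ` {F. F \<subseteq> clusters W l \<and> finite F})"
    proof (rule bdd_aboveI, clarify)
      fix F assume F: "F \<subseteq> clusters W l" "finite F"
      have "(\<Sum>\<C>\<in>F. ?m \<C>) = measure lebesgue (\<Union>\<C>\<in>F. r \<C>)"
      proof (rule measure_UNION_AE[symmetric])
        show "pairwise (\<lambda>\<C> \<D>. AE x in lebesgue. x \<notin> r \<C> \<or> x \<notin> r \<D>) F"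
        proof (rule pairwiseI)
          fix \<C> \<D> assume "\<C> \<in> F" "\<D> \<in> F" "\<C> \<noteq> \<D>"
          then have "r \<C> \<inter> r \<D> \<in> null_sets lebesgue" using F r by (intro clusters_disjoint[of \<C> W l \<D>]) auto
          then show "AE x in lebesgue. x \<notin> r \<C> \<or> x \<notin> r \<D>" by (intro AE_I') auto
        qed
      qed (use F fm in auto)
      also have "\<dots> \<le> measure lebesgue {0..1::real}"
        using F fm mem by (intro measure_mono_fmeasurable) (auto simp: conn_sets_iff subset_eq)
      finally show "(\<Sum>\<C>\<in>F. ?m \<C>) \<le> measure lebesgue {0..1::real}" .
    qed
  qed auto
  then have "countable {\<C> \<in> clusters W l. ?m \<C> \<noteq> 0}" by (rule summable_countable_real)
  moreover have "?m \<C> \<noteq> 0" if "\<C> \<in> clusters W l" for \<C>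
    using mem[OF that] unit_measure_pos_iff[of "r \<C>"] unfolding conn_sets_iff by auto
  ultimately show ?thesis by (smt (verit) Collect_cong mem_Collect_eq countable_subset subsetI)
qed

text \<open>The selector \<open>r\<close> in \<^const>\<open>mergeon\<close> yields a member of every cluster, so the existence of essential maxima
  is part of the assumption.\<close>

lemma mergeon_ge_on_conn_set:
  assumes M: "mergeon W M" and l: "l \<in> {0..1}" and A: "A \<in> conn_sets W l"
  shows "AE (x, y) in lebesgue. x \<in> A \<and> y \<in> A \<longrightarrow> l \<le> M x y"
proof -
  obtain r where r: "\<forall>\<C>\<in>clusters W l. r \<C> \<in> \<C>" and
    N: "sym_diff {(x, y). x \<in> {0..1} \<and> y \<in> {0..1} \<and> l \<le> M x y} (\<Union>\<C>\<in>clusters W l. r \<C> \<times> r \<C>) \<in> null_sets lebesgue"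
    (is "?N \<in> _")
    using M l unfolding mergeon_def by blast
  let ?C = "ess_max (conn_rel W l `` {A})"
  have C: "?C \<in> clusters W l" unfolding clusters_def using A by (auto intro: quotientI)
  have "A \<in> conn_rel W l `` {A}" using A unfolding conn_rel_def by auto
  then have "A - r ?C \<in> null_sets lebesgue" using r C unfolding ess_max_def by auto
  then have "(A - r ?C) \<times> UNIV \<union> UNIV \<times> (A - r ?C) \<union> ?N \<in> null_sets lebesgue"
    using N null_sets_lebesgue_Times by blast
  then show ?thesis
    by (rule AE_lebesgueI_null) (use C in blast)
qed

text \<open>The part of a cluster square inside \<open>K \<times> K'\<close> is a rectangle with a
  null side, and there are countably many clusters; elsewhere \<open>M\<close> reaches
  \<open>l\<close> only on a null set.\<close>

lemma mergeon_less_off_conn_sets: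
  assumes M: "mergeon W M" and l: "l \<in> {0..1}"
    and K: "\<And>A. A \<in> conn_sets W l \<Longrightarrow> A \<inter> K \<in> null_sets lebesgue \<or> A \<inter> K' \<in> null_sets lebesgue"
  shows "AE (x, y) in lebesgue. x \<in> K \<inter> {0..1} \<and> y \<in> K' \<inter> {0..1} \<longrightarrow> M x y < l"
proof -
  obtain r where r: "\<forall>\<C>\<in>clusters W l. r \<C> \<in> \<C>" and
    N: "sym_diff {(x, y). x \<in> {0..1} \<and> y \<in> {0..1} \<and> l \<le> M x y} (\<Union>\<C>\<in>clusters W l. r \<C> \<times> r \<C>) \<in> null_sets lebesgue"
    (is "?N \<in> _")
    using M l unfolding mergeon_def by blast
  have "(\<Union>\<C>\<in>clusters W l. (r \<C> \<inter> K) \<times> (r \<C> \<inter> K')) \<in> null_sets lebesgue"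
  proof (rule null_sets_UN')
    show "countable (clusters W l)" using r by (rule countable_clusters)
    show "(r \<C> \<inter> K) \<times> (r \<C> \<inter> K') \<in> null_sets lebesgue" if "\<C> \<in> clusters W l" for \<C>
      using K[of "r \<C>"] cluster_member[OF that] r that by (intro null_sets_lebesgue_Times) auto
  qed
  then have "(\<Union>\<C>\<in>clusters W l. (r \<C> \<inter> K) \<times> (r \<C> \<inter> K')) \<union> ?N \<in> null_sets lebesgue" using N by blast
  then show ?thesis
  proof (rule AE_lebesgueI_null)
    fix x y assume *: "(x, y) \<notin> (\<Union>\<C>\<in>clusters W l. (r \<C> \<inter> K) \<times> (r \<C> \<inter> K')) \<union> ?N"
    show "x \<in> K \<inter> {0..1} \<and> y \<in> K' \<inter> {0..1} \<longrightarrow> M x y < l"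
    proof (rule impI, rule ccontr)
      assume xy: "x \<in> K \<inter> {0..1} \<and> y \<in> K' \<inter> {0..1}" "\<not> M x y < l"
      then have "(x, y) \<in> (\<Union>\<C>\<in>clusters W l. r \<C> \<times> r \<C>)" using * by auto
      then show False using * xy by auto
    qed
  qed
qed

text \<open>Lebesgue measure has no atoms: the measure of \<open>X \<inter> {..t}\<close> is
  1-Lipschitz in \<open>t\<close> and so attains half the measure of \<open>X\<close>. Needed to cut
  inside a single cell that is joined to no cell.\<close>

lemma ex_splitting_subset:
  fixes X :: "real set"
  assumes X: "X \<in> sets lebesgue" "X \<subseteq> {0..1}" "X \<notin> null_sets lebesgue"
  shows "\<exists>S\<in>sets lebesgue. S \<subseteq> X \<and> S \<notin> null_sets lebesgue \<and> X - S \<notin> null_sets lebesgue"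
proof -
  let ?f = "\<lambda>t. measure lebesgue (X \<inter> {..t})"
  have L: "X \<inter> {..t} \<in> lmeasurable" for t using X by (intro unit_lmeasurable) auto
  have step: "?f s \<le> ?f t" "?f t \<le> ?f s + (t - s)" if "s \<le> t" for s t
  proof -
    show "?f s \<le> ?f t" using that L by (intro measure_mono_fmeasurable) (auto simp: fmeasurableD)
    have "?f t \<le> measure lebesgue ((X \<inter> {..s}) \<union> {s..t})"
      using L by (intro measure_mono_fmeasurable fmeasurable.Un) (auto simp: fmeasurableD)
    also have "\<dots> \<le> ?f s + measure lebesgue {s..t}"
      using L by (intro measure_Un_le) (auto simp: fmeasurableD)
    finally show "?f t \<le> ?f s + (t - s)" using that by simp
  qed
  have "continuous_on {0..1} ?f"
  proof (rule lipschitz_on_continuous_on[of 1], rule lipschitz_onI)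
    show "dist (?f s) (?f t) \<le> 1 * dist s t" for s t
      using step[of s t] step[of t s] by (cases "s \<le> t") (auto simp: dist_real_def)
  qed auto
  moreover have "?f 0 = 0"
  proof -
    have "X \<inter> {..0} \<subseteq> {0}" using X by auto
    then have "X \<inter> {..0} \<in> null_sets lebesgue" by (rule null_sets_lebesgue_subset[rotated]) auto
    then show ?thesis by (simp add: measure_def null_setsD1)
  qed
  moreover have pos: "0 < measure lebesgue X" using unit_measure_pos_iff X by auto
  moreover have X1: "X \<inter> {..1} = X" using X by auto
  ultimately obtain t where t: "?f t = measure lebesgue X / 2"
    using IVT'[of ?f 0 "measure lebesgue X / 2" 1] by auto
  show ?thesis
  proof (intro bexI[of _ "X \<inter> {..t}"] conjI)
    show "X \<inter> {..t} \<notin> null_sets lebesgue" using t pos unit_measure_pos_iff[of "X \<inter> {..t}"] X fmeasurableD[OF L] by auto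
    show "X - X \<inter> {..t} \<notin> null_sets lebesgue" using t pos unit_measure_less_iff[of X "X \<inter> {..t}"] X fmeasurableD[OF L] by auto
  qed (use X in auto)
qed

section \<open>Cells\<close>

text \<open>Null pieces are discarded, whence the covering only up to a null set; in return every
  cell attracts a positive fraction of the sample. Borel cells make the occupancy counts
  measurable.\<close>

definition cells :: "(real \<Rightarrow> real \<Rightarrow> real) \<Rightarrow> real \<Rightarrow> real set set \<Rightarrow> bool" where
  "cells W \<epsilon> \<K> \<longleftrightarrow> finite \<K> \<and> disjoint \<K> \<and>
     (\<forall>K\<in>\<K>. K \<in> sets borel \<and> K \<subseteq> {0..1} \<and> K \<notin> null_sets lebesgue) \<and>
     {0..1} - \<Union>\<K> \<in> null_sets lebesgue \<and>
     (\<forall>K\<in>\<K>. \<forall>K'\<in>\<K>. \<forall>x\<in>K. \<forall>x'\<in>K. \<forall>y\<in>K'. \<forall>y'\<in>K'. \<bar>W x y - W x' y'\<bar> \<le> \<epsilon>)"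

lemma piecewise_lipschitz_cells:
  assumes "piecewise_lipschitz W" "0 < \<epsilon>"
  shows "\<exists>\<K>. cells W \<epsilon> \<K>"
proof -
  obtain c P where c: "0 \<le> c" and P: "finite P" "partition_on {0..1} P" "\<And>B. B \<in> P \<Longrightarrow> is_interval B"
    and lip: "\<And>B B' x x' y y'. B \<in> P \<Longrightarrow> B' \<in> P \<Longrightarrow> x \<in> B \<Longrightarrow> x' \<in> B \<Longrightarrow> y \<in> B' \<Longrightarrow> y' \<in> B' \<Longrightarrow>
           \<bar>W x y - W x' y'\<bar> \<le> c * (\<bar>x - x'\<bar> + \<bar>y - y'\<bar>)"
    using assms(1) unfolding piecewise_lipschitz_def by metis
  \<comment> \<open>\<open>c + 1\<close> avoids division by zero; the factor 2 is there because both
    coordinates move by up to \<open>\<delta>\<close>.\<close>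
  define \<delta> where "\<delta> = \<epsilon> / (2 * (c + 1))"
  have \<delta>: "0 < \<delta>" "c * (2 * \<delta>) \<le> \<epsilon>" using c assms(2) by (auto simp: \<delta>_def field_simps)
  let ?cell = "\<lambda>(B, m :: int). B \<inter> {x. \<lfloor>x / \<delta>\<rfloor> = m}"
  let ?I = "P \<times> {0..\<lfloor>1 / \<delta>\<rfloor>}"
  let ?\<K> = "{K \<in> ?cell ` ?I. K \<notin> null_sets lebesgue}"
  have sub: "B \<subseteq> {0..1}" if "B \<in> P" for B using P(2) that unfolding partition_on_def by auto
  have cover: "{0..1} \<subseteq> \<Union>(?cell ` ?I)"
  proof
    fix x :: real assume x: "x \<in> {0..1}"
    then have "x \<in> \<Union>P" using P(2) unfolding partition_on_def by auto
    then obtain B where B: "B \<in> P" "x \<in> B" by blast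
    have "0 \<le> x / \<delta>" "x / \<delta> \<le> 1 / \<delta>" using x \<delta> by (auto simp: divide_right_mono)
    then have "(B, \<lfloor>x / \<delta>\<rfloor>) \<in> ?I" using B by (auto simp: floor_mono)
    then show "x \<in> \<Union>(?cell ` ?I)" using B by (intro UnionI[OF imageI]) auto
  qed
  have "cells W \<epsilon> ?\<K>"
    unfolding cells_def
  proof (intro conjI)
    show "finite ?\<K>" using P(1) by simp
    show "disjoint ?\<K>"
    proof (rule disjointI)
      fix K K' assume "K \<in> ?\<K>" "K' \<in> ?\<K>" "K \<noteq> K'"
      then obtain B m B' m' where K: "K = ?cell (B, m)" "K' = ?cell (B', m')" "B \<in> P" "B' \<in> P" "(B, m) \<noteq> (B', m')"
        by auto
      have "B = B' \<or> B \<inter> B' = {}" using P(2) K unfolding partition_on_def by (meson disjointD)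
      then show "K \<inter> K' = {}" using K by auto
    qed
    show "\<forall>K\<in>?\<K>. K \<in> sets borel \<and> K \<subseteq> {0..1} \<and> K \<notin> null_sets lebesgue"
    proof
      fix K assume "K \<in> ?\<K>"
      then obtain B m where K: "K = B \<inter> {x. \<lfloor>x / \<delta>\<rfloor> = m}" "B \<in> P" "K \<notin> null_sets lebesgue" by auto
      have "B \<in> sets borel" using P(3)[OF K(2)] by (intro real_interval_borel_measurable)
      moreover have "{x. \<lfloor>x / \<delta>\<rfloor> = m} \<in> sets borel" by measurable
      ultimately show "K \<in> sets borel \<and> K \<subseteq> {0..1} \<and> K \<notin> null_sets lebesgue" using K sub by auto
    qed
    show "{0..1} - \<Union>?\<K> \<in> null_sets lebesgue"
    proof (rule null_sets_lebesgue_subset)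
      show "\<Union>{K \<in> ?cell ` ?I. K \<in> null_sets lebesgue} \<in> null_sets lebesgue"
        using P(1) by (intro null_sets.finite_Union) auto
      have "X - \<Union>{K \<in> \<A>. K \<notin> \<N>} \<subseteq> \<Union>{K \<in> \<A>. K \<in> \<N>}" if "X \<subseteq> \<Union>\<A>"
        for X :: "real set" and \<A> \<N> using that by blast
      from this[OF cover] show "{0..1} - \<Union>?\<K> \<subseteq> \<Union>{K \<in> ?cell ` ?I. K \<in> null_sets lebesgue}" .
    qed
    show "\<forall>K\<in>?\<K>. \<forall>K'\<in>?\<K>. \<forall>x\<in>K. \<forall>x'\<in>K. \<forall>y\<in>K'. \<forall>y'\<in>K'. \<bar>W x y - W x' y'\<bar> \<le> \<epsilon>"
    proof (intro ballI)
      fix K K' x x' y y' assume "K \<in> ?\<K>" "K' \<in> ?\<K>" and xy: "x \<in> K" "x' \<in> K" "y \<in> K'" "y' \<in> K'"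
      then obtain B m B' m' where K: "K = ?cell (B, m)" "K' = ?cell (B', m')" "B \<in> P" "B' \<in> P" by auto
      have near: "\<bar>u - v\<bar> \<le> \<delta>" if "\<lfloor>u / \<delta>\<rfloor> = \<lfloor>v / \<delta>\<rfloor>" for u v
      proof -
        have "\<bar>u / \<delta> - v / \<delta>\<bar> \<le> 1" using that by linarith
        then show ?thesis using \<delta>(1) by (simp add: diff_divide_distrib[symmetric] field_simps)
      qed
      have "\<bar>W x y - W x' y'\<bar> \<le> c * (\<bar>x - x'\<bar> + \<bar>y - y'\<bar>)" using lip[of B B' x x' y y'] K xy by auto
      also have "\<dots> \<le> c * (\<delta> + \<delta>)" using near[of x x'] near[of y y'] K xy c by (intro mult_left_mono add_mono) auto
      finally show "\<bar>W x y - W x' y'\<bar> \<le> \<epsilon>" using \<delta>(2) by simp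
    qed
  qed
  then show ?thesis by blast
qed

lemma sym_cell_rel:
  assumes "graphon W" "cells W \<epsilon> \<K>"
  shows "sym (cell_rel W \<K> l)"
proof (rule symI)
  fix K K' assume *: "(K, K') \<in> cell_rel W \<K> l"
  then have "K \<subseteq> {0..1}" "K' \<subseteq> {0..1}" using assms(2) unfolding cells_def cell_rel_def by auto
  then have "l \<le> W y x" if "x \<in> K" "y \<in> K'" for x y
  proof -
    have "W x y = W y x" using assms(1) that \<open>K \<subseteq> {0..1}\<close> \<open>K' \<subseteq> {0..1}\<close> unfolding graphon_def by blast
    moreover have "l \<le> W x y" using * that by (auto simp: cell_rel_def)
    ultimately show ?thesis by simp
  qed
  then show "(K', K) \<in> cell_rel W \<K> l" using * by (auto simp: cell_rel_def)
qed

lemma cell_rel_antimono: "l' \<le> l \<Longrightarrow> cell_rel W \<K> l \<subseteq> cell_rel W \<K> l'"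
  by (fastforce simp: cell_rel_def)

text \<open>The closure must not be reflexive: \<open>W\<close> may be small on \<open>K \<times> K\<close>, and then \<open>K\<close> is not connected.\<close>

lemma trancl_cell_rel_conn_set:
  assumes W: "graphon W" and \<K>: "cells W \<epsilon> \<K>" and KK': "(K, K') \<in> (cell_rel W \<K> l)\<^sup>+"
  shows "\<exists>A\<in>conn_sets W l. K \<subseteq> A \<and> K' \<subseteq> A"
proof -
  let ?R = "cell_rel W \<K> l"
  define \<L> where "\<L> = ?R\<^sup>* `` {K}"
  have sym: "(L, L') \<in> ?R \<Longrightarrow> (L', L) \<in> ?R" for L L' using symD[OF sym_cell_rel[OF W \<K>]] .
  obtain K1 where K1: "(K, K1) \<in> ?R" using KK' by (meson converse_tranclE)
  then have K: "K \<in> \<K>" by (simp add: cell_rel_def)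
  have L\<K>: "L \<in> \<K>" if "L \<in> \<L>" for L
    using that K unfolding \<L>_def Image_singleton mem_Collect_eq
    by (induction rule: rtrancl_induct) (auto simp: cell_rel_def)
  have cell: "L \<in> sets lebesgue" "L \<subseteq> {0..1}" "L \<notin> null_sets lebesgue" if "L \<in> \<L>" for L
    using \<K> L\<K>[OF that] unfolding cells_def by auto
  \<comment> \<open>Loops count. For a cell other than \<open>K\<close>, the last step of a path
    from \<open>K\<close>, reversed, leads to a neighbour.\<close>
  have neighbour: "\<exists>L'\<in>\<L>. (L, L') \<in> ?R" if "L \<in> \<L>" for L
  proof (cases "L = K")
    case True
    then show ?thesis using K1 by (auto simp: \<L>_def)
  next
    case False
    then have "(K, L) \<in> ?R\<^sup>+" using that by (auto simp: \<L>_def dest: rtranclD)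
    then obtain L' where "(K, L') \<in> ?R\<^sup>*" "(L', L) \<in> ?R" by (meson tranclD2)
    then show ?thesis using sym by (auto simp: \<L>_def)
  qed
  have fin: "finite \<L>" using L\<K> \<K> unfolding cells_def by (meson finite_subset subsetI)
  have mem: "K \<in> \<L>" "K' \<in> \<L>" using KK' by (auto simp: \<L>_def)
  have "\<Union>\<L> \<in> conn_sets W l"
    unfolding conn_sets_iff
  proof (intro conjI allI impI ballI)
    show "\<Union>\<L> \<in> sets lebesgue" using fin cell by (intro sets.finite_Union) auto
    show "\<Union>\<L> \<subseteq> {0..1}" using cell by auto
    show "\<Union>\<L> \<notin> null_sets lebesgue"
      using null_sets_lebesgue_subset[of "\<Union>\<L>" K] mem cell(3)[of K] by blast
    fix l' S assume l': "l' < l" and S: "S \<in> sets lebesgue" "S \<subseteq> \<Union>\<L>"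
      and AE: "AE (x, y) in lebesgue. x \<in> S \<and> y \<in> \<Union>\<L> - S \<longrightarrow> W x y < l'"
    \<comment> \<open>\<open>W\<close> is at least \<open>l > l'\<close> on
      \<open>L \<times> L'\<close>, so the rectangle that the cut leaves in it must be null.\<close>
    have edge: "S \<inter> L \<in> null_sets lebesgue \<or> L' - S \<in> null_sets lebesgue"
      if "(L, L') \<in> ?R" "L \<in> \<L>" "L' \<in> \<L>" for L L'
    proof (rule AE_lebesgue_Times_null[OF AE])
      show "S \<inter> L \<in> sets lebesgue" "L' - S \<in> sets lebesgue" using S cell that by auto
      fix x y assume "x \<in> S \<inter> L" "y \<in> L' - S"
      moreover then have "l \<le> W x y" using that(1) by (auto simp: cell_rel_def)
      ultimately show "\<not> (x \<in> S \<and> y \<in> \<Union>\<L> - S \<longrightarrow> W x y < l')" using that l' by auto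
    qed
    have not_both: "\<not> (S \<inter> L \<in> null_sets lebesgue \<and> L - S \<in> null_sets lebesgue)" if "L \<in> \<L>" for L
    proof
      assume "S \<inter> L \<in> null_sets lebesgue \<and> L - S \<in> null_sets lebesgue"
      then have "S \<inter> L \<union> (L - S) \<in> null_sets lebesgue" by blast
      then have "L \<in> null_sets lebesgue" by (rule null_sets_lebesgue_subset) auto
      then show False using cell(3)[OF that] by simp
    qed
    \<comment> \<open>Going to a neighbour and back shows that no cell is properly cut, although
      \<open>W\<close> may be small on \<open>L \<times> L\<close>.\<close>
    have either: "S \<inter> L \<in> null_sets lebesgue \<or> L - S \<in> null_sets lebesgue" if L: "L \<in> \<L>" for L
    proof -
      obtain L' where L': "L' \<in> \<L>" "(L, L') \<in> ?R" using neighbour[OF L] by blast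
      show ?thesis using edge[OF L'(2) L L'(1)] edge[OF sym[OF L'(2)] L'(1) L] not_both[OF L'(1)] by blast
    qed
    have spread: "(S \<inter> L \<in> null_sets lebesgue \<longleftrightarrow> S \<inter> K \<in> null_sets lebesgue) \<and> L \<in> \<L>"
      if "(K, L) \<in> ?R\<^sup>*" for L
      using that
    proof (induction rule: rtrancl_induct)
      case base
      then show ?case using mem by simp
    next
      case (step L L')
      then have L': "L' \<in> \<L>" by (auto simp: \<L>_def)
      show ?case
        using step L' edge[OF step(2) _ L'] edge[OF sym[OF step(2)] L'] not_both[OF L'] not_both[of L]
          either[of L] either[OF L'] by blast
    qed
    show "S \<in> null_sets lebesgue \<or> \<Union>\<L> - S \<in> null_sets lebesgue"
    proof (cases "S \<inter> K \<in> null_sets lebesgue")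
      case True
      then have "S \<inter> L \<in> null_sets lebesgue" if "L \<in> \<L>" for L
        using spread[of L] that unfolding \<L>_def by blast
      then have "(\<Union>L\<in>\<L>. S \<inter> L) \<in> null_sets lebesgue"
        by (rule null_sets_UN'[OF countable_finite[OF fin]])
      moreover have "S = (\<Union>L\<in>\<L>. S \<inter> L)" using S by auto
      ultimately show ?thesis by simp
    next
      case False
      then have "L - S \<in> null_sets lebesgue" if "L \<in> \<L>" for L
        using spread[of L] either[OF that] that unfolding \<L>_def by blast
      then have "(\<Union>L\<in>\<L>. L - S) \<in> null_sets lebesgue"
        by (rule null_sets_UN'[OF countable_finite[OF fin]])
      moreover have "\<Union>\<L> - S = (\<Union>L\<in>\<L>. L - S)" by auto
      ultimately have "\<Union>\<L> - S \<in> null_sets lebesgue" by (rule ssubst[rotated])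
      then show ?thesis ..
    qed
  qed
  then show ?thesis using mem by blast
qed

text \<open>If \<open>K'\<close> is unreachable from \<open>K\<close>, the reachable cells cut
  \<open>A\<close>: two cells not joined at level \<open>l - 2 * \<epsilon>\<close> have a pair of
  points below it, hence by small oscillation \<open>W < l - \<epsilon>\<close> on their whole
  product. The second \<open>\<epsilon>\<close> gives the level strictly below \<open>l\<close> at
  which \<open>A\<close> is known to be connected.\<close>

lemma conn_set_trancl_cell_rel:
  assumes W: "graphon W" and \<K>: "cells W \<epsilon> \<K>" and \<epsilon>: "0 < \<epsilon>" and A: "A \<in> conn_sets W l"
    and K: "K \<in> \<K>" "K' \<in> \<K>" "A \<inter> K \<notin> null_sets lebesgue" "A \<inter> K' \<notin> null_sets lebesgue"
  shows "(K, K') \<in> (cell_rel W \<K> (l - 2 * \<epsilon>))\<^sup>+"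
proof (rule ccontr)
  let ?R = "cell_rel W \<K> (l - 2 * \<epsilon>)"
  assume neg: "(K, K') \<notin> ?R\<^sup>+"
  have sets: "L \<in> sets lebesgue" if "L \<in> \<K>" for L using \<K> that unfolding cells_def by auto
  have fin: "finite \<K>" and disj: "disjoint \<K>" and null: "{0..1} - \<Union>\<K> \<in> null_sets lebesgue"
    using \<K> unfolding cells_def by blast+
  have A': "A \<in> sets lebesgue" "A \<subseteq> {0..1}" using A unfolding conn_sets_iff by auto
  have low: "W x y < l - \<epsilon>" if L: "(L, L') \<notin> ?R" "L \<in> \<K>" "L' \<in> \<K>" "x \<in> L" "y \<in> L'" for L L' x y
  proof -
    obtain x' y' where xy': "x' \<in> L" "y' \<in> L'" "W x' y' < l - 2 * \<epsilon>"
      using L by (auto simp: cell_rel_def not_le)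
    then have "\<bar>W x y - W x' y'\<bar> \<le> \<epsilon>" using \<K> L unfolding cells_def by blast
    then show ?thesis using xy'(3) by linarith
  qed
  have split: "S \<in> null_sets lebesgue \<or> A - S \<in> null_sets lebesgue"
    if S: "S \<in> sets lebesgue" "S \<subseteq> A"
      and sep: "\<And>x y L'. x \<in> S \<Longrightarrow> y \<in> A - S \<Longrightarrow> L' \<in> \<K> \<Longrightarrow> y \<in> L' \<Longrightarrow> \<exists>L\<in>\<K>. x \<in> L \<and> (L, L') \<notin> ?R" for S
  proof (rule conn_setsD[OF A _ S])
    show "l - \<epsilon> < l" using \<epsilon> by simp
    have "(UNIV :: real set) \<times> ({0..1} - \<Union>\<K>) \<in> null_sets lebesgue" by (intro null_sets_lebesgue_Times disjI2 null)
    then show "AE (x, y) in lebesgue. x \<in> S \<and> y \<in> A - S \<longrightarrow> W x y < l - \<epsilon>"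
    proof (rule AE_lebesgueI_null, intro impI)
      fix x y assume *: "(x, y) \<notin> UNIV \<times> ({0..1} - \<Union>\<K>)" "x \<in> S \<and> y \<in> A - S"
      then obtain L' where L': "L' \<in> \<K>" "y \<in> L'" using A' by blast
      then obtain L where "L \<in> \<K>" "x \<in> L" "(L, L') \<notin> ?R" using sep * by blast
      then show "W x y < l - \<epsilon>" using low L' by blast
    qed
  qed
  show False
  proof (cases "?R `` {K} = {}")
    case True
    \<comment> \<open>No cell is joined to \<open>K\<close>, not even \<open>K\<close> itself, so
      any nontrivial cut inside \<open>A \<inter> K\<close> separates. Reachable cells would give no
      cut here, as there are none; the situation includes \<open>K = K'\<close>.\<close>
    obtain S where S: "S \<in> sets lebesgue" "S \<subseteq> A \<inter> K" "S \<notin> null_sets lebesgue" "A \<inter> K - S \<notin> null_sets lebesgue"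
      using ex_splitting_subset[of "A \<inter> K"] A' sets K by blast
    have "A - S \<notin> null_sets lebesgue" using S(4) null_sets_lebesgue_subset[of "A - S" "A \<inter> K - S"] by blast
    moreover have "S \<in> null_sets lebesgue \<or> A - S \<in> null_sets lebesgue"
      using S(1,2) True K by (intro split) blast+
    ultimately show False using S(3) by blast
  next
    case False
    define \<L> where "\<L> = ?R\<^sup>+ `` {K}"
    obtain K1 where K1: "(K, K1) \<in> ?R" using False by auto
    then have "(K1, K) \<in> ?R" using symD[OF sym_cell_rel[OF W \<K>]] by blast
    then have K\<L>: "K \<in> \<L>" using K1 by (auto simp: \<L>_def intro: trancl_into_trancl)
    have L\<K>: "\<L> \<subseteq> \<K>" unfolding \<L>_def by (auto elim!: tranclE simp: cell_rel_def)
    let ?S = "A \<inter> \<Union>\<L>"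
    have "\<Union>\<L> \<in> sets lebesgue" using fin L\<K> sets by (intro sets.finite_Union) (auto intro: finite_subset)
    then have "?S \<in> sets lebesgue" using A' by auto
    then have "?S \<in> null_sets lebesgue \<or> A - ?S \<in> null_sets lebesgue"
    proof (rule split)
      fix x y L' assume *: "x \<in> ?S" "y \<in> A - ?S" "L' \<in> \<K>" "y \<in> L'"
      then obtain L where L: "L \<in> \<L>" "x \<in> L" by auto
      have "L' \<notin> \<L>" using * by auto
      then have "(L, L') \<notin> ?R" using L(1) by (auto simp: \<L>_def intro: trancl_into_trancl)
      then show "\<exists>L\<in>\<K>. x \<in> L \<and> (L, L') \<notin> ?R" using L L\<K> by blast
    qed auto
    moreover have "?S \<notin> null_sets lebesgue" using K(3) K\<L> null_sets_lebesgue_subset[of ?S "A \<inter> K"] by blast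
    moreover have "A - ?S \<notin> null_sets lebesgue"
    proof -
      have "K' \<notin> \<L>" using neg by (auto simp: \<L>_def)
      then have "K' \<inter> \<Union>\<L> = {}" using disj K(2) L\<K> by (auto dest: disjointD)
      then have "A \<inter> K' \<subseteq> A - ?S" by auto
      then show ?thesis using K(4) null_sets_lebesgue_subset by blast
    qed
    ultimately show False by blast
  qed
qed

text \<open>The exceptional null set must not depend on the level, so only rational levels are used.
  Moving between a real and a rational level costs one \<open>\<epsilon>\<close>, hence
  \<open>l - \<epsilon>\<close> and \<open>3 * \<epsilon>\<close> in place of
  \<open>2 * \<epsilon>\<close>.\<close>

lemma mergeon_cells_AE:
  assumes W: "graphon W" and M: "mergeon W M" and \<K>: "cells W \<epsilon> \<K>" and \<epsilon>: "0 < \<epsilon>"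
  shows "AE (x, y) in lebesgue. \<forall>K\<in>\<K>. \<forall>K'\<in>\<K>. x \<in> K \<longrightarrow> y \<in> K' \<longrightarrow>
    (\<forall>l. (K, K') \<in> (cell_rel W \<K> l)\<^sup>+ \<longrightarrow> l - \<epsilon> \<le> M x y) \<and>
    (K, K') \<in> (cell_rel W \<K> (M x y - 3 * \<epsilon>))\<^sup>+"
proof -
  have gM: "graphon M" using M unfolding mergeon_def by blast
  have fin: "finite \<K>" using \<K> unfolding cells_def by blast
  have sub: "K \<subseteq> {0..1}" if "K \<in> \<K>" for K using \<K> that unfolding cells_def by auto
  let ?Q = "\<rat> \<inter> {0..1::real}"
  have Q: "countable ?Q" using countable_rat by (rule countable_subset[rotated]) auto
  have "AE z in lebesgue. \<forall>K\<in>\<K>. \<forall>K'\<in>\<K>. \<forall>q\<in>?Q. fst z \<in> K \<longrightarrow> snd z \<in> K' \<longrightarrow>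
      ((K, K') \<in> (cell_rel W \<K> q)\<^sup>+ \<longrightarrow> q \<le> M (fst z) (snd z)) \<and>
      (q \<le> M (fst z) (snd z) \<longrightarrow> (K, K') \<in> (cell_rel W \<K> (q - 2 * \<epsilon>))\<^sup>+)"
  proof (intro AE_ball_countable[OF countable_finite[OF fin], THEN iffD2] AE_ball_countable[OF Q, THEN iffD2] ballI)
    fix K K' q assume K: "K \<in> \<K>" "K' \<in> \<K>" and q: "q \<in> ?Q"
    have "AE z in lebesgue. fst z \<in> K \<longrightarrow> snd z \<in> K' \<longrightarrow>
        (K, K') \<in> (cell_rel W \<K> q)\<^sup>+ \<longrightarrow> q \<le> M (fst z) (snd z)"
    proof (cases "(K, K') \<in> (cell_rel W \<K> q)\<^sup>+")
      case True
      then obtain A where A: "A \<in> conn_sets W q" "K \<subseteq> A" "K' \<subseteq> A"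
        using trancl_cell_rel_conn_set[OF W \<K>] by blast
      have "AE (x, y) in lebesgue. x \<in> A \<and> y \<in> A \<longrightarrow> q \<le> M x y"
        using q by (intro mergeon_ge_on_conn_set[OF M _ A(1)]) auto
      then show ?thesis by (rule AE_mp) (use A in \<open>auto simp: case_prod_beta\<close>)
    qed auto
    moreover have "AE z in lebesgue. fst z \<in> K \<longrightarrow> snd z \<in> K' \<longrightarrow>
        q \<le> M (fst z) (snd z) \<longrightarrow> (K, K') \<in> (cell_rel W \<K> (q - 2 * \<epsilon>))\<^sup>+"
    proof (cases "(K, K') \<in> (cell_rel W \<K> (q - 2 * \<epsilon>))\<^sup>+")
      case False
      have "AE (x, y) in lebesgue. x \<in> K \<inter> {0..1} \<and> y \<in> K' \<inter> {0..1} \<longrightarrow> M x y < q"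
        using q conn_set_trancl_cell_rel[OF W \<K> \<epsilon> _ K] False
        by (intro mergeon_less_off_conn_sets[OF M]) blast+
      then show ?thesis by (rule AE_mp) (use sub K in \<open>auto simp: case_prod_beta subset_eq not_le\<close>)
    qed auto
    ultimately show "AE z in lebesgue. fst z \<in> K \<longrightarrow> snd z \<in> K' \<longrightarrow>
      ((K, K') \<in> (cell_rel W \<K> q)\<^sup>+ \<longrightarrow> q \<le> M (fst z) (snd z)) \<and>
      (q \<le> M (fst z) (snd z) \<longrightarrow> (K, K') \<in> (cell_rel W \<K> (q - 2 * \<epsilon>))\<^sup>+)"
      by eventually_elim blast
  qed
  then show ?thesis
  proof (rule AE_mp, intro AE_I2, unfold case_prod_beta, intro impI ballI conjI allI)
    fix z K K' l
    assume *: "\<forall>K\<in>\<K>. \<forall>K'\<in>\<K>. \<forall>q\<in>?Q. fst z \<in> K \<longrightarrow> snd z \<in> K' \<longrightarrow>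
      ((K, K') \<in> (cell_rel W \<K> q)\<^sup>+ \<longrightarrow> q \<le> M (fst z) (snd z)) \<and>
      (q \<le> M (fst z) (snd z) \<longrightarrow> (K, K') \<in> (cell_rel W \<K> (q - 2 * \<epsilon>))\<^sup>+)"
      and K: "K \<in> \<K>" "K' \<in> \<K>" "fst z \<in> K" "snd z \<in> K'"
    let ?m = "M (fst z) (snd z)"
    have z: "fst z \<in> {0..1}" "snd z \<in> {0..1}" using sub[OF K(1)] sub[OF K(2)] K(3,4) by auto
    then have m: "0 \<le> ?m" "?m \<le> 1" using gM unfolding graphon_def by auto
    show "l - \<epsilon> \<le> ?m" if l: "(K, K') \<in> (cell_rel W \<K> l)\<^sup>+"
    proof (cases "l - \<epsilon> \<le> 0")
      case False
      \<comment> \<open>\<open>mergeon\<close> speaks only of levels in the unit interval; a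
        nonempty path at level \<open>l\<close> forces \<open>l \<le> 1\<close>.\<close>
      have "l \<le> 1"
      proof -
        obtain K1 where K1: "(K, K1) \<in> cell_rel W \<K> l" using l by (meson converse_tranclE)
        then have "K1 \<in> \<K>" "K1 \<noteq> {}" using \<K> unfolding cells_def cell_rel_def by auto
        then obtain y where y: "y \<in> K1" by auto
        then have "l \<le> W (fst z) y" using K1 K by (auto simp: cell_rel_def)
        also have "\<dots> \<le> 1" using W z y sub \<open>K1 \<in> \<K>\<close> unfolding graphon_def by blast
        finally show ?thesis .
      qed
      obtain q where q: "q \<in> \<rat>" "l - \<epsilon> < q" "q < l" using Rats_dense_in_real[of "l - \<epsilon>" l] \<epsilon> by auto
      have "(K, K') \<in> (cell_rel W \<K> q)\<^sup>+"
        using l trancl_mono[OF _ cell_rel_antimono] q by (meson less_imp_le)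
      moreover have "q \<in> ?Q" using q False \<open>l \<le> 1\<close> by auto
      ultimately have "q \<le> ?m" using * K by blast
      then show ?thesis using q by linarith
    qed (use m in linarith)
    \<comment> \<open>For \<open>?m = 0\<close> no admissible level lies strictly below, but 0
      itself is rational.\<close>
    obtain q where q: "q \<in> ?Q" "q \<le> ?m" "?m - \<epsilon> \<le> q"
    proof (cases "?m = 0")
      case True
      then show ?thesis using that[of 0] \<epsilon> by auto
    next
      case False
      then have "max 0 (?m - \<epsilon>) < ?m" using m \<epsilon> by auto
      then obtain q where "q \<in> \<rat>" "max 0 (?m - \<epsilon>) < q" "q < ?m" using Rats_dense_in_real by blast
      then show ?thesis using that[of q] m by auto
    qed
    have "(K, K') \<in> (cell_rel W \<K> (q - 2 * \<epsilon>))\<^sup>+" using * K q by blast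
    then show "(K, K') \<in> (cell_rel W \<K> (?m - 3 * \<epsilon>))\<^sup>+"
      by (rule trancl_mono) (use q in \<open>intro cell_rel_antimono, linarith\<close>)
  qed
qed

section \<open>Samples\<close>

abbreviation unit_lebesgue :: "real measure" where
  "unit_lebesgue \<equiv> lebesgue_on {0..1}"

abbreviation sample_space :: "nat \<Rightarrow> (nat \<Rightarrow> real) measure" where
  "sample_space n \<equiv> \<Pi>\<^sub>M i\<in>{1..n}. unit_lebesgue"

lemma prob_space_unit_lebesgue: "prob_space unit_lebesgue"
  by (rule prob_space_restrict_space) auto

interpretation samples: product_prob_space "\<lambda>_ :: nat. unit_lebesgue" UNIV
  by (simp add: product_prob_space_def product_prob_space_axioms_def product_sigma_finite_def
      prob_space_unit_lebesgue prob_space_imp_sigma_finite)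

lemma prob_space_sample_space: "prob_space (sample_space n)"
  by (intro prob_space_PiM prob_space_unit_lebesgue)

lemma prob_space_completion:
  assumes "prob_space M"
  shows "prob_space (completion M)"
proof
  show "emeasure (completion M) (space (completion M)) = 1"
    using prob_space.emeasure_space_1[OF assms] by simp
qed

lemma space_sample_space: "x \<in> space (sample_space n) \<Longrightarrow> i \<in> {1..n} \<Longrightarrow> x i \<in> {0..1}"
  by (auto simp: space_PiM PiE_iff)

lemma measurable_sample_component:
  assumes "i \<in> {1..n}"
  shows "(\<lambda>x. x i) \<in> sample_space n \<rightarrow>\<^sub>M borel"
proof -
  have "(\<lambda>x. x) \<in> unit_lebesgue \<rightarrow>\<^sub>M borel" by (intro measurable_restrict_space1 measurable_completion) simp
  from measurable_compose[OF measurable_component_singleton[OF assms] this] show ?thesis by simp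
qed

lemma measurable_sample_pair:
  assumes "i \<in> {1..n}" "j \<in> {1..n}"
  shows "(\<lambda>x. (x i, x j)) \<in> sample_space n \<rightarrow>\<^sub>M borel"
  using assms by (intro borel_measurable_Pair measurable_sample_component)

text \<open>By Fubini, integrating over coordinate \<open>j\<close> with the others fixed. The null
  set is first enlarged to a Borel one, so that its indicator is measurable on the uncompleted
  product.\<close>

lemma AE_sample_pair:
  assumes ij: "i \<in> {1..n}" "j \<in> {1..n}" "i \<noteq> j" and AE: "AE (x, y) in lebesgue. P x y"
  shows "AE x in sample_space n. P (x i) (x j)"
proof -
  have "AE z in lborel. P (fst z) (snd z)" using AE by (simp add: case_prod_beta AE_completion_iff)
  then obtain N where N: "N \<in> null_sets lborel" "{z \<in> space lborel. \<not> P (fst z) (snd z)} \<subseteq> N"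
    unfolding eventually_ae_filter by blast
  have Nb: "N \<in> sets borel" using N(1) by auto
  have "AE z in lborel \<Otimes>\<^sub>M lborel. z \<notin> N" unfolding lborel_prod using N(1) by (rule AE_not_in)
  then have "AE u in lborel. AE v in lborel. (u, v) \<notin> N" by (rule lborel_pair.AE_pair)
  then have "AE u in lebesgue. AE v in lebesgue. (u, v) \<notin> N" unfolding AE_completion_iff .
  then have AEu: "AE u in unit_lebesgue. AE v in unit_lebesgue. (u, v) \<notin> N"
    by (simp add: AE_restrict_space_iff) (auto elim: eventually_mono)
  let ?I = "{1..n} - {j}"
  have I: "insert j ?I = {1..n}" using ij by auto
  let ?f = "\<lambda>x. indicator N (x i, x j) :: ennreal"
  have f: "?f \<in> borel_measurable (sample_space n)"
    by (rule measurable_compose[OF measurable_sample_pair[OF ij(1,2)]]) (use Nb in simp)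
  have "(\<integral>\<^sup>+x. ?f x \<partial>sample_space n) =
      (\<integral>\<^sup>+x. (\<integral>\<^sup>+y. ?f (x(j := y)) \<partial>unit_lebesgue) \<partial>(\<Pi>\<^sub>M i\<in>?I. unit_lebesgue))"
    using samples.product_nn_integral_insert[of ?I j ?f] f unfolding I by simp
  also have "\<dots> = (\<integral>\<^sup>+x. 0 \<partial>(\<Pi>\<^sub>M i\<in>?I. unit_lebesgue))"
  proof (rule nn_integral_cong_AE)
    have "AE x in (\<Pi>\<^sub>M i\<in>?I. unit_lebesgue). AE v in unit_lebesgue. (x i, v) \<notin> N"
      using ij by (intro AE_PiM_component AEu prob_space_unit_lebesgue) auto
    then show "AE x in (\<Pi>\<^sub>M i\<in>?I. unit_lebesgue). (\<integral>\<^sup>+y. ?f (x(j := y)) \<partial>unit_lebesgue) = 0"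
    proof eventually_elim
      case (elim x)
      have "(\<integral>\<^sup>+y. ?f (x(j := y)) \<partial>unit_lebesgue) = (\<integral>\<^sup>+y. 0 \<partial>unit_lebesgue)"
        using elim ij(3) by (intro nn_integral_cong_AE) (auto elim!: eventually_mono)
      then show ?case by simp
    qed
  qed
  finally have "(\<integral>\<^sup>+x. ?f x \<partial>sample_space n) = 0" by simp
  then have "AE x in sample_space n. ?f x = 0" by (rule nn_integral_0_iff_AE[OF f, THEN iffD1])
  then show ?thesis by (rule eventually_mono) (use N(2) in \<open>force simp: indicator_def split: if_splits\<close>)
qed

text \<open>A Lebesgue measurable set is Borel up to a null set, whose preimage is null by
  \<open>AE_sample_pair\<close> and thus measurable after completion.\<close>

lemma measurable_sample_pair_lebesgue:
  assumes ij: "i \<in> {1..n}" "j \<in> {1..n}" "i \<noteq> j"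
    and g: "(\<lambda>(x, y). g x y) \<in> borel_measurable (lebesgue_on ({0..1} \<times> {0..1}))"
  shows "(\<lambda>x. g (x i) (x j) :: real) \<in> borel_measurable (completion (sample_space n))"
proof -
  let ?h = "\<lambda>x :: nat \<Rightarrow> real. (x i, x j)"
  have h: "?h \<in> completion (sample_space n) \<rightarrow>\<^sub>M lborel"
    using measurable_completion[OF measurable_sample_pair[OF ij(1,2)]] by simp
  have "?h \<in> completion (sample_space n) \<rightarrow>\<^sub>M lebesgue"
  proof (rule completion.measurable_completion2[OF h], rule subsetI)
    fix N :: "(real \<times> real) set" assume N: "N \<in> null_sets lborel"
    then have "AE (x, y) in lebesgue. (x, y) \<notin> N" by (intro AE_completion) (auto dest: AE_not_in)
    then have "AE x in completion (sample_space n). (x i, x j) \<notin> N"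
      by (rule AE_completion[OF AE_sample_pair[OF ij]])
    then have "{x \<in> space (completion (sample_space n)). \<not> (x i, x j) \<notin> N} \<in> null_sets (completion (sample_space n))"
      by (rule completion.AE_iff_null_sets[THEN iffD1])
    moreover have "{x \<in> space (completion (sample_space n)). \<not> (x i, x j) \<notin> N} =
        ?h -` N \<inter> space (completion (sample_space n))" by blast
    ultimately have "?h -` N \<inter> space (completion (sample_space n)) \<in> null_sets (completion (sample_space n))"
      by (rule subst[rotated])
    then show "N \<in> null_sets (distr (completion (sample_space n)) lborel ?h)"
      unfolding null_sets_distr_iff[OF h] using null_setsD2[OF N] by (rule conjI)
  qed
  then have "?h \<in> completion (sample_space n) \<rightarrow>\<^sub>M lebesgue_on ({0..1} \<times> {0..1})"
    using space_sample_space[of _ n] ij by (intro measurable_restrict_space2) auto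
  from measurable_compose[OF this g] show ?thesis by simp
qed

lemma sum_indicator_count:
  fixes x :: "nat \<Rightarrow> 'a"
  shows "(\<Sum>i\<in>{1..n}. indicator K (x i) :: real) = real (card {i \<in> {1..n}. x i \<in> K})"
proof -
  have "(\<Sum>i\<in>{1..n}. indicator K (x i) :: real) = (\<Sum>i\<in>{i \<in> {1..n}. x i \<in> K}. 1)"
    by (rule sum.mono_neutral_cong_right) (auto simp: indicator_def)
  then show ?thesis by simp
qed

lemma sample_count_measurable:
  assumes "K \<in> sets borel"
  shows "(\<lambda>x. real (card {i \<in> {1..n}. x i \<in> K})) \<in> borel_measurable (sample_space n)"
proof -
  have "(\<lambda>x. indicator K (x i) :: real) \<in> borel_measurable (sample_space n)" if "i \<in> {1..n}" for i
    by (rule measurable_compose[OF measurable_sample_component[OF that]]) (use assms in simp)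
  then have "(\<lambda>x. \<Sum>i\<in>{1..n}. indicator K (x i) :: real) \<in> borel_measurable (sample_space n)"
    by (rule borel_measurable_sum)
  then show ?thesis unfolding sum_indicator_count .
qed

text \<open>Chernoff's bound with exponential parameter -1: each point contributes a factor of at
  most \<open>exp (- ?\<mu> / 2)\<close>, and the threshold \<open>?\<mu> / 4\<close> gives back
  half of that exponent.\<close>

lemma sample_occupancy_upper:
  assumes K: "K \<in> sets borel" "K \<subseteq> {0..1}"
  shows "emeasure (sample_space n) {x \<in> space (sample_space n).
      real (card {i \<in> {1..n}. x i \<in> K}) \<le> measure lebesgue K / 4 * n}
    \<le> ennreal (exp (- (measure lebesgue K / 4 * n)))"
proof -
  let ?\<mu> = "measure lebesgue K"
  let ?g = "\<lambda>y. ennreal (exp (- indicator K y))"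
  let ?B = "{x \<in> space (sample_space n). real (card {i \<in> {1..n}. x i \<in> K}) \<le> ?\<mu> / 4 * n}"
  have K': "K \<in> sets unit_lebesgue" using K by (auto simp: sets_restrict_space)
  have mK: "measure unit_lebesgue K = ?\<mu>" using K by (intro measure_restrict_space) auto
  have \<mu>1: "0 \<le> ?\<mu>" "?\<mu> \<le> 1" using prob_space.prob_le_1[OF prob_space_unit_lebesgue, of K] mK by auto
  have g: "?g \<in> borel_measurable unit_lebesgue" using K' by measurable
  have e: "exp (- 1 :: real) \<le> 1 / 2" using exp_ge_add_one_self[of 1] by (simp add: exp_minus field_simps)
  have "(\<integral>\<^sup>+y. ?g y \<partial>unit_lebesgue) = (\<integral>\<^sup>+y. ennreal (1 - (1 - exp (-1)) * indicator K y) \<partial>unit_lebesgue)"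
    by (intro nn_integral_cong arg_cong[of _ _ ennreal]) (auto simp: indicator_def)
  also have "\<dots> = ennreal (\<integral>y. 1 - (1 - exp (-1)) * indicator K y \<partial>unit_lebesgue)"
  proof (rule nn_integral_eq_integral)
    show "integrable unit_lebesgue (\<lambda>y. 1 - (1 - exp (-1)) * indicator K y :: real)"
      using K' e by (intro samples.M.integrable_const_bound[of _ 1]) (auto simp: indicator_def)
  qed (auto simp: indicator_def)
  also have "(\<integral>y. 1 - (1 - exp (-1)) * indicator K y \<partial>unit_lebesgue) = 1 - (1 - exp (-1)) * ?\<mu>"
  proof -
    have "integrable unit_lebesgue (indicator K :: real \<Rightarrow> real)"
      using K' by (intro samples.M.integrable_const_bound[of _ 1]) (auto simp: indicator_def)
    moreover have "integral\<^sup>L unit_lebesgue (indicator K :: real \<Rightarrow> real) = ?\<mu>"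
    proof -
      have "K \<inter> space unit_lebesgue = K" using K(2) by auto
      then show ?thesis by (simp only: Bochner_Integration.integral_indicator mK)
    qed
    moreover have "integral\<^sup>L unit_lebesgue (\<lambda>_. 1 :: real) = 1" using samples.M.prob_space by simp
    ultimately show ?thesis
      by (subst Bochner_Integration.integral_diff) auto
  qed
  also have "ennreal (1 - (1 - exp (-1)) * ?\<mu>) \<le> ennreal (exp (- ?\<mu> / 2))"
  proof (rule ennreal_leI)
    have "1 - (1 - exp (-1)) * ?\<mu> \<le> 1 + (- ?\<mu> / 2)"
      using mult_right_mono[OF e \<mu>1(1)] by (simp add: algebra_simps)
    also have "\<dots> \<le> exp (- ?\<mu> / 2)" by (rule exp_ge_add_one_self)
    finally show "1 - (1 - exp (-1)) * ?\<mu> \<le> exp (- ?\<mu> / 2)" .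
  qed
  finally have one: "(\<integral>\<^sup>+y. ?g y \<partial>unit_lebesgue) \<le> ennreal (exp (- ?\<mu> / 2))" .
  have card: "(\<Prod>i\<in>{1..n}. ?g (x i)) = ennreal (exp (- real (card {i \<in> {1..n}. x i \<in> K})))" for x :: "nat \<Rightarrow> real"
  proof -
    have "(\<Prod>i\<in>{1..n}. ?g (x i)) = ennreal (exp (\<Sum>i\<in>{1..n}. - indicator K (x i)))"
      by (simp add: prod_ennreal exp_sum)
    also have "(\<Sum>i\<in>{1..n}. - indicator K (x i)) = - real (card {i \<in> {1..n}. x i \<in> K})"
      unfolding sum_negf sum_indicator_count ..
    finally show ?thesis .
  qed
  have int: "(\<integral>\<^sup>+x. (\<Prod>i\<in>{1..n}. ?g (x i)) \<partial>sample_space n) \<le> ennreal (exp (- ?\<mu> / 2)) ^ n"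
    using samples.product_nn_integral_prod[of "{1..n}" "\<lambda>_. ?g"] g power_mono[OF one, of n] by simp
  have B: "?B \<in> sets (sample_space n)"
    using sample_count_measurable[OF K(1)] by (rule borel_measurable_le) simp
  have "ennreal (exp (- (?\<mu> / 4 * n))) * emeasure (sample_space n) ?B =
      (\<integral>\<^sup>+x. ennreal (exp (- (?\<mu> / 4 * n))) * indicator ?B x \<partial>sample_space n)"
    by (rule nn_integral_cmult_indicator[OF B, symmetric])
  also have "\<dots> \<le> (\<integral>\<^sup>+x. (\<Prod>i\<in>{1..n}. ?g (x i)) \<partial>sample_space n)"
    unfolding card by (intro nn_integral_mono) (auto simp: indicator_def intro!: ennreal_leI)
  also have "\<dots> \<le> ennreal (exp (- (?\<mu> / 2 * n)))"
    using int by (simp add: ennreal_power exp_of_nat_mult[symmetric] mult.commute)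
  also have "\<dots> = ennreal (exp (- (?\<mu> / 4 * n))) * ennreal (exp (- (?\<mu> / 4 * n)))"
    by (simp add: ennreal_mult'[symmetric] exp_add[symmetric])
  finally show ?thesis
    by (subst (asm) ennreal_mult_le_mult_iff) auto
qed

section \<open>Concentration of the smoothed matrix\<close>

definition edges :: "nat \<Rightarrow> nat set set" where
  "edges n = {e. e \<subseteq> {1..n} \<and> card e = 2}"

text \<open>\<open>Min\<close> and \<open>Max\<close> pick an orientation of the unordered pair; by
  symmetry of \<open>W\<close> the choice is immaterial.\<close>

definition edge_prob :: "(real \<Rightarrow> real \<Rightarrow> real) \<Rightarrow> (nat \<Rightarrow> real) \<Rightarrow> nat set \<Rightarrow> real" where
  "edge_prob W x e = W (x (Min e)) (x (Max e))"

lemma graphs_eq: "graphs n = Pow (edges n)"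
  by (simp add: graphs_def edges_def)

lemma finite_edges: "finite (edges n)"
  by (rule finite_subset[of _ "Pow {1..n}"]) (auto simp: edges_def)

lemma edgesE:
  assumes "e \<in> edges n"
  obtains i j where "1 \<le> i" "i < j" "j \<le> n" "e = {i, j}"
proof -
  obtain i j where "e = {i, j}" "i \<noteq> j" "i \<in> {1..n}" "j \<in> {1..n}"
    using assms unfolding edges_def by (auto simp: card_2_iff)
  then show ?thesis using that[of i j] that[of j i] by (cases "i < j") (auto simp: insert_commute)
qed

lemma insert_in_edges: "i \<in> {1..n} \<Longrightarrow> j \<in> {1..n} \<Longrightarrow> i \<noteq> j \<Longrightarrow> {i, j} \<in> edges n"
  by (auto simp: edges_def)

text \<open>The bridge from the sampling law to the finite sums: pairs with \<open>i < j\<close>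
  correspond bijectively to edges.\<close>

lemma label_density_eq:
  assumes "G \<subseteq> edges n"
  shows "label_density W n G x = bern_weight (edge_prob W x) (edges n) G"
proof -
  have "(\<Prod>(i, j) | 1 \<le> i \<and> i < j \<and> j \<le> n \<and> {i, j} \<in> H. f i j) = (\<Prod>e\<in>H. f (Min e) (Max e))"
    if H: "H \<subseteq> edges n" for H and f :: "nat \<Rightarrow> nat \<Rightarrow> real"
  proof (rule prod.reindex_bij_witness[where i = "\<lambda>e. (Min e, Max e)" and j = "\<lambda>(i, j). {i, j}"])
    fix e assume "e \<in> H"
    then have "e \<in> edges n" using H by blast
    then obtain i j where "1 \<le> i" "i < j" "j \<le> n" "e = {i, j}" by (rule edgesE)
    then show "(case (Min e, Max e) of (i, j) \<Rightarrow> {i, j}) = e"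
      "(Min e, Max e) \<in> {(i, j). 1 \<le> i \<and> i < j \<and> j \<le> n \<and> {i, j} \<in> H}"
      using \<open>e \<in> H\<close> by auto
  qed auto
  note * = this
  have "{i, j} \<notin> G \<longleftrightarrow> {i, j} \<in> edges n - G" if "1 \<le> i" "i < j" "j \<le> n" for i j
    using that insert_in_edges[of i n j] by auto
  then have "{(i, j). 1 \<le> i \<and> i < j \<and> j \<le> n \<and> {i, j} \<notin> G} =
      {(i, j). 1 \<le> i \<and> i < j \<and> j \<le> n \<and> {i, j} \<in> edges n - G}" by auto
  then show ?thesis
    unfolding label_density_def bern_weight_def edge_prob_def
    using *[OF assms, of "\<lambda>i j. W (x i) (x j)"] *[of "edges n - G" "\<lambda>i j. 1 - W (x i) (x j)"] by simp
qed

lemma edge_prob_range: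
  assumes W: "graphon W" and x: "\<And>i. i \<in> {1..n} \<Longrightarrow> x i \<in> {0..1}" and e: "e \<in> edges n"
  shows "0 \<le> edge_prob W x e \<and> edge_prob W x e \<le> 1"
proof -
  obtain i j where ij: "1 \<le> i" "i < j" "j \<le> n" "e = {i, j}" using e by (rule edgesE)
  then have "x i \<in> {0..1}" "x j \<in> {0..1}" using x by auto
  then show ?thesis using W ij unfolding graphon_def edge_prob_def by auto
qed

lemma edge_prob_insert:
  assumes W: "graphon W" and x: "\<And>i. i \<in> {1..n} \<Longrightarrow> x i \<in> {0..1}"
    and "i \<in> {1..n}" "j \<in> {1..n}" "i \<noteq> j"
  shows "edge_prob W x {i, j} = W (x i) (x j)"
proof -
  have "W (x i) (x j) = W (x j) (x i)" using W x[OF assms(3)] x[OF assms(4)] unfolding graphon_def by blast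
  then show ?thesis using assms(5) unfolding edge_prob_def by (cases "i < j") auto
qed

text \<open>The purpose of deleting \<open>j\<close>: neighbourhoods formed for column
  \<open>j\<close> do not depend on the edges at \<open>j\<close>.\<close>

lemma nbhd_cong:
  assumes "delete_vertex j A = delete_vertex j B"
  shows "nbhd C n A i j = nbhd C n B i j"
  unfolding nbhd_def nbhd_dist_def assms ..

text \<open>The labels are fixed in this context, so \<open>P\<close> is the conditional law of the
  graph given the labels.\<close>

locale sampled_graphon =
  fixes W :: "real \<Rightarrow> real \<Rightarrow> real" and n :: nat and x :: "nat \<Rightarrow> real"
  assumes W: "graphon W" and x: "\<And>i. i \<in> {1..n} \<Longrightarrow> x i \<in> {0..1}"
begin

abbreviation "V \<equiv> {1..n}"
abbreviation "p \<equiv> edge_prob W x"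
abbreviation "P \<equiv> bern_prob p (edges n)"
abbreviation "w i j \<equiv> W (x i) (x j)"

lemma w: "i \<in> V \<Longrightarrow> j \<in> V \<Longrightarrow> w i j = w j i \<and> 0 \<le> w i j \<and> w i j \<le> 1"
  using W x[of i] x[of j] unfolding graphon_def by blast

lemma p: "e \<in> edges n \<Longrightarrow> 0 \<le> p e \<and> p e \<le> 1"
  by (rule edge_prob_range[OF W]) (rule x)

text \<open>The tail bound for edges at one vertex, indexed by their other ends; the coefficients
  may read the rest of the graph.\<close>

lemma bern_prob_star_tail:
  assumes k: "k \<in> V" and I: "I \<subseteq> V - {k}"
    and \<epsilon>: "0 \<le> \<epsilon>" "\<epsilon> \<le> 2"
    and F: "F = (\<lambda>l. {l, k}) ` I"
    and a: "\<And>H l. H \<subseteq> edges n - F \<Longrightarrow> l \<in> I \<Longrightarrow> \<bar>a H l\<bar> \<le> 1"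
    and Q: "\<And>H. H \<subseteq> edges n - F \<Longrightarrow> (\<Sum>l\<in>I. (a H l)\<^sup>2) \<le> Q H"
    and m: "\<And>H. H \<subseteq> edges n - F \<Longrightarrow> m \<le> Q H"
  shows "P (\<lambda>G. \<epsilon> * Q (G - F) \<le> \<bar>\<Sum>l\<in>I. a (G - F) l * (adjacency G l k - w l k)\<bar>)
    \<le> 2 * exp (- (\<epsilon>\<^sup>2 * m / 4))"
proof -
  let ?e = "\<lambda>l. {l, k}"
  have inj: "inj_on ?e I" by (rule inj_onI) (auto simp: doubleton_eq_iff)
  define c where "c H e = a H (inv_into I ?e e)" for H e
  have c: "c H {l, k} = a H l" if "l \<in> I" for H l
    unfolding c_def using inv_into_f_f[OF inj that] by simp
  have FE: "F \<subseteq> edges n" using k I unfolding F by (auto intro!: insert_in_edges)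
  have sumF: "(\<Sum>e\<in>F. f e) = (\<Sum>l\<in>I. f {l, k})" for f :: "nat set \<Rightarrow> real"
    unfolding F using inj by (simp add: sum.reindex)
  have "P (\<lambda>G. \<epsilon> * Q (G - F) \<le> \<bar>\<Sum>e\<in>F. c (G - F) e * (of_bool (e \<in> G) - p e)\<bar>)
    \<le> 2 * exp (- (\<epsilon>\<^sup>2 * m / 4))"
  proof (rule bern_prob_tail[OF finite_edges FE p \<epsilon>])
    show "\<bar>c H e\<bar> \<le> 1" if "H \<subseteq> edges n - F" "e \<in> F" for H e
      using that a c unfolding F by auto
    show "(\<Sum>e\<in>F. (c H e)\<^sup>2) \<le> Q H" if "H \<subseteq> edges n - F" for H
      using Q[OF that] c by (simp add: sumF)
  qed (use m in auto)
  also have "(\<lambda>G. \<epsilon> * Q (G - F) \<le> \<bar>\<Sum>e\<in>F. c (G - F) e * (of_bool (e \<in> G) - p e)\<bar>) =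
      (\<lambda>G. \<epsilon> * Q (G - F) \<le> \<bar>\<Sum>l\<in>I. a (G - F) l * (adjacency G l k - w l k)\<bar>)"
  proof
    fix G
    have "(\<Sum>e\<in>F. c (G - F) e * (of_bool (e \<in> G) - p e)) = (\<Sum>l\<in>I. a (G - F) l * (adjacency G l k - w l k))"
      unfolding sumF
    proof (rule sum.cong)
      fix l assume l: "l \<in> I"
      then have "p {l, k} = w l k" using I k by (intro edge_prob_insert[OF W x]) auto
      then show "c (G - F) {l, k} * (of_bool ({l, k} \<in> G) - p {l, k}) = a (G - F) l * (adjacency G l k - w l k)"
        using c[OF l] by (simp add: adjacency_def)
    qed simp
    then show "(\<epsilon> * Q (G - F) \<le> \<bar>\<Sum>e\<in>F. c (G - F) e * (of_bool (e \<in> G) - p e)\<bar>) =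
      (\<epsilon> * Q (G - F) \<le> \<bar>\<Sum>l\<in>I. a (G - F) l * (adjacency G l k - w l k)\<bar>)" by simp
  qed
  finally show ?thesis .
qed

text \<open>Products of edges are linearised by changing one factor at a time: the edges at
  \<open>k\<close> are centred with the edges at \<open>i\<close> as frozen coefficients, then the
  edges at \<open>i\<close> with the constants \<open>w l k\<close>.\<close>

lemma bern_prob_common_neighbours_tail:
  fixes \<tau> :: real
  assumes ijk: "i \<in> V" "j \<in> V" "k \<in> V" "i \<noteq> j" "i \<noteq> k" "j \<noteq> k" and \<tau>: "0 \<le> \<tau>" "\<tau> \<le> 2"
  shows "P (\<lambda>G. 2 * \<tau> * n \<le> \<bar>\<Sum>l\<in>V - {i, j, k}. adjacency G i l * adjacency G l k - w i l * w l k\<bar>)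
    \<le> 4 * exp (- (\<tau>\<^sup>2 * n / 4))"
proof -
  let ?I = "V - {i, j, k}"
  let ?F = "(\<lambda>l. {l, k}) ` ?I" and ?F' = "(\<lambda>l. {l, i}) ` ?I"
  let ?X = "\<lambda>G. \<Sum>l\<in>?I. adjacency (G - ?F) i l * (adjacency G l k - w l k)"
  let ?Y = "\<lambda>G. \<Sum>l\<in>?I. w l k * (adjacency G l i - w l i)"
  have card_I: "real (card ?I) \<le> real n" using card_mono[of V ?I] by simp
  have sq: "(\<Sum>l\<in>?I. (f l)\<^sup>2) \<le> real n" if "\<And>l. l \<in> ?I \<Longrightarrow> \<bar>f l\<bar> \<le> 1" for f :: "nat \<Rightarrow> real"
  proof -
    have "(\<Sum>l\<in>?I. (f l)\<^sup>2) \<le> (\<Sum>l\<in>?I. 1)"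
      using that by (intro sum_mono) (simp add: abs_square_le_1)
    then show ?thesis using card_I by simp
  qed
  have adj: "\<bar>adjacency H i l\<bar> \<le> 1" for H l by (simp add: adjacency_def)
  have ww: "\<bar>w l k\<bar> \<le> 1" if "l \<in> ?I" for l using w[of l k] that ijk by auto
  have 1: "P (\<lambda>G. \<tau> * n \<le> \<bar>?X G\<bar>) \<le> 2 * exp (- (\<tau>\<^sup>2 * n / 4))"
  proof (rule bern_prob_star_tail[of k ?I \<tau> ?F "\<lambda>H l. adjacency H i l" "\<lambda>_. real n" "real n"])
    show "(\<Sum>l\<in>?I. (adjacency H i l)\<^sup>2) \<le> real n" for H by (rule sq) (rule adj)
  qed (use ijk \<tau> adj in auto)
  have 2: "P (\<lambda>G. \<tau> * n \<le> \<bar>?Y G\<bar>) \<le> 2 * exp (- (\<tau>\<^sup>2 * n / 4))"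
  proof (rule bern_prob_star_tail[of i ?I \<tau> ?F' "\<lambda>H l. w l k" "\<lambda>_. real n" "real n"])
    show "(\<Sum>l\<in>?I. (w l k)\<^sup>2) \<le> real n" by (rule sq) (rule ww)
  qed (use ijk \<tau> ww in auto)
  have split: "(\<Sum>l\<in>?I. adjacency G i l * adjacency G l k - w i l * w l k) = ?X G + ?Y G" for G
    unfolding sum.distrib[symmetric]
  proof (rule sum.cong)
    fix l assume l: "l \<in> ?I"
    \<comment> \<open>The coefficients read only edges that avoid \<open>k\<close>, so removing the
      star at \<open>k\<close> does not change them.\<close>
    then have "{i, l} \<notin> ?F" using ijk by (auto simp: doubleton_eq_iff)
    then have "adjacency (G - ?F) i l = adjacency G i l" by (simp add: adjacency_def)
    moreover have "w i l = w l i" using w[of i l] l ijk by auto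
    moreover have "adjacency G l i = adjacency G i l" by (rule adjacency_sym)
    ultimately show "adjacency G i l * adjacency G l k - w i l * w l k =
        adjacency (G - ?F) i l * (adjacency G l k - w l k) + w l k * (adjacency G l i - w l i)"
      by (simp add: algebra_simps)
  qed simp
  have "P (\<lambda>G. 2 * \<tau> * n \<le> \<bar>\<Sum>l\<in>?I. adjacency G i l * adjacency G l k - w i l * w l k\<bar>)
      \<le> P (\<lambda>G. \<tau> * n \<le> \<bar>?X G\<bar> \<or> \<tau> * n \<le> \<bar>?Y G\<bar>)"
    unfolding split
  proof (rule bern_prob_mono[OF finite_edges p])
    fix G assume "2 * \<tau> * n \<le> \<bar>?X G + ?Y G\<bar>"
    then show "\<tau> * n \<le> \<bar>?X G\<bar> \<or> \<tau> * n \<le> \<bar>?Y G\<bar>" by argo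
  qed auto
  also have "\<dots> \<le> P (\<lambda>G. \<tau> * n \<le> \<bar>?X G\<bar>) + P (\<lambda>G. \<tau> * n \<le> \<bar>?Y G\<bar>)"
    by (rule bern_prob_disj[OF finite_edges p])
  finally show ?thesis using 1 2 by linarith
qed

text \<open>The coefficients are membership indicators, whose squares sum to the size of the
  neighbourhood; this size is the random \<open>Q\<close>, bounded below through the
  quantile.\<close>

lemma bern_prob_nbhd_tail:
  assumes C: "0 < C" "C < 1" "3 \<le> n" and ij: "i \<in> V" "j \<in> V" "i \<noteq> j" and \<epsilon>: "0 \<le> \<epsilon>" "\<epsilon> \<le> 2"
  shows "P (\<lambda>G. \<epsilon> * real (card (nbhd C n (adjacency G) i j)) \<le>
      \<bar>\<Sum>i'\<in>nbhd C n (adjacency G) i j. adjacency G i' j - w i' j\<bar>)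
    \<le> 2 * exp (- (\<epsilon>\<^sup>2 * (bandwidth C n * real (n - 2)) / 4))"
proof -
  let ?I = "V - {j}"
  let ?F = "(\<lambda>l. {l, j}) ` ?I"
  let ?N = "\<lambda>H. nbhd C n (adjacency H) i j"
  have N: "?N H \<subseteq> ?I" for H unfolding nbhd_def by auto
  have sumN: "(\<Sum>l\<in>?I. of_bool (l \<in> ?N H) * f l) = (\<Sum>l\<in>?N H. f l)" for H and f :: "nat \<Rightarrow> real"
    using N[of H] by (intro sum.mono_neutral_cong_right) auto
  have cong: "?N (G - ?F) = ?N G" if "G \<subseteq> edges n" for G
  proof (rule nbhd_cong, intro ext)
    fix a b
    have "{a, b} \<notin> ?F" if "a \<noteq> j" "b \<noteq> j" using that by (auto simp: doubleton_eq_iff)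
    then show "delete_vertex j (adjacency (G - ?F)) a b = delete_vertex j (adjacency G) a b"
      by (auto simp: delete_vertex_def adjacency_def)
  qed
  have "P (\<lambda>G. \<epsilon> * real (card (?N G)) \<le> \<bar>\<Sum>i'\<in>?N G. adjacency G i' j - w i' j\<bar>)
      \<le> P (\<lambda>G. \<epsilon> * real (card (?N (G - ?F))) \<le> \<bar>\<Sum>l\<in>?I. of_bool (l \<in> ?N (G - ?F)) * (adjacency G l j - w l j)\<bar>)"
    by (rule bern_prob_mono[OF finite_edges p]) (simp_all only: sumN cong)
  also have "\<dots> \<le> 2 * exp (- (\<epsilon>\<^sup>2 * (bandwidth C n * real (n - 2)) / 4))"
  proof (rule bern_prob_star_tail[OF ij(2) _ \<epsilon>])
    fix H assume "H \<subseteq> edges n - ?F"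
    show "(\<Sum>l\<in>?I. (of_bool (l \<in> ?N H))\<^sup>2) \<le> real (card (?N H))"
      using sumN[of H "\<lambda>_. 1"] by (simp add: power2_eq_square)
    show "bandwidth C n * real (n - 2) \<le> real (card (?N H))"
      by (rule card_nbhd_ge[OF C ij])
  qed auto
  finally show ?thesis .
qed

text \<open>A union bound over triples and pairs; off these events the argument is deterministic.
  The factor 24 is 8 times the accuracy \<open>3 * \<tau>\<close> achieved for the neighbour
  counts.\<close>

lemma bern_prob_smoothed_far:
  fixes \<kappa> :: "nat \<Rightarrow> 'c" and \<kappa>' :: "nat \<Rightarrow> 'd" and \<epsilon>\<^sub>0 \<epsilon> \<beta> \<tau> :: real
  assumes C: "0 < C" "C < 1" and n: "4 \<le> n"
    and fine: "\<And>i i' l. i \<in> V \<Longrightarrow> i' \<in> V \<Longrightarrow> l \<in> V \<Longrightarrow> \<kappa> i = \<kappa> i' \<Longrightarrow> \<bar>w i l - w i' l\<bar> \<le> \<epsilon>\<^sub>0"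
    and fine_count: "\<And>i. i \<in> V \<Longrightarrow> 4 \<le> card {i' \<in> V. \<kappa> i' = \<kappa> i} \<and>
      bandwidth C n * real (n - 2) + 2 \<le> real (card {i' \<in> V. \<kappa> i' = \<kappa> i})"
    and coarse: "\<And>i i' l. i \<in> V \<Longrightarrow> i' \<in> V \<Longrightarrow> l \<in> V \<Longrightarrow> \<kappa>' i = \<kappa>' i' \<Longrightarrow> \<bar>w i l - w i' l\<bar> \<le> \<epsilon> / 4"
    and coarse_count: "\<And>i. i \<in> V \<Longrightarrow> \<beta> * n \<le> real (card {i' \<in> V. \<kappa>' i' = \<kappa>' i})"
    and small: "0 < \<epsilon>" "\<epsilon> \<le> 2" "0 \<le> \<tau>" "\<tau> \<le> 2" "3 / n \<le> \<tau>" "4 * \<epsilon>\<^sub>0 + 24 * \<tau> < \<beta> * \<epsilon>\<^sup>2 / 4"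
  shows "P (\<lambda>G. \<exists>i\<in>V. \<exists>j\<in>V. i \<noteq> j \<and> \<not> \<bar>smoothed C n (adjacency G) i j - w i j\<bar> \<le> 2 * \<epsilon>)
    \<le> real n ^ 3 * (4 * exp (- (\<tau>\<^sup>2 * n / 4))) +
       real n ^ 2 * (2 * exp (- (\<epsilon>\<^sup>2 * (bandwidth C n * real (n - 2)) / 4)))"
proof -
  define T where "T = (\<lambda>(i, j, k) G.
    2 * \<tau> * n \<le> \<bar>\<Sum>l\<in>V - {i, j, k}. adjacency G i l * adjacency G l k - w i l * w l k\<bar>)"
  define U where "U = (\<lambda>(i, j) G. \<epsilon> * real (card (nbhd C n (adjacency G) i j)) \<le>
      \<bar>\<Sum>i'\<in>nbhd C n (adjacency G) i j. adjacency G i' j - w i' j\<bar>)"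
  define I3 where "I3 = {(i, j, k). i \<in> V \<and> j \<in> V \<and> k \<in> V \<and> i \<noteq> j \<and> i \<noteq> k \<and> j \<noteq> k}"
  define I2 where "I2 = {(i, j). i \<in> V \<and> j \<in> V \<and> i \<noteq> j}"
  have I3: "I3 \<subseteq> V \<times> V \<times> V" "finite I3" and I2: "I2 \<subseteq> V \<times> V" "finite I2"
    unfolding I3_def I2_def by (auto intro: finite_subset[of _ "V \<times> V \<times> V"] finite_subset[of _ "V \<times> V"])
  have "card I3 \<le> n ^ 3" "card I2 \<le> n ^ 2"
    using card_mono[OF _ I3(1)] card_mono[OF _ I2(1)]
    by (simp_all add: card_cartesian_product power2_eq_square power3_eq_cube mult.assoc)
  then have card: "real (card I3) \<le> real n ^ 3" "real (card I2) \<le> real n ^ 2"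
    by (metis of_nat_le_iff of_nat_power)+
  have n0: "0 < real n" using n by simp
  have "P (\<lambda>G. \<exists>i\<in>V. \<exists>j\<in>V. i \<noteq> j \<and> \<not> \<bar>smoothed C n (adjacency G) i j - w i j\<bar> \<le> 2 * \<epsilon>)
      \<le> P (\<lambda>G. (\<exists>t\<in>I3. T t G) \<or> (\<exists>t\<in>I2. U t G))"
  proof (rule bern_prob_mono[OF finite_edges p])
    fix G assume G: "G \<subseteq> edges n"
      and ex: "\<exists>i\<in>V. \<exists>j\<in>V. i \<noteq> j \<and> \<not> \<bar>smoothed C n (adjacency G) i j - w i j\<bar> \<le> 2 * \<epsilon>"
    show "(\<exists>t\<in>I3. T t G) \<or> (\<exists>t\<in>I2. U t G)"
    proof (rule ccontr)
      assume neg: "\<not> ((\<exists>t\<in>I3. T t G) \<or> (\<exists>t\<in>I2. U t G))"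
      have Gn: "G \<in> graphs n" using G by (simp add: graphs_eq)
      have conc: "\<bar>mat_square n (delete_vertex j (adjacency G)) i k / n - (\<Sum>l\<in>V. w i l * w l k) / n\<bar> \<le> 3 * \<tau>"
        if ijk: "i \<in> V" "j \<in> V" "k \<in> V" "i \<noteq> j" "i \<noteq> k" "j \<noteq> k" for i j k
      proof -
        let ?D = "\<Sum>l\<in>V. w i l * w l k" and ?D' = "\<Sum>l\<in>V - {i, j, k}. w i l * w l k"
        let ?S = "mat_square n (delete_vertex j (adjacency G)) i k"
        have "(i, j, k) \<in> I3" using ijk by (auto simp: I3_def)
        then have "\<not> T (i, j, k) G" using neg by blast
        then have S: "\<bar>?S - ?D'\<bar> \<le> 2 * \<tau> * n"
          using mat_square_delete_vertex[OF Gn ijk(4), of k] ijk(6) by (simp add: T_def sum_subtractf)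
        \<comment> \<open>The three omitted indices cost at most \<open>3 / n \<le> \<tau>\<close>
          on top of \<open>2 * \<tau>\<close>.\<close>
        have "?D = ?D' + (\<Sum>l\<in>{i, j, k}. w i l * w l k)"
          using ijk by (intro sum.subset_diff) auto
        moreover have "0 \<le> w i l * w l k \<and> w i l * w l k \<le> 1" if "l \<in> V" for l
          using w[OF ijk(1) that] w[OF that ijk(3)] by (auto intro: mult_le_one)
        then have "\<bar>\<Sum>l\<in>{i, j, k}. w i l * w l k\<bar> \<le> (\<Sum>l\<in>{i, j, k}. 1)"
          using ijk by (intro order_trans[OF sum_abs sum_mono]) (metis abs_of_nonneg insertE singletonD)
        moreover have "real (card {i, j, k}) \<le> 3" by (simp add: card_insert_if)
        ultimately have "\<bar>?S - ?D\<bar> \<le> 2 * \<tau> * n + 3" using S by simp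
        also have "\<dots> \<le> 3 * \<tau> * n" using small(5) n0 by (simp add: field_simps)
        finally have "\<bar>?S - ?D\<bar> / n \<le> 3 * \<tau>" using n0 by (simp add: field_simps)
        then show ?thesis using n0 by (simp add: diff_divide_distrib[symmetric])
      qed
      have "\<bar>smoothed C n (adjacency G) i j - w i j\<bar> \<le> 2 * \<epsilon>" if ij: "i \<in> V" "j \<in> V" "i \<noteq> j" for i j
      proof (rule smoothed_close[where w = "\<lambda>i j. w i j", OF ij])
        show "w i j = w j i" using w ij by blast
        show "nbhd C n (adjacency G) i j \<noteq> {}" if ij: "i \<in> V" "j \<in> V" "i \<noteq> j" for i j
        proof -
          have "0 < bandwidth C n * real (n - 2)" using bandwidth_bounds(1)[OF C, of n] n by simp
          then show ?thesis using card_nbhd_ge[OF C _ ij, of "adjacency G"] n by auto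
        qed
        show "\<bar>w i j - w i' j\<bar> \<le> \<epsilon>" if "i \<in> V" "j \<in> V" "i \<noteq> j" "i' \<in> nbhd C n (adjacency G) i j" for i j i'
        proof (rule nbhd_close[OF C n w conc fine fine_count coarse coarse_count small(1) _ that])
        qed (use small in simp_all)
        show "\<bar>\<Sum>i'\<in>nbhd C n (adjacency G) i j. adjacency G i' j - w i' j\<bar> \<le> \<epsilon> * card (nbhd C n (adjacency G) i j)"
          if "i \<in> V" "j \<in> V" "i \<noteq> j" for i j
        proof -
          have "\<not> U (i, j) G" using neg that by (auto simp: I2_def)
          then show ?thesis by (simp add: U_def)
        qed
      qed
      then show False using ex by blast
    qed
  qed auto
  also have "\<dots> \<le> P (\<lambda>G. \<exists>t\<in>I3. T t G) + P (\<lambda>G. \<exists>t\<in>I2. U t G)"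
    by (rule bern_prob_disj[OF finite_edges p])
  also have "P (\<lambda>G. \<exists>t\<in>I3. T t G) \<le> real (card I3) * (4 * exp (- (\<tau>\<^sup>2 * n / 4)))"
  proof (rule bern_prob_Ex[OF finite_edges p I3(2)])
    fix t assume "t \<in> I3"
    then obtain i j k where t: "t = (i, j, k)" and ijk: "i \<in> V" "j \<in> V" "k \<in> V" "i \<noteq> j" "i \<noteq> k" "j \<noteq> k"
      unfolding I3_def by blast
    show "P (T t) \<le> 4 * exp (- (\<tau>\<^sup>2 * n / 4))"
      unfolding t T_def prod.case by (rule bern_prob_common_neighbours_tail[OF ijk small(3,4)])
  qed
  also have "\<dots> \<le> real n ^ 3 * (4 * exp (- (\<tau>\<^sup>2 * n / 4)))" using card by (intro mult_right_mono) auto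
  also have "P (\<lambda>G. \<exists>t\<in>I2. U t G) \<le> real (card I2) * (2 * exp (- (\<epsilon>\<^sup>2 * (bandwidth C n * real (n - 2)) / 4)))"
  proof (rule bern_prob_Ex[OF finite_edges p I2(2)])
    fix t assume "t \<in> I2"
    then show "P (U t) \<le> 2 * exp (- (\<epsilon>\<^sup>2 * (bandwidth C n * real (n - 2)) / 4))"
      using bern_prob_nbhd_tail[OF C] n small unfolding I2_def U_def by auto
  qed
  also have "\<dots> \<le> real n ^ 2 * (2 * exp (- (\<epsilon>\<^sup>2 * (bandwidth C n * real (n - 2)) / 4)))"
    using card by (intro mult_right_mono) auto
  finally show ?thesis by simp
qed

end

section \<open>Consistency\<close>

text \<open>Otherwise the simplifier turns the index set \<open>{1..n}\<close> of the product measure into \<open>{Suc 0..n}\<close> in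
  some places only, and facts no longer match.\<close>

declare One_nat_def [simp del]

lemma finite_graphs: "finite (graphs n)"
  by (simp add: graphs_eq finite_edges)

lemma sets_label_measure:
  "sets (label_measure W n) = sets (count_space (graphs n) \<Otimes>\<^sub>M completion (sample_space n))"
  unfolding label_measure_def by (rule sets_density)

lemma space_label_measure:
  "space (label_measure W n) = graphs n \<times> space (sample_space n)"
  by (simp only: label_measure_def space_density space_pair_measure space_completion space_count_space)

lemma graphon_sample_measurable:
  assumes "graphon W" "i \<in> {1..n}" "j \<in> {1..n}" "i \<noteq> j"
  shows "(\<lambda>x. W (x i) (x j)) \<in> borel_measurable (completion (sample_space n))"
  using assms unfolding graphon_def by (intro measurable_sample_pair_lebesgue) auto

lemma label_density_measurable:
  assumes W: "graphon W"
  shows "(\<lambda>(G, x). ennreal (label_density W n G x)) \<in>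
    borel_measurable (count_space (graphs n) \<Otimes>\<^sub>M completion (sample_space n))"
proof (rule measurable_pair_measure_countable1)
  show "countable (graphs n)" using finite_graphs by (rule countable_finite)
  fix G
  have "(\<lambda>x. label_density W n G x) \<in> borel_measurable (completion (sample_space n))"
    unfolding label_density_def case_prod_beta
    by (intro borel_measurable_times borel_measurable_prod borel_measurable_diff borel_measurable_const
        graphon_sample_measurable[OF W]) auto
  then show "(\<lambda>x. case (G, x) of (G, x) \<Rightarrow> ennreal (label_density W n G x)) \<in>
      borel_measurable (completion (sample_space n))" by simp
qed

text \<open>Fubini with the finite sum over graphs inside: the conditional probability is at most 1
  on \<open>S\<close> and at most \<open>b\<close> off it.\<close>

lemma emeasure_label_measure_le:
  assumes W: "graphon W" and E: "E \<in> sets (label_measure W n)"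
    and S: "S \<in> sets (completion (sample_space n))" "emeasure (completion (sample_space n)) S \<le> ennreal s"
    and b: "0 \<le> b" "0 \<le> s"
    and le: "AE x in completion (sample_space n).
      x \<notin> S \<longrightarrow> bern_prob (edge_prob W x) (edges n) (\<lambda>G. (G, x) \<in> E) \<le> b"
  shows "emeasure (label_measure W n) E \<le> ennreal (s + b)"
proof -
  let ?Q = "completion (sample_space n)"
  let ?d = "\<lambda>z. (case z of (G, x) \<Rightarrow> ennreal (label_density W n G x)) * indicator E z"
  have Qprob: "prob_space ?Q" by (intro prob_space_completion prob_space_sample_space)
  have E': "E \<in> sets (count_space (graphs n) \<Otimes>\<^sub>M ?Q)" using E unfolding sets_label_measure .
  have d: "?d \<in> borel_measurable (count_space (graphs n) \<Otimes>\<^sub>M ?Q)"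
    by (intro borel_measurable_times_ennreal label_density_measurable[OF W] borel_measurable_indicator E')
  have d': "(\<lambda>x. ?d (G, x)) \<in> borel_measurable ?Q" if "G \<in> graphs n" for G
    by (rule measurable_compose[OF measurable_Pair1' d]) (use that in simp)
  have "emeasure (label_measure W n) E = (\<integral>\<^sup>+z. ?d z \<partial>(count_space (graphs n) \<Otimes>\<^sub>M ?Q))"
    unfolding label_measure_def
    by (rule emeasure_density[OF label_density_measurable[OF W] E'])
  also have "\<dots> = (\<integral>\<^sup>+G. \<integral>\<^sup>+x. ?d (G, x) \<partial>?Q \<partial>count_space (graphs n))"
    by (rule sigma_finite_measure.nn_integral_fst[OF prob_space_imp_sigma_finite[OF Qprob] d, symmetric])
  also have "\<dots> = (\<Sum>G\<in>graphs n. \<integral>\<^sup>+x. ?d (G, x) \<partial>?Q)"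
    by (rule nn_integral_count_space_finite[OF finite_graphs])
  also have "\<dots> = (\<integral>\<^sup>+x. (\<Sum>G\<in>graphs n. ?d (G, x)) \<partial>?Q)"
    by (rule nn_integral_sum[symmetric]) (rule d')
  also have "\<dots> \<le> (\<integral>\<^sup>+x. indicator S x + ennreal b \<partial>?Q)"
  proof (rule nn_integral_mono_AE)
    have "AE x in ?Q. x \<in> space ?Q" by (rule AE_space)
    then show "AE x in ?Q. (\<Sum>G\<in>graphs n. ?d (G, x)) \<le> indicator S x + ennreal b"
      using le
    proof eventually_elim
      case (elim x)
      then have x: "x i \<in> {0..1}" if "i \<in> {1..n}" for i using space_sample_space that by simp
      note p = edge_prob_range[OF W x]
      let ?P = "bern_prob (edge_prob W x) (edges n) (\<lambda>G. (G, x) \<in> E)"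
      have "(\<Sum>G\<in>graphs n. ?d (G, x)) =
          (\<Sum>G\<in>graphs n. ennreal (bern_weight (edge_prob W x) (edges n) G * of_bool ((G, x) \<in> E)))"
        by (intro sum.cong refl) (auto simp: graphs_eq label_density_eq indicator_def)
      also have "\<dots> = ennreal (\<Sum>G\<in>graphs n. bern_weight (edge_prob W x) (edges n) G * of_bool ((G, x) \<in> E))"
        using p by (intro sum_ennreal) (auto simp: graphs_eq intro!: bern_weight_nonneg)
      also have "(\<Sum>G\<in>graphs n. bern_weight (edge_prob W x) (edges n) G * of_bool ((G, x) \<in> E)) = ?P"
        unfolding bern_prob_def using finite_edges
        by (intro sum.mono_neutral_cong_right) (auto simp: graphs_eq)
      finally have eq: "(\<Sum>G\<in>graphs n. ?d (G, x)) = ennreal ?P" .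
      show ?case
      proof (cases "x \<in> S")
        case True
        have "?P \<le> 1" by (rule bern_prob_le_1[OF finite_edges p])
        then have "ennreal ?P \<le> 1" by (simp add: ennreal_le_1)
        then show ?thesis unfolding eq using True by (simp add: add_increasing2)
      next
        case False
        then show ?thesis unfolding eq using elim by (simp add: ennreal_leI)
      qed
    qed
  qed
  also have "\<dots> = emeasure ?Q S + ennreal b"
    using S(1) prob_space.emeasure_space_1[OF Qprob] by (subst nn_integral_add) auto
  also have "\<dots> \<le> ennreal s + ennreal b" using S(2) by (rule add_right_mono)
  finally show ?thesis using b by simp
qed

text \<open>The diagonal of the square is a hyperplane, hence null.\<close>

lemma AE_sample_inj: "AE x in sample_space n. inj_on x {1..n}"
proof -
  have "AE x in sample_space n. \<forall>i\<in>{1..n}. \<forall>j\<in>{1..n}. i \<noteq> j \<longrightarrow> x i \<noteq> x j"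
  proof (intro AE_ball_countable[OF countable_finite, THEN iffD2] finite_atLeastAtMost ballI)
    fix i j assume ij: "i \<in> {1..n}" "j \<in> {1..n}"
    have "negligible {z :: real \<times> real. (1, -1) \<bullet> z = 0}" by (rule negligible_hyperplane) (simp add: zero_prod_def)
    then have "{z :: real \<times> real. (1, -1) \<bullet> z = 0} \<in> null_sets lebesgue" by (simp add: negligible_iff_null_sets)
    then have "AE (x, y) in (lebesgue :: (real \<times> real) measure). x \<noteq> y" by (rule AE_lebesgueI_null) auto
    then show "AE x in sample_space n. i \<noteq> j \<longrightarrow> x i \<noteq> x j"
      using AE_sample_pair[OF ij] by (cases "i = j") auto
  qed
  then show ?thesis by (rule eventually_mono) (auto simp: inj_on_def)
qed

text \<open>For injective labels the event is a finite combination of inequalities between values of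
  \<open>M\<close>; the remaining labels form a null set, harmless by completeness.\<close>

lemma distortion_event_measurable:
  assumes f: "graph_clustering_method f" and M: "graphon M" and n: "1 \<le> n" and e: "0 < e"
  shows "distortion_event f W M e n \<in> sets (label_measure W n)"
proof -
  let ?Q = "completion (sample_space n)"
  let ?d = "\<lambda>G x. merge_distortion (x ` {1..n}) M (merge_height M (relabel (f n G) x))"
  have "{x \<in> space ?Q. e < ?d G x} \<in> sets ?Q" if G: "G \<in> graphs n" for G
  proof (cases "n = 1")
    case True
    have "{\<bar>M s s' - merge_height M (relabel (f n G) x) s s'\<bar> |s s'. s \<in> x ` {1..n} \<and> s' \<in> x ` {1..n} \<and> s \<noteq> s'} = {}" for x
      using True by auto
    \<comment> \<open>With one vertex there are no pairs. \<open>Max {}\<close> is unspecified but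
      independent of \<open>x\<close>, so the event is empty or everything.\<close>
    then have "?d G x = Max {}" for x unfolding merge_distortion_def by presburger
    then show ?thesis by simp
  next
    case False
    then have n2: "2 \<le> card {1..n}" using n by simp
    have cl: "clustering {1..n} (f n G)" using f n G unfolding graph_clustering_method_def by blast
    let ?A = "smallest_cluster (f n G)"
    let ?E = "{x \<in> space ?Q. \<exists>i\<in>{1..n}. \<exists>j\<in>{1..n}. i \<noteq> j \<and> (\<exists>u\<in>?A i j. \<exists>v\<in>?A i j.
       u \<noteq> v \<and> e < M (x i) (x j) - M (x u) (x v))}"
    have sub: "?A i j \<subseteq> {1..n}" if "i \<in> {1..n}" "j \<in> {1..n}" for i j
      using smallest_cluster_in[OF cl _ that] cl unfolding clustering_def by auto
    have E: "?E \<in> sets ?Q"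
    proof (intro sets.sets_Collect_finite_Ex finite_atLeastAtMost)
      fix i j assume ij: "i \<in> {1..n}" "j \<in> {1..n}"
      have fin: "finite (?A i j)" using sub[OF ij] by (rule finite_subset) simp
      show "{x \<in> space ?Q. i \<noteq> j \<and> (\<exists>u\<in>?A i j. \<exists>v\<in>?A i j. u \<noteq> v \<and> e < M (x i) (x j) - M (x u) (x v))} \<in> sets ?Q"
      proof (cases "i = j")
        case False
        have base: "{x \<in> space ?Q. u \<noteq> v \<and> e < M (x i) (x j) - M (x u) (x v)} \<in> sets ?Q"
          if "u \<in> ?A i j" "v \<in> ?A i j" for u v
        proof (cases "u = v")
          case uv: False
          have "(\<lambda>x. M (x i) (x j) - M (x u) (x v)) \<in> borel_measurable ?Q"
            using ij False uv that sub[OF ij]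
            by (intro borel_measurable_diff graphon_sample_measurable[OF M]) auto
          then have "{x \<in> space ?Q. e < M (x i) (x j) - M (x u) (x v)} \<in> sets ?Q"
            by (intro borel_measurable_less borel_measurable_const)
          then show ?thesis using uv by simp
        qed simp
        have "{x \<in> space ?Q. \<exists>u\<in>?A i j. \<exists>v\<in>?A i j. u \<noteq> v \<and> e < M (x i) (x j) - M (x u) (x v)} \<in> sets ?Q"
          by (rule sets.sets_Collect_finite_Ex[OF sets.sets_Collect_finite_Ex[OF base fin] fin])
        then show ?thesis using False by (simp only: simp_thms)
      qed simp
    qed
    have "AE x in ?Q. inj_on x {1..n}" by (rule AE_completion[OF AE_sample_inj])
    then have "AE x in ?Q. x \<in> ?E \<longleftrightarrow> x \<in> {x \<in> space ?Q. e < ?d G x}"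
      by (rule eventually_mono) (simp add: less_merge_distortion_iff[OF cl _ n2 _ e])
    then show ?thesis by (rule completion.in_sets_AE[OF _ E]) auto
  qed
  then have "(\<Union>G\<in>graphs n. {G} \<times> {x \<in> space ?Q. e < ?d G x}) \<in> sets (count_space (graphs n) \<Otimes>\<^sub>M ?Q)"
    by (intro sets.finite_UN finite_graphs pair_measureI) auto
  moreover have "distortion_event f W M e n = (\<Union>G\<in>graphs n. {G} \<times> {x \<in> space ?Q. e < ?d G x})"
    unfolding distortion_event_def space_label_measure by auto
  ultimately show ?thesis unfolding sets_label_measure by simp
qed

section \<open>Cells in a random sample\<close>

lemma cells_oscillation:
  assumes "cells W \<epsilon> \<K>" "K \<in> \<K>" "K' \<in> \<K>" "x \<in> K" "x' \<in> K" "y \<in> K'" "y' \<in> K'"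
  shows "\<bar>W x y - W x' y'\<bar> \<le> \<epsilon>"
  using assms unfolding cells_def by blast

lemma cells_mono:
  assumes "cells W \<epsilon> \<K>" "\<epsilon> \<le> \<epsilon>'"
  shows "cells W \<epsilon>' \<K>"
proof -
  have "\<bar>W x y - W x' y'\<bar> \<le> \<epsilon>'"
    if "K \<in> \<K>" "K' \<in> \<K>" "x \<in> K" "x' \<in> K" "y \<in> K'" "y' \<in> K'" for K K' x x' y y'
  proof -
    have "\<bar>W x y - W x' y'\<bar> \<le> \<epsilon>" by (rule cells_oscillation[OF assms(1) that])
    then show ?thesis using assms(2) by simp
  qed
  then show ?thesis using assms(1) unfolding cells_def by simp
qed

lemma cells_measure_lower:
  assumes "cells W \<epsilon> \<K>"
  shows "\<exists>\<beta>>0. \<forall>K\<in>\<K>. \<beta> \<le> measure lebesgue K / 4"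
proof -
  \<comment> \<open>The 1 guards against an empty family, for which \<open>Min\<close> would be
    unspecified.\<close>
  let ?S = "insert 1 ((\<lambda>K. measure lebesgue K / 4) ` \<K>)"
  have fin: "finite ?S" using assms unfolding cells_def by simp
  have "0 < measure lebesgue K" if "K \<in> \<K>" for K
    using assms that unit_measure_pos_iff[of K] unfolding cells_def by auto
  then have "0 < Min ?S" using fin by (subst Min_gr_iff) auto
  moreover have "\<forall>K\<in>\<K>. Min ?S \<le> measure lebesgue K / 4" using fin by (intro ballI Min_le) auto
  ultimately show ?thesis by blast
qed

definition sparse_samples :: "real set set \<Rightarrow> real \<Rightarrow> nat \<Rightarrow> (nat \<Rightarrow> real) set" where
  "sparse_samples \<K> \<beta> n =
     {x \<in> space (sample_space n). \<exists>K\<in>\<K>. real (card {i \<in> {1..n}. x i \<in> K}) \<le> \<beta> * n}"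

lemma sparse_samples:
  assumes \<K>: "cells W \<epsilon> \<K>" and \<beta>: "\<And>K. K \<in> \<K> \<Longrightarrow> \<beta> \<le> measure lebesgue K / 4"
  shows sparse_samples_sets: "sparse_samples \<K> \<beta> n \<in> sets (completion (sample_space n))"
    and emeasure_sparse_samples: "emeasure (completion (sample_space n)) (sparse_samples \<K> \<beta> n)
      \<le> ennreal (card \<K> * exp (- (\<beta> * n)))"
proof -
  have K: "K \<in> sets borel" "K \<subseteq> {0..1}" if "K \<in> \<K>" for K
    using \<K> that unfolding cells_def by auto
  have fin: "finite \<K>" using \<K> unfolding cells_def by blast
  let ?B = "\<lambda>t K. {x \<in> space (sample_space n). real (card {i \<in> {1..n}. x i \<in> K}) \<le> t}"
  have B: "?B t K \<in> sets (sample_space n)" if "K \<in> \<K>" for t K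
    using sample_count_measurable[OF K(1)[OF that]] by (rule borel_measurable_le) simp
  have eq: "sparse_samples \<K> \<beta> n = (\<Union>K\<in>\<K>. ?B (\<beta> * n) K)" unfolding sparse_samples_def by auto
  have sets: "sparse_samples \<K> \<beta> n \<in> sets (sample_space n)" unfolding eq by (intro sets.finite_UN fin B)
  then show "sparse_samples \<K> \<beta> n \<in> sets (completion (sample_space n))" by (rule sets_completionI_sets)
  have "emeasure (completion (sample_space n)) (sparse_samples \<K> \<beta> n) =
      emeasure (sample_space n) (\<Union>K\<in>\<K>. ?B (\<beta> * n) K)"
    using sets by (simp only: emeasure_completion sets_completionI_sets main_part eq[symmetric])
  also have "\<dots> \<le> (\<Sum>K\<in>\<K>. emeasure (sample_space n) (?B (\<beta> * n) K))"
    by (rule emeasure_subadditive_finite[OF fin]) (use B in blast)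
  also have "\<dots> \<le> (\<Sum>K\<in>\<K>. ennreal (exp (- (\<beta> * n))))"
  proof (rule sum_mono)
    fix K assume KK: "K \<in> \<K>"
    let ?\<mu> = "measure lebesgue K"
    have le: "\<beta> * n \<le> ?\<mu> / 4 * n" using \<beta>[OF KK] by (intro mult_right_mono) auto
    have "?B (\<beta> * n) K \<subseteq> ?B (?\<mu> / 4 * n) K" using le by auto
    then have "emeasure (sample_space n) (?B (\<beta> * n) K) \<le> emeasure (sample_space n) (?B (?\<mu> / 4 * n) K)"
      using B[OF KK] by (rule emeasure_mono)
    also have "\<dots> \<le> ennreal (exp (- (?\<mu> / 4 * n)))" by (rule sample_occupancy_upper[OF K[OF KK]])
    also have "\<dots> \<le> ennreal (exp (- (\<beta> * n)))" using le by (intro ennreal_leI) simp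
    finally show "emeasure (sample_space n) (?B (\<beta> * n) K) \<le> ennreal (exp (- (\<beta> * n)))" .
  qed
  also have "\<dots> = ennreal (card \<K> * exp (- (\<beta> * n)))" by (simp add: ennreal_mult' ennreal_of_nat_eq_real_of_nat)
  finally show "emeasure (completion (sample_space n)) (sparse_samples \<K> \<beta> n)
      \<le> ennreal (card \<K> * exp (- (\<beta> * n)))" .
qed

lemma AE_sample_in_cells:
  assumes "cells W \<epsilon> \<K>"
  shows "AE x in sample_space n. \<forall>i\<in>{1..n}. x i \<in> \<Union>\<K>"
proof (intro AE_ball_countable[OF countable_finite, THEN iffD2] finite_atLeastAtMost ballI)
  fix i assume i: "i \<in> {1..n}"
  have "AE y in lebesgue. y \<notin> {0..1} - \<Union>\<K>" using assms unfolding cells_def by (intro AE_not_in) blast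
  then have "AE y in unit_lebesgue. y \<in> \<Union>\<K>"
    by (subst AE_restrict_space_iff) (auto elim: eventually_mono)
  then show "AE x in sample_space n. x i \<in> \<Union>\<K>"
    using i by (intro AE_PiM_component prob_space_unit_lebesgue) auto
qed

lemma AE_sample_mergeon_cells:
  assumes "graphon W" "mergeon W M" "cells W \<epsilon> \<K>" "0 < \<epsilon>"
  shows "AE x in sample_space n. \<forall>i\<in>{1..n}. \<forall>j\<in>{1..n}. i \<noteq> j \<longrightarrow>
    (\<forall>K\<in>\<K>. \<forall>K'\<in>\<K>. x i \<in> K \<longrightarrow> x j \<in> K' \<longrightarrow>
      (\<forall>l. (K, K') \<in> (cell_rel W \<K> l)\<^sup>+ \<longrightarrow> l - \<epsilon> \<le> M (x i) (x j)) \<and>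
      (K, K') \<in> (cell_rel W \<K> (M (x i) (x j) - 3 * \<epsilon>))\<^sup>+)"
  (is "AE x in _. \<forall>i\<in>_. \<forall>j\<in>_. i \<noteq> j \<longrightarrow> ?R (x i) (x j)")
proof (intro AE_ball_countable[OF countable_finite, THEN iffD2] finite_atLeastAtMost ballI)
  fix i j assume ij: "i \<in> {1..n}" "j \<in> {1..n}"
  show "AE x in sample_space n. i \<noteq> j \<longrightarrow> ?R (x i) (x j)"
  proof (cases "i = j")
    case False
    have "AE x in sample_space n. ?R (x i) (x j)"
      by (rule AE_sample_pair[OF ij False mergeon_cells_AE[OF assms]])
    then show ?thesis by (rule eventually_mono) (rule impI)
  qed simp
qed

text \<open>The union names the cell of a point without a choice and is defined for all points; it
  serves as the labellings \<open>\<kappa>\<close> and \<open>\<kappa>'\<close>.\<close>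

lemma cell_Union_eq:
  assumes "cells W \<epsilon> \<K>" "K \<in> \<K>" "y \<in> K"
  shows "\<Union>{K' \<in> \<K>. y \<in> K'} = K"
proof -
  have "K' = K" if "K' \<in> \<K>" "y \<in> K'" for K'
    using assms that unfolding cells_def by (meson disjointD disjoint_iff)
  then show ?thesis using assms by blast
qed

context sampled_graphon
begin

lemma cell_oscillation:
  assumes \<K>: "cells W \<epsilon> \<K>" and cover: "\<And>i. i \<in> V \<Longrightarrow> x i \<in> \<Union>\<K>"
    and i: "i \<in> V" "i' \<in> V" "l \<in> V" and eq: "\<Union>{K \<in> \<K>. x i \<in> K} = \<Union>{K \<in> \<K>. x i' \<in> K}"
  shows "\<bar>w i l - w i' l\<bar> \<le> \<epsilon>"
proof -
  obtain K where K: "K \<in> \<K>" "x i \<in> K" using cover[OF i(1)] by blast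
  obtain K' where K': "K' \<in> \<K>" "x i' \<in> K'" using cover[OF i(2)] by blast
  obtain L where L: "L \<in> \<K>" "x l \<in> L" using cover[OF i(3)] by blast
  have "K = K'" using cell_Union_eq[OF \<K> K] cell_Union_eq[OF \<K> K'] eq by simp
  then show ?thesis using cells_oscillation[OF \<K> K(1) L(1) K(2) _ L(2) L(2)] K' by blast
qed

lemma cell_count:
  assumes \<K>: "cells W \<epsilon> \<K>" and cover: "\<And>i. i \<in> V \<Longrightarrow> x i \<in> \<Union>\<K>"
    and dense: "\<And>K. K \<in> \<K> \<Longrightarrow> b < real (card {i \<in> V. x i \<in> K})" and i: "i \<in> V"
  shows "b < real (card {i' \<in> V. \<Union>{K \<in> \<K>. x i' \<in> K} = \<Union>{K \<in> \<K>. x i \<in> K}})"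
proof -
  obtain K where K: "K \<in> \<K>" "x i \<in> K" using cover[OF i] by blast
  have "{i' \<in> V. x i' \<in> K} \<subseteq> {i' \<in> V. \<Union>{K \<in> \<K>. x i' \<in> K} = \<Union>{K \<in> \<K>. x i \<in> K}}"
    using cell_Union_eq[OF \<K> K(1)] K(2) by auto
  then have "card {i' \<in> V. x i' \<in> K} \<le> card {i' \<in> V. \<Union>{K \<in> \<K>. x i' \<in> K} = \<Union>{K \<in> \<K>. x i \<in> K}}"
    by (intro card_mono) auto
  then show ?thesis using dense[OF K(1)] by linarith
qed

lemma merge_distortion_le:
  assumes G: "G \<in> graphs n" and n: "2 \<le> n" and inj: "inj_on x V"
    and \<K>: "cells W \<epsilon> \<K>" and cover: "\<And>i. i \<in> V \<Longrightarrow> x i \<in> \<Union>\<K>"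
    and hit: "\<And>K. K \<in> \<K> \<Longrightarrow> \<exists>i\<in>V. x i \<in> K"
    and M: "\<And>i j K K'. i \<in> V \<Longrightarrow> j \<in> V \<Longrightarrow> i \<noteq> j \<Longrightarrow> K \<in> \<K> \<Longrightarrow> K' \<in> \<K> \<Longrightarrow> x i \<in> K \<Longrightarrow> x j \<in> K' \<Longrightarrow>
      (\<forall>l. (K, K') \<in> (cell_rel W \<K> l)\<^sup>+ \<longrightarrow> l - \<epsilon> \<le> M (x i) (x j)) \<and>
      (K, K') \<in> (cell_rel W \<K> (M (x i) (x j) - 3 * \<epsilon>))\<^sup>+"
    and close: "\<And>i j. i \<in> V \<Longrightarrow> j \<in> V \<Longrightarrow> i \<noteq> j \<Longrightarrow> \<bar>smoothed C n (adjacency G) i j - w i j\<bar> \<le> \<epsilon>"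
    and e: "0 < e" "7 * \<epsilon> \<le> e"
  shows "\<not> e < merge_distortion (x ` V) M (merge_height M (relabel (nbhd_smoothing_clustering C n G) x))"
proof
  let ?P = "smoothed C n (adjacency G)"
  assume "e < merge_distortion (x ` V) M (merge_height M (relabel (nbhd_smoothing_clustering C n G) x))"
  moreover have "clustering V (nbhd_smoothing_clustering C n G)"
    using graph_clustering_method_nbhd_smoothing G n unfolding graph_clustering_method_def by auto
  ultimately obtain i j u v where ij: "i \<in> V" "j \<in> V" "i \<noteq> j"
    and uv: "u \<in> smallest_cluster (single_linkage V ?P) i j" "v \<in> smallest_cluster (single_linkage V ?P) i j" "u \<noteq> v"
    and less: "e < M (x i) (x j) - M (x u) (x v)"
    using less_merge_distortion_iff[OF _ _ _ inj e(1), of "nbhd_smoothing_clustering C n G" M] n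
    unfolding nbhd_smoothing_clustering_def by auto
  have "M (x i) (x j) - M (x u) (x v) \<le> 7 * \<epsilon>"
  proof (rule single_linkage_merge_close[where P = ?P and W = W and x = x and \<K> = \<K>, OF _ _ _ close _ cover hit _ _ ij uv])
    show "?P i j = ?P j i" for i j by (rule smoothed_sym)
    show "\<bar>W a b - W a' b'\<bar> \<le> \<epsilon>"
      if "K \<in> \<K>" "K' \<in> \<K>" "a \<in> K" "a' \<in> K" "b \<in> K'" "b' \<in> K'" for K K' a a' b b'
      by (rule cells_oscillation[OF \<K> that])
    show "l - \<epsilon> \<le> M (x i) (x j)"
      if "i \<in> V" "j \<in> V" "i \<noteq> j" "K \<in> \<K>" "K' \<in> \<K>" "x i \<in> K" "x j \<in> K'" "(K, K') \<in> (cell_rel W \<K> l)\<^sup>+"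
      for i j K K' l using M[OF that(1-7)] that(8) by blast
    show "(K, K') \<in> (cell_rel W \<K> (M (x i) (x j) - 3 * \<epsilon>))\<^sup>+"
      if "i \<in> V" "j \<in> V" "i \<noteq> j" "K \<in> \<K>" "K' \<in> \<K>" "x i \<in> K" "x j \<in> K'" for i j K K'
      using M[OF that] by blast
  qed (use n in auto)
  then show False using less e by linarith
qed

end

section \<open>Error rates, choice of constants and the limit\<close>

definition error_bound :: "real \<Rightarrow> real \<Rightarrow> real \<Rightarrow> nat \<Rightarrow> real" where
  "error_bound C \<tau> \<epsilon> n = real n ^ 3 * (4 * exp (- (\<tau>\<^sup>2 * real n / 4))) +
     real n ^ 2 * (2 * exp (- (\<epsilon>\<^sup>2 * (bandwidth C n * real (n - 2)) / 4)))"

text \<open>The exponent in the second term is of order \<open>sqrt (n * ln n)\<close>, which beats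
  every power of \<open>n\<close>.\<close>

lemma error_bound_tendsto_0:
  assumes "0 < C" "0 < \<tau>" "0 < \<epsilon>"
  shows "error_bound C \<tau> \<epsilon> \<longlonglongrightarrow> 0"
proof -
  define a where "a = \<epsilon>\<^sup>2 * C / 4"
  define t where "t = \<tau>\<^sup>2 / 4"
  have pos: "0 < a" "0 < t" using assms by (auto simp: a_def t_def)
  have 1: "(\<lambda>n. real n ^ 3 * (4 * exp (- (t * real n)))) \<longlonglongrightarrow> 0" using pos by real_asymp
  have 2: "(\<lambda>n. real n ^ 2 * (2 * exp (- (a * (sqrt (ln (real n) / real n) * (real n - 2)))))) \<longlonglongrightarrow> 0"
    using pos by real_asymp
  have "\<forall>\<^sub>F n in sequentially. real n ^ 3 * (4 * exp (- (t * real n))) +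
      real n ^ 2 * (2 * exp (- (a * (sqrt (ln (real n) / real n) * (real n - 2))))) = error_bound C \<tau> \<epsilon> n"
    using eventually_ge_at_top[of 2]
  proof eventually_elim
    case (elim n)
    have "\<tau>\<^sup>2 * real n / 4 = t * real n" by (simp add: t_def)
    moreover have "\<epsilon>\<^sup>2 * (bandwidth C n * real (n - 2)) / 4 = a * (sqrt (ln (real n) / real n) * (real n - 2))"
      using elim by (simp only: a_def bandwidth_def of_nat_diff) simp
    ultimately show ?case unfolding error_bound_def by (simp only:)
  qed
  then show ?thesis using tendsto_add[OF 1 2] by (simp add: filterlim_cong)
qed

text \<open>The bandwidth tends to 0, so a cell with a fixed fraction of the sample eventually holds
  more points than the quantile asks for.\<close>

lemma eventually_bandwidth_le:
  assumes "0 < C" "0 < \<beta>"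
  shows "\<forall>\<^sub>F n in sequentially. bandwidth C n * real (n - 2) + 2 \<le> \<beta> * real n"
proof -
  have "(\<lambda>n. (C * sqrt (ln (real n) / real n) * (real n - 2) + 2) / real n) \<longlonglongrightarrow> 0"
    using assms(1) by real_asymp
  then have "\<forall>\<^sub>F n in sequentially. (C * sqrt (ln (real n) / real n) * (real n - 2) + 2) / real n < \<beta>"
    using assms(2) by (rule order_tendstoD)
  then show ?thesis
    using eventually_ge_at_top[of 2]
    by eventually_elim (simp add: bandwidth_def of_nat_diff field_simps)
qed

theorem corollary1:
  fixes W :: "real \<Rightarrow> real \<Rightarrow> real" and C :: real
  assumes "graphon W"
    and "piecewise_lipschitz W"
    and "0 < C" and "C < 1"
  shows "consistent_estimator (nbhd_smoothing_clustering C) W"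
  unfolding consistent_estimator_def
proof (intro conjI allI impI graph_clustering_method_nbhd_smoothing; elim conjE)
  fix M and e :: real assume M: "mergeon W M" and e: "0 < e"
  let ?E = "distortion_event (nbhd_smoothing_clustering C) W M e"
  have gM: "graphon M" using M unfolding mergeon_def by blast
  note W = assms(1)
  show sets: "?E n \<in> sets (label_measure W n)" if "1 \<le> n" for n
    by (rule distortion_event_measurable[OF graph_clustering_method_nbhd_smoothing gM that e])
  \<comment> \<open>The smoothed matrix is accurate to \<open>2 * \<epsilon>\<close> and single
    linkage multiplies this by 7. The cap keeps \<open>\<epsilon>\<close> in the range of the tail
    bounds.\<close>
  define \<epsilon> where "\<epsilon> = min (e / 7) 1 / 2"
  have \<epsilon>: "0 < \<epsilon>" "\<epsilon> \<le> 2" "7 * (2 * \<epsilon>) \<le> e" using e by (auto simp: \<epsilon>_def min_def)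
  obtain \<K>' where \<K>': "cells W (\<epsilon> / 4) \<K>'" using piecewise_lipschitz_cells[OF assms(2), of "\<epsilon> / 4"] \<epsilon> by auto
  obtain \<beta> where \<beta>: "0 < \<beta>" "\<And>K. K \<in> \<K>' \<Longrightarrow> \<beta> \<le> measure lebesgue K / 4"
    using cells_measure_lower[OF \<K>'] by blast
  define \<delta> where "\<delta> = \<beta> * \<epsilon>\<^sup>2 / 4"
  have \<delta>: "0 < \<delta>" using \<beta> \<epsilon> by (simp add: \<delta>_def)
  obtain \<K> where \<K>: "cells W (\<delta> / 16) \<K>" using piecewise_lipschitz_cells[OF assms(2), of "\<delta> / 16"] \<delta> by auto
  obtain \<beta>\<^sub>1 where \<beta>\<^sub>1: "0 < \<beta>\<^sub>1" "\<And>K. K \<in> \<K> \<Longrightarrow> \<beta>\<^sub>1 \<le> measure lebesgue K / 4"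
    using cells_measure_lower[OF \<K>] by blast
  \<comment> \<open>Fine cells and counts each use a quarter of the budget \<open>\<delta>\<close>:
    \<open>4 * (\<delta> / 16)\<close> and at most \<open>24 * (\<delta> / 96)\<close>. The cap 2 is
    required by the tail bound.\<close>
  define \<tau> where "\<tau> = min (\<delta> / 96) 2"
  have \<tau>: "0 < \<tau>" "\<tau> \<le> 2" "4 * (\<delta> / 16) + 24 * \<tau> < \<beta> * \<epsilon>\<^sup>2 / 4"
    using \<delta> unfolding \<delta>_def[symmetric] by (auto simp: \<tau>_def min_def)
  define b where "b n = real (card \<K>) * exp (- (\<beta>\<^sub>1 * n)) + real (card \<K>') * exp (- (\<beta> * n)) + error_bound C \<tau> \<epsilon> n" for n
  have decay: "(\<lambda>n. c * exp (- (\<gamma> * real n))) \<longlonglongrightarrow> 0" if "0 < \<gamma>" for c \<gamma> :: real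
  proof -
    have "(\<lambda>n. exp (- (\<gamma> * real n))) \<longlonglongrightarrow> 0" using that by real_asymp
    then show ?thesis by (rule tendsto_mult_right_zero)
  qed
  from tendsto_add[OF tendsto_add[OF decay[OF \<beta>\<^sub>1(1)] decay[OF \<beta>(1)]] error_bound_tendsto_0[OF assms(3) \<tau>(1) \<epsilon>(1)]]
  have b: "b \<longlonglongrightarrow> 0" unfolding b_def by simp
  have "\<forall>\<^sub>F n in sequentially. 3 / real n \<le> \<tau> \<and> 4 \<le> \<beta>\<^sub>1 * real n"
  proof -
    have "(\<lambda>n. 3 / real n) \<longlonglongrightarrow> 0" by real_asymp
    then have "\<forall>\<^sub>F n in sequentially. 3 / real n < \<tau>" using \<tau>(1) by (rule order_tendstoD)
    moreover have "filterlim (\<lambda>n. \<beta>\<^sub>1 * real n) at_top sequentially" using \<beta>\<^sub>1(1) by real_asymp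
    then have "\<forall>\<^sub>F n in sequentially. 4 \<le> \<beta>\<^sub>1 * real n" by (simp add: filterlim_at_top)
    ultimately show ?thesis by eventually_elim simp
  qed
  then have "\<forall>\<^sub>F n in sequentially. measure (label_measure W n) (?E n) \<le> b n"
    using eventually_bandwidth_le[OF assms(3) \<beta>\<^sub>1(1)] eventually_ge_at_top[of 4]
  proof eventually_elim
    case (elim n)
    let ?Q = "completion (sample_space n)"
    let ?S = "sparse_samples \<K> \<beta>\<^sub>1 n \<union> sparse_samples \<K>' \<beta> n"
    have S: "?S \<in> sets ?Q"
      using sparse_samples_sets[OF \<K> \<beta>\<^sub>1(2)] sparse_samples_sets[OF \<K>' \<beta>(2)] by (rule sets.Un)
    have "emeasure ?Q ?S \<le> emeasure ?Q (sparse_samples \<K> \<beta>\<^sub>1 n) + emeasure ?Q (sparse_samples \<K>' \<beta> n)"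
      using sparse_samples_sets[OF \<K> \<beta>\<^sub>1(2)] sparse_samples_sets[OF \<K>' \<beta>(2)] by (rule emeasure_subadditive)
    also have "\<dots> \<le> ennreal (card \<K> * exp (- (\<beta>\<^sub>1 * n))) + ennreal (card \<K>' * exp (- (\<beta> * n)))"
      by (intro add_mono emeasure_sparse_samples[OF \<K> \<beta>\<^sub>1(2)] emeasure_sparse_samples[OF \<K>' \<beta>(2)])
    also have "\<dots> = ennreal (card \<K> * exp (- (\<beta>\<^sub>1 * n)) + card \<K>' * exp (- (\<beta> * n)))"
      by (rule ennreal_plus[symmetric]) auto
    finally have S': "emeasure ?Q ?S \<le> ennreal (card \<K> * exp (- (\<beta>\<^sub>1 * n)) + card \<K>' * exp (- (\<beta> * n)))" .
    \<comment> \<open>The coarse cells also carry the bottleneck paths, with the tolerance relaxed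
      to the accuracy of the smoothed matrix.\<close>
    have \<K>'': "cells W (2 * \<epsilon>) \<K>'" using \<epsilon> by (intro cells_mono[OF \<K>']) auto
    have "AE x in ?Q. x \<in> space ?Q" by (rule AE_space)
    moreover have "AE x in ?Q. inj_on x {1..n}" by (rule AE_completion[OF AE_sample_inj])
    moreover have "AE x in ?Q. \<forall>i\<in>{1..n}. x i \<in> \<Union>\<K>" by (rule AE_completion[OF AE_sample_in_cells[OF \<K>]])
    moreover have "AE x in ?Q. \<forall>i\<in>{1..n}. x i \<in> \<Union>\<K>'" by (rule AE_completion[OF AE_sample_in_cells[OF \<K>']])
    moreover have "0 < 2 * \<epsilon>" using \<epsilon> by simp
    note AE_completion[OF AE_sample_mergeon_cells[OF W M \<K>'' this, of n]]
    ultimately have "AE x in ?Q. x \<notin> ?S \<longrightarrow>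
        bern_prob (edge_prob W x) (edges n) (\<lambda>G. (G, x) \<in> ?E n) \<le> error_bound C \<tau> \<epsilon> n"
    proof eventually_elim
      case h: (elim x)
      interpret sampled_graphon W n x
        using W h(1) space_sample_space[of x n] by unfold_locales auto
      show ?case
      proof
        assume "x \<notin> ?S"
        then have dense: "\<And>K. K \<in> \<K> \<Longrightarrow> \<beta>\<^sub>1 * n < real (card {i \<in> V. x i \<in> K})"
          and dense': "\<And>K. K \<in> \<K>' \<Longrightarrow> \<beta> * n < real (card {i \<in> V. x i \<in> K})"
          using h(1) unfolding sparse_samples_def by (auto simp: not_le)
        have cover: "x i \<in> \<Union>\<K>" and cover': "x i \<in> \<Union>\<K>'" if "i \<in> V" for i using h(3,4) that by auto
        let ?far = "\<lambda>G. \<exists>i\<in>V. \<exists>j\<in>V. i \<noteq> j \<and> \<not> \<bar>smoothed C n (adjacency G) i j - w i j\<bar> \<le> 2 * \<epsilon>"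
        have "P (\<lambda>G. (G, x) \<in> ?E n) \<le> P ?far"
        proof (rule bern_prob_mono[OF finite_edges p])
          fix G assume G: "G \<subseteq> edges n" and E: "(G, x) \<in> ?E n"
          show "?far G"
          proof (rule ccontr)
            assume near: "\<not> ?far G"
            have "\<not> e < merge_distortion (x ` V) M (merge_height M (relabel (nbhd_smoothing_clustering C n G) x))"
            proof (rule merge_distortion_le[OF _ _ h(2) \<K>'' cover' _ _ _ e \<epsilon>(3)])
              show "G \<in> graphs n" using G by (simp add: graphs_eq)
              show "2 \<le> n" using elim by simp
              show "\<exists>i\<in>V. x i \<in> K" if "K \<in> \<K>'" for K
              proof -
                have "0 \<le> \<beta> * n" using \<beta>(1) by simp
                then have "card {i \<in> V. x i \<in> K} \<noteq> 0" using dense'[OF that] by linarith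
                then have "{i \<in> V. x i \<in> K} \<noteq> {}" by (metis card.empty)
                then show ?thesis by blast
              qed
              show "(\<forall>l. (K, K') \<in> (cell_rel W \<K>' l)\<^sup>+ \<longrightarrow> l - 2 * \<epsilon> \<le> M (x i) (x j)) \<and>
                  (K, K') \<in> (cell_rel W \<K>' (M (x i) (x j) - 3 * (2 * \<epsilon>)))\<^sup>+"
                if "i \<in> V" "j \<in> V" "i \<noteq> j" "K \<in> \<K>'" "K' \<in> \<K>'" "x i \<in> K" "x j \<in> K'" for i j K K'
                using h(5) that by blast
              show "\<bar>smoothed C n (adjacency G) i j - w i j\<bar> \<le> 2 * \<epsilon>" if "i \<in> V" "j \<in> V" "i \<noteq> j" for i j
                using near that by blast
            qed
            then show False using E unfolding distortion_event_def by simp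
          qed
        qed
        also have "P ?far \<le> error_bound C \<tau> \<epsilon> n"
          unfolding error_bound_def
        proof (rule bern_prob_smoothed_far[OF assms(3,4) _ _ _ _ _ \<epsilon>(1,2) less_imp_le[OF \<tau>(1)] \<tau>(2) _ \<tau>(3)])
          show "\<bar>w i l - w i' l\<bar> \<le> \<delta> / 16"
            if "i \<in> V" "i' \<in> V" "l \<in> V" "\<Union>{K \<in> \<K>. x i \<in> K} = \<Union>{K \<in> \<K>. x i' \<in> K}" for i i' l
            by (rule cell_oscillation[OF \<K> cover that])
          show "\<bar>w i l - w i' l\<bar> \<le> \<epsilon> / 4"
            if "i \<in> V" "i' \<in> V" "l \<in> V" "\<Union>{K \<in> \<K>'. x i \<in> K} = \<Union>{K \<in> \<K>'. x i' \<in> K}" for i i' l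
            by (rule cell_oscillation[OF \<K>' cover' that])
          show "\<beta> * n \<le> real (card {i' \<in> V. \<Union>{K \<in> \<K>'. x i' \<in> K} = \<Union>{K \<in> \<K>'. x i \<in> K}})" if "i \<in> V" for i
            using cell_count[OF \<K>' cover' dense' that] by (rule less_imp_le)
          show "4 \<le> card {i' \<in> V. \<Union>{K \<in> \<K>. x i' \<in> K} = \<Union>{K \<in> \<K>. x i \<in> K}} \<and>
              bandwidth C n * real (n - 2) + 2 \<le> real (card {i' \<in> V. \<Union>{K \<in> \<K>. x i' \<in> K} = \<Union>{K \<in> \<K>. x i \<in> K}})"
            if "i \<in> V" for i
            using cell_count[OF \<K> cover dense that] elim(1,2) by linarith
        qed (use elim in auto)
        finally show "P (\<lambda>G. (G, x) \<in> ?E n) \<le> error_bound C \<tau> \<epsilon> n" .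
      qed
    qed
    then have "emeasure (label_measure W n) (?E n) \<le> ennreal (b n)"
      unfolding b_def using elim(3)
      by (intro emeasure_label_measure_le[OF W sets S S']) (auto simp: error_bound_def)
    then show ?case
      unfolding measure_def by (rule enn2real_leI[rotated]) (simp add: b_def error_bound_def)
  qed
  then show "(\<lambda>n. measure (label_measure W n) (?E n)) \<longlonglongrightarrow> 0"
    by (intro tendsto_sandwich[OF _ _ tendsto_const b]) auto
qed

end
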